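(* For every real $\varphi\in W_2^1[-\tau,0]$, the boundary value problem $\mathcal B$ has a unique solution $y\in W_2^1(\mathcal T_\tau)\cap W_2^2(\widetilde{\mathcal T})$. Moreover, there exists a constant $C_2>0$, independent of $\varphi$, such that $$\|y\|_{W_2^1(\mathcal T_\tau)}\le C_2\|\varphi\|_{W_2^1[-\tau,0]}.$$ Consequently, the variational problem (VP) is uniquely solvable.
   Context: Tree setup. Fix integers $m\ge 1$ and $0\le d<m$. Let $\mathcal T$ be a compact rooted tree with vertices $v_0,v_1,\dots,v_m$ and edges $e_1,\dots,e_m$. Here $e_j=[v_{k_j},v_j]$, with $k_1=0$ and $k_j\in\{1,\dots,d\}$ for $j=2,\dots,m$. The map $j\mapsto k_j$ is such that iterating it from any $j$ eventually reaches $1$ and then $0$, so the graph is a tree. The vertices $v_0,v_{d+1},\dots,v_m$ are the boundary vertices (each incident to exactly one edge). The vertices $v_1,\dots,v_d$ are internal. The root is $v_0$. For $j=0,\dots,d$ put $V_j:=\{\nu\in\{1,\dots,m\}: k_\nu=j\}$, the indices of the edges emanating from $v_j$. Thus $V_0=\{1\}$, and $V_j\neq\emptyset$ for $j=1,\dots,d$. Lengths and delay. Edge $e_j$ has length $T_j>0$ and is parametrized by $t\in[0,T_j]$, with $t=0$ at $v_{k_j}$ and $t=T_j$ at $v_j$. Fix $\tau\ge0$ with $\tau<T_j$ for all $j$. Set $l_j:=T_j$ for $j=1,\dots,d$ and $l_j:=T_j-\tau$ for $j=d+1,\dots,m$. Functions and spaces. A function on $\mathcal T_\tau$ is a tuple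 $y=[y_1,\dots,y_m]$ of real functions with $y_1$ defined on $[-\tau,T_1]$ and $y_j$ defined on $[0,T_j]$ for $j\ge2$. We use the following Sobolev spaces: - $W_2^k(\mathcal T_\tau):=W_2^k[-\tau,T_1]\oplus\bigoplus_{j=2}^mW_2^k[0,T_j]$; - $W_2^k(\mathcal T):=\bigoplus_{j=1}^mW_2^k[0,T_j]$; - $L_2(\mathcal T):=\bigoplus_{j=1}^m L_2(0,T_j)$. Each carries the sum of the componentwise norms squared. We write $y\in W_2^2(\widetilde{\mathcal T})$ if $y_j|_{[0,l_j]}\in W_2^2[0,l_j]$ for every $j$. Operators. Fix real constants $b_j,c_j$ for $j=1,\dots,m$. Define $$\ell_jy(t):=y_j'(t)+b_jy_j(t)+c_jy_j(t-\tau),\qquad 0<t<T_j,$$ with the following convention: for $j\ge2$ and $t\in(0,\tau)$, the value $y_j(t-\tau)$ means $y_{k_j}(t-\tau+T_{k_j})$. For $j=1$, the value $y_1(t-\tau)$ uses $y_1$ on $[-\tau,0]$. Set $$\mathcal J(y):=\sum_{j=1}^m\int_0^{T_j}(\ell_jy(t))^2\,dt.$$ Conditions. - (C): $y_j(0)=y_{k_j}(T_{k_j})$ for $j=2,\dots,m$. - (I): $y_1=\varphi$ on $[-\tau,0]$. - (Z): $y_j=0$ on $[T_j-\tau,T_j]$ for $j=d+1,\dots,m$. Variational problem (VP): find $y\in W_2^1(\mathcal T_\tau)$ satisfying (C), (I), (Z) that minimizes $\mathcal J$ among all such functions. Boundary value problem $\mathcal B$. Define $$\tilde\ell_jy(t):=\begin{cases}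 c_j\ell_jy(t+\tau), & 0<t<T_j-\tau,\ j=1,\dots,m,\\ \sum_{\nu\in V_j}c_\nu\ell_\nu y(t+\tau-T_j), & T_j-\tau<t<T_j,\ j=1,\dots,d,\end{cases}$$ and $$\mathcal L_jy:=-(\ell_jy)'+b_j\ell_jy+\tilde\ell_jy.$$ Also set $\beta_j:=b_j-\sum_{\nu\in V_j}b_\nu$ and $\gamma_j:=c_j-\sum_{\nu\in V_j}c_\nu$. A solution of $\mathcal B$ is a $y\in W_2^1(\mathcal T_\tau)\cap W_2^2(\widetilde{\mathcal T})$ such that: - $y$ satisfies (C), (I), (Z); - $\mathcal L_jy=0$ a.e. on $(0,l_j)$, for each $j$; - the following conditions hold: $$y_j'(T_j)-\sum_{\nu\in V_j}y_\nu'(0)+\beta_jy_j(T_j)+\gamma_jy_j(T_j-\tau)=0,\qquad j=1,\dots,d.$$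
   Formalization: The delay is assumed positive, τ > 0, instead of τ ≥ 0: for τ = 0 the interval [-τ,0] is a point, the norm of φ is zero and the stated estimate fails whenever φ(0) ≠ 0; unique solvability at τ = 0 is not covered. *)

theory Defs
  imports "HOL-Analysis.Analysis"
begin

section \<open>Sobolev spaces on a compact interval (functions = continuous representatives)\<close>

definition L2_on :: "real \<Rightarrow> real \<Rightarrow> (real \<Rightarrow> real) \<Rightarrow> bool" where
  "L2_on a b g \<longleftrightarrow> g \<in> borel_measurable (lebesgue_on {a..b})
      \<and> integrable (lebesgue_on {a..b}) (\<lambda>t. (g t)\<^sup>2)"

text \<open>g is a weak (L2) derivative of f on [a,b]; f is the absolutely continuous representative.\<close>
definition is_wderiv :: "real \<Rightarrow> real \<Rightarrow> (real \<Rightarrow> real) \<Rightarrow> (real \<Rightarrow> real) \<Rightarrow> bool" where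
  "is_wderiv a b f g \<longleftrightarrow> L2_on a b g
      \<and> (\<forall>x\<in>{a..b}. f x = f a + integral\<^sup>L (lebesgue_on {a..x}) g)"

definition W21 :: "real \<Rightarrow> real \<Rightarrow> (real \<Rightarrow> real) \<Rightarrow> bool" where
  "W21 a b f \<longleftrightarrow> L2_on a b f \<and> (\<exists>g. is_wderiv a b f g)"

definition W22 :: "real \<Rightarrow> real \<Rightarrow> (real \<Rightarrow> real) \<Rightarrow> bool" where
  "W22 a b f \<longleftrightarrow> W21 a b f \<and> (\<exists>g. is_wderiv a b f g \<and> W21 a b g)"

definition wderiv :: "real \<Rightarrow> real \<Rightarrow> (real \<Rightarrow> real) \<Rightarrow> real \<Rightarrow> real" where
  "wderiv a b f = (SOME g. is_wderiv a b f g)"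

definition W21_norm :: "real \<Rightarrow> real \<Rightarrow> (real \<Rightarrow> real) \<Rightarrow> real" where
  "W21_norm a b f = sqrt (integral\<^sup>L (lebesgue_on {a..b}) (\<lambda>t. (f t)\<^sup>2)
                        + integral\<^sup>L (lebesgue_on {a..b}) (\<lambda>t. (wderiv a b f t)\<^sup>2))"

text \<open>Edge indices 1..m; k j is the index of the initial vertex of edge j.
  A function on the tree is y :: nat => real => real, y j defined on [tleft j, T j].\<close>

definition tleft :: "real \<Rightarrow> nat \<Rightarrow> real" where
  "tleft \<tau> j = (if j = 1 then - \<tau> else 0)"

definition lvec :: "nat \<Rightarrow> real \<Rightarrow> (nat \<Rightarrow> real) \<Rightarrow> nat \<Rightarrow> real" where
  "lvec d \<tau> T j = (if j \<le> d then T j else T j - \<tau>)"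

definition Vset :: "nat \<Rightarrow> (nat \<Rightarrow> nat) \<Rightarrow> nat \<Rightarrow> nat set" where
  "Vset m k j = {\<nu> \<in> {1..m}. k \<nu> = j}"

definition ydel :: "real \<Rightarrow> (nat \<Rightarrow> nat) \<Rightarrow> (nat \<Rightarrow> real) \<Rightarrow> (nat \<Rightarrow> real \<Rightarrow> real) \<Rightarrow> nat \<Rightarrow> real \<Rightarrow> real" where
  "ydel \<tau> k T y j t =
     (if j = 1 then y 1 (t - \<tau>)
      else if t < \<tau> then y (k j) (t - \<tau> + T (k j)) else y j (t - \<tau>))"

text \<open>ell_j y, with dy j playing the role of the derivative y_j'\<close>
definition ell :: "(nat \<Rightarrow> real) \<Rightarrow> (nat \<Rightarrow> real) \<Rightarrow> real \<Rightarrow> (nat \<Rightarrow> nat) \<Rightarrow> (nat \<Rightarrow> real)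
     \<Rightarrow> (nat \<Rightarrow> real \<Rightarrow> real) \<Rightarrow> (nat \<Rightarrow> real \<Rightarrow> real) \<Rightarrow> nat \<Rightarrow> real \<Rightarrow> real" where
  "ell b c \<tau> k T y dy j t = dy j t + b j * y j t + c j * ydel \<tau> k T y j t"

definition ell_tilde :: "nat \<Rightarrow> (nat \<Rightarrow> real) \<Rightarrow> (nat \<Rightarrow> real) \<Rightarrow> real \<Rightarrow> (nat \<Rightarrow> nat) \<Rightarrow> (nat \<Rightarrow> real)
     \<Rightarrow> (nat \<Rightarrow> real \<Rightarrow> real) \<Rightarrow> (nat \<Rightarrow> real \<Rightarrow> real) \<Rightarrow> nat \<Rightarrow> real \<Rightarrow> real" where
  "ell_tilde m b c \<tau> k T y dy j t =
     (if t < T j - \<tau> then c j * ell b c \<tau> k T y dy j (t + \<tau>)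
      else (\<Sum>\<nu>\<in>Vset m k j. c \<nu> * ell b c \<tau> k T y dy \<nu> (t + \<tau> - T j)))"

definition admissible :: "nat \<Rightarrow> nat \<Rightarrow> (nat \<Rightarrow> nat) \<Rightarrow> (nat \<Rightarrow> real) \<Rightarrow> real
     \<Rightarrow> (real \<Rightarrow> real) \<Rightarrow> (nat \<Rightarrow> real \<Rightarrow> real) \<Rightarrow> bool" where
  "admissible m d k T \<tau> \<phi> y \<longleftrightarrow>
     W21 (- \<tau>) (T 1) (y 1) \<and> (\<forall>j\<in>{2..m}. W21 0 (T j) (y j))
     \<and> (\<forall>j\<in>{2..m}. y j 0 = y (k j) (T (k j)))
     \<and> (\<forall>t\<in>{- \<tau>..0}. y 1 t = \<phi> t)
     \<and> (\<forall>j\<in>{d+1..m}. \<forall>t\<in>{T j - \<tau>..T j}. y j t = 0)"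

definition Jfun :: "nat \<Rightarrow> (nat \<Rightarrow> real) \<Rightarrow> (nat \<Rightarrow> real) \<Rightarrow> real \<Rightarrow> (nat \<Rightarrow> nat) \<Rightarrow> (nat \<Rightarrow> real)
     \<Rightarrow> (nat \<Rightarrow> real \<Rightarrow> real) \<Rightarrow> real" where
  "Jfun m b c \<tau> k T y = (\<Sum>j = 1..m. integral\<^sup>L (lebesgue_on {0..T j})
      (\<lambda>t. (ell b c \<tau> k T y (\<lambda>i. wderiv 0 (T i) (y i)) j t)\<^sup>2))"

definition VP_sol where
  "VP_sol m d k T \<tau> b c \<phi> y \<longleftrightarrow> admissible m d k T \<tau> \<phi> y
     \<and> (\<forall>z. admissible m d k T \<tau> \<phi> z \<longrightarrow> Jfun m b c \<tau> k T y \<le> Jfun m b c \<tau> k T z)"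

definition BVP_sol where
  "BVP_sol m d k T \<tau> b c \<phi> y \<longleftrightarrow> admissible m d k T \<tau> \<phi> y
     \<and> (\<forall>j\<in>{1..m}. W22 0 (lvec d \<tau> T j) (y j))
     \<and> (\<exists>dy. (\<forall>j\<in>{1..m}. is_wderiv 0 (T j) (y j) (dy j) \<and> W21 0 (lvec d \<tau> T j) (dy j))
        \<and> (\<forall>j\<in>{1..m}. \<exists>h. is_wderiv 0 (lvec d \<tau> T j) (ell b c \<tau> k T y dy j) h
              \<and> (AE t in lebesgue_on {0<..<lvec d \<tau> T j}.
                   - h t + b j * ell b c \<tau> k T y dy j t + ell_tilde m b c \<tau> k T y dy j t = 0))
        \<and> (\<forall>j\<in>{1..d}. dy j (T j) - (\<Sum>\<nu>\<in>Vset m k j. dy \<nu> 0)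
              + (b j - (\<Sum>\<nu>\<in>Vset m k j. b \<nu>)) * y j (T j)
              + (c j - (\<Sum>\<nu>\<in>Vset m k j. c \<nu>)) * y j (T j - \<tau>) = 0))"

definition eq_on_tree :: "nat \<Rightarrow> real \<Rightarrow> (nat \<Rightarrow> real) \<Rightarrow> (nat \<Rightarrow> real \<Rightarrow> real) \<Rightarrow> (nat \<Rightarrow> real \<Rightarrow> real) \<Rightarrow> bool" where
  "eq_on_tree m \<tau> T y z \<longleftrightarrow> (\<forall>j\<in>{1..m}. \<forall>t\<in>{tleft \<tau> j..T j}. y j t = z j t)"

definition tree_norm :: "nat \<Rightarrow> real \<Rightarrow> (nat \<Rightarrow> real) \<Rightarrow> (nat \<Rightarrow> real \<Rightarrow> real) \<Rightarrow> real" where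
  "tree_norm m \<tau> T y = sqrt (\<Sum>j = 1..m. (W21_norm (tleft \<tau> j) (T j) (y j))\<^sup>2)"

end

theory Submission
  imports Defs
begin

text \<open>
  Write \<open>u = \<ell> y\<close>. Along every edge \<open>y\<close> is determined by \<open>u\<close>, by its initial value and by its
  values on the parent edge, so induction over the tree bounds \<open>y\<close> in \<open>W21\<close> by \<open>\<phi>\<close> and the energy
  \<open>J y = \<parallel>u\<parallel>\<^sup>2\<close>. By the parallelogram identity a minimizing sequence is then Cauchy, and
  completeness of \<open>L\<^sub>2\<close> yields a minimizer, which is characterized by \<open>\<ell> y\<close> being orthogonal to
  \<open>\<ell> w\<close> for all admissible \<open>w\<close> with zero history. Shifting the delay from \<open>w\<close> to \<open>u\<close> and integrating
  by parts, this orthogonality is equivalent to the boundary value problem: the equations on the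
  edges come from the du Bois-Reymond lemma, the vertex conditions from hat functions. The bound
  follows by comparing the energy of the solution with that of an explicit extension of \<open>\<phi>\<close>.
\<close>

section \<open>Square-integrable functions on an interval\<close>

text \<open>A weak derivative is fixed only up to null sets, whereas the vertex conditions evaluate
  \<open>dy\<close> at single points. Hence functions on the tree are carried as pairs
  \<open>y\<close>, \<open>dy\<close>, and passing from the variational problem to the boundary
  value problem includes choosing a representative of \<open>dy\<close> for which
  \<open>\<ell> y\<close> is continuous on the part of the edge where the equation holds.
  Orthogonality is the hub: it implies minimality by Pythagoras, is implied by minimality, and is
  equivalent to the boundary value problem up to that choice of \<open>dy\<close>. Uniqueness for
  both problems and the bound thereby become statements about energies. The energy alone is not
  definite; it controls \<open>y\<close> only together with the history on
  \<open>[-\<tau>,0]\<close>, so definiteness is available for differences of functions with the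
  same history. On leaf edges the test functions vanish on the last stretch of length \<tau>, which
  is why the equation is obtained only up to \<open>lvec\<close>.\<close>

abbreviation lint :: "real \<Rightarrow> real \<Rightarrow> (real \<Rightarrow> real) \<Rightarrow> real" where
  "lint a b f \<equiv> integral\<^sup>L (lebesgue_on {a..b}) f"

lemma finite_measure_Icc: "finite_measure (lebesgue_on {a..b::real})"
  by (rule finite_measure_lebesgue_on) simp

lemma measure_Icc: "a \<le> b \<Longrightarrow> measure (lebesgue_on {a..b::real}) {a..b} = b - a"
  by (simp add: measure_restrict_space)

lemma integrable_const_Icc [simp]: "integrable (lebesgue_on {a..b::real}) (\<lambda>_. c::real)"
  by (rule finite_measure.integrable_const[OF finite_measure_Icc])

lemma lint_const: "a \<le> b \<Longrightarrow> lint a b (\<lambda>_. c) = (b - a) * c"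
  by (simp add: measure_Icc)

lemma L2_on_measurable: "L2_on a b f \<Longrightarrow> f \<in> borel_measurable (lebesgue_on {a..b})"
  by (simp add: L2_on_def)

lemma L2_on_square: "L2_on a b f \<Longrightarrow> integrable (lebesgue_on {a..b}) (\<lambda>t. (f t)\<^sup>2)"
  by (simp add: L2_on_def)

lemma L2_on_integrable: "L2_on a b f \<Longrightarrow> integrable (lebesgue_on {a..b}) f"
  unfolding L2_on_def
  using finite_measure.square_integrable_imp_integrable[OF finite_measure_Icc] by blast

lemma L2_on_mult_integrable:
  assumes "L2_on a b f" "L2_on a b g"
  shows "integrable (lebesgue_on {a..b}) (\<lambda>t. f t * g t)"
proof (rule Bochner_Integration.integrable_bound)
  show "integrable (lebesgue_on {a..b}) (\<lambda>t. (f t)\<^sup>2 + (g t)\<^sup>2)"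
    using assms by (auto intro: L2_on_square)
  show "(\<lambda>t. f t * g t) \<in> borel_measurable (lebesgue_on {a..b})"
    using assms by (intro borel_measurable_times L2_on_measurable)
  have "\<bar>f t * g t\<bar> \<le> (f t)\<^sup>2 + (g t)\<^sup>2" for t
  proof -
    have "2 * (\<bar>f t\<bar> * \<bar>g t\<bar>) \<le> (f t)\<^sup>2 + (g t)\<^sup>2" "0 \<le> \<bar>f t\<bar> * \<bar>g t\<bar>"
      using sum_squares_bound[of "\<bar>f t\<bar>" "\<bar>g t\<bar>"] by auto
    then show ?thesis unfolding abs_mult by linarith
  qed
  then show "AE t in lebesgue_on {a..b}. norm (f t * g t) \<le> norm ((f t)\<^sup>2 + (g t)\<^sup>2)"
    by simp
qed

lemma L2_onI_bounded:
  assumes "f \<in> borel_measurable (lebesgue_on {a..b})"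
    and "L2_on a b g" "\<And>t. t \<in> {a..b} \<Longrightarrow> \<bar>f t\<bar> \<le> \<bar>g t\<bar> + K" "0 \<le> K"
  shows "L2_on a b f"
  unfolding L2_on_def
proof
  show "integrable (lebesgue_on {a..b}) (\<lambda>t. (f t)\<^sup>2)"
  proof (rule Bochner_Integration.integrable_bound)
    show "integrable (lebesgue_on {a..b}) (\<lambda>t. 2 * (g t)\<^sup>2 + 2 * K\<^sup>2)"
      using L2_on_square[OF assms(2)] by (intro Bochner_Integration.integrable_add integrable_mult_right) auto
    show "(\<lambda>t. (f t)\<^sup>2) \<in> borel_measurable (lebesgue_on {a..b})"
      using assms by auto
    have "(f t)\<^sup>2 \<le> 2 * (g t)\<^sup>2 + 2 * K\<^sup>2" if "t \<in> {a..b}" for t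
    proof -
      have "(f t)\<^sup>2 \<le> (\<bar>g t\<bar> + K)\<^sup>2"
        using assms(3)[OF that] by (metis abs_ge_zero power2_abs power_mono)
      also have "\<dots> \<le> 2 * (g t)\<^sup>2 + 2 * K\<^sup>2"
        using sum_squares_bound[of "\<bar>g t\<bar>" K] by (simp add: power2_sum)
      finally show ?thesis .
    qed
    then show "AE t in lebesgue_on {a..b}. norm ((f t)\<^sup>2) \<le> norm (2 * (g t)\<^sup>2 + 2 * K\<^sup>2)"
      by (intro AE_I2) auto
  qed
qed (use assms in auto)

lemma L2_on_const [simp]: "L2_on a b (\<lambda>_. c)"
  unfolding L2_on_def by auto

lemma L2_on_add:
  assumes "L2_on a b f" "L2_on a b g"
  shows "L2_on a b (\<lambda>t. f t + g t)"
  unfolding L2_on_def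
proof
  show "integrable (lebesgue_on {a..b}) (\<lambda>t. (f t + g t)\<^sup>2)"
    using L2_on_square[OF assms(1)] L2_on_square[OF assms(2)] L2_on_mult_integrable[OF assms]
    by (simp add: power2_sum mult.assoc)
qed (use assms in \<open>intro borel_measurable_add L2_on_measurable\<close>)

lemma L2_on_cmult: "L2_on a b f \<Longrightarrow> L2_on a b (\<lambda>t. c * f t)"
  unfolding L2_on_def by (auto simp: power_mult_distrib)

lemma L2_on_diff: "L2_on a b f \<Longrightarrow> L2_on a b g \<Longrightarrow> L2_on a b (\<lambda>t. f t - g t)"
  using L2_on_add[of a b f "\<lambda>t. -1 * g t"] L2_on_cmult[of a b g "-1"] by simp

lemma L2_on_sum: "(\<And>i. i \<in> I \<Longrightarrow> L2_on a b (f i)) \<Longrightarrow> L2_on a b (\<lambda>t. \<Sum>i\<in>I. f i t)"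
  by (induction I rule: infinite_finite_induct) (auto intro: L2_on_add)

lemma L2_on_subset:
  assumes "L2_on a b f" "a \<le> c" "d \<le> b"
  shows "L2_on c d f"
  unfolding L2_on_def
proof
  show "f \<in> borel_measurable (lebesgue_on {c..d})"
    by (rule measurable_restrict_mono[OF L2_on_measurable[OF assms(1)]]) (use assms in auto)
  show "integrable (lebesgue_on {c..d}) (\<lambda>t. (f t)\<^sup>2)"
    by (rule integrable_subinterval[OF L2_on_square[OF assms(1)]]) (use assms in auto)
qed

lemma L2_on_continuous: "continuous_on {a..b} f \<Longrightarrow> L2_on a b f"
  unfolding L2_on_def
  by (intro conjI continuous_imp_integrable_real continuous_imp_measurable_on_sets_lebesgue
      continuous_on_power) auto

lemma lint_cong: "(\<And>t. t \<in> {a..b} \<Longrightarrow> f t = g t) \<Longrightarrow> lint a b f = lint a b g"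
  by (rule Bochner_Integration.integral_cong) auto

lemma lint_combine:
  assumes "integrable (lebesgue_on {a..b}) f" "a \<le> c" "c \<le> b"
  shows "lint a b f = lint a c f + lint c b f"
proof -
  have "integrable (lebesgue_on {a..c}) f" "integrable (lebesgue_on {c..b}) f"
    using assms by (auto intro: integrable_subinterval[OF assms(1)])
  then show ?thesis
    using assms Henstock_Kurzweil_Integration.integral_combine[of a c b f]
    by (simp add: lebesgue_integral_eq_integral integrable_on_lebesgue_on)
qed

lemma lint_subset_mono:
  assumes "integrable (lebesgue_on {a..b}) f" "a \<le> c" "d \<le> b" "\<And>t. t \<in> {a..b} \<Longrightarrow> 0 \<le> f t"
  shows "lint c d f \<le> lint a b f"
  using assms by (intro integral_mono_lebesgue_on_AE) auto

lemma AE_Icc_neq: "AE t in lebesgue_on {a..b::real}. t \<noteq> c"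
  using AE_completion[OF AE_lborel_singleton[of c]]
  by (auto simp: AE_restrict_space_iff elim!: eventually_mono)

lemma measurable_on_piecewise:
  assumes "f \<in> borel_measurable (lebesgue_on {a..c})" "g \<in> borel_measurable (lebesgue_on {c..b})"
  shows "(\<lambda>t::real. if t < c then f t else g t::real) \<in> borel_measurable (lebesgue_on {a..b})"
proof -
  have F: "(\<lambda>t. if t \<in> {a..c} then f t else 0) \<in> borel_measurable lebesgue"
    using assms by (intro borel_measurable_if_I) auto
  have G: "(\<lambda>t. if t \<in> {c..b} then g t else 0) \<in> borel_measurable lebesgue"
    using assms by (intro borel_measurable_if_I) auto
  have "(\<lambda>t. if t < c then (if t \<in> {a..c} then f t else 0) else (if t \<in> {c..b} then g t else 0))
      \<in> borel_measurable lebesgue"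
    by (rule measurable_If[OF F G])
      (auto simp: pred_def intro!: sets_completionI_sets[of _ lborel])
  then have "(\<lambda>t. if t < c then (if t \<in> {a..c} then f t else 0) else (if t \<in> {c..b} then g t else 0))
      \<in> borel_measurable (lebesgue_on {a..b})"
    by (rule measurable_restrict_space1)
  then show ?thesis
    by (subst measurable_lebesgue_cong) auto
qed

lemma integrable_Icc_combine:
  fixes f :: "real \<Rightarrow> real"
  assumes "integrable (lebesgue_on {a..c}) f" "integrable (lebesgue_on {c..b}) f" "a \<le> c" "c \<le> b"
  shows "integrable (lebesgue_on {a..b}) f"
proof -
  have "{a..b} = {a..c} \<union> {c..b}" using assms by auto
  then show ?thesis
    using assms set_integrable_Un[of lebesgue "{a..c}" f "{c..b}"]
    by (simp add: integrable_restrict_space set_integrable_def)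
qed

lemma L2_on_piecewise:
  assumes "L2_on a c f" "L2_on c b g" "a \<le> c" "c \<le> b"
  shows "L2_on a b (\<lambda>t. if t < c then f t else g t)"
proof -
  let ?h = "\<lambda>t. if t < c then f t else g t"
  have m: "?h \<in> borel_measurable (lebesgue_on {a..b})"
    using assms by (intro measurable_on_piecewise) (auto dest: L2_on_measurable)
  have "integrable (lebesgue_on {a..c}) (\<lambda>t. (?h t)\<^sup>2)"
  proof -
    have "L2_on a c ?h"
    \<comment> \<open>At the end point \<open>c\<close> the glued function already takes the value
      \<open>g c\<close>, so \<open>f\<close> dominates it only up to this constant.\<close>
    proof (rule L2_onI_bounded[OF _ assms(1), where K = "\<bar>g c\<bar>"])
      show "?h \<in> borel_measurable (lebesgue_on {a..c})"
        by (rule measurable_restrict_mono[OF m]) (use assms in auto)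
    qed auto
    then show ?thesis by (rule L2_on_square)
  qed
  moreover have "integrable (lebesgue_on {c..b}) (\<lambda>t. (?h t)\<^sup>2)"
    using L2_on_square[OF assms(2)] by (rule back_subst[where P=id, unfolded id_def])
      (intro Bochner_Integration.integrable_cong, auto)
  ultimately show ?thesis
    unfolding L2_on_def using m assms by (auto intro: integrable_Icc_combine)
qed

section \<open>Translations of the variable\<close>

lemma distr_shift_Icc:
  "distr (lebesgue_on {a - c..b - c}) (lebesgue_on {a..b}) (\<lambda>t. t + c) = lebesgue_on {a..b::real}"
  and measurable_shift_Icc: "(\<lambda>t. t + c) \<in> lebesgue_on {a - c..b - c} \<rightarrow>\<^sub>M lebesgue_on {a..b::real}"
proof -
  have m: "(\<lambda>t. t + c) \<in> lebesgue \<rightarrow>\<^sub>M lebesgue"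
    using lebesgue_affine_measurable[of "\<lambda>_. 1::real" c] by (simp add: add.commute)
  show m2: "(\<lambda>t. t + c) \<in> lebesgue_on {a - c..b - c} \<rightarrow>\<^sub>M lebesgue_on {a..b::real}"
    by (rule measurable_restrict_space3[OF m]) auto
  have d: "distr lebesgue lebesgue (\<lambda>t. t + c) = (lebesgue :: real measure)"
    using lebesgue_real_affine[of 1 c] by (simp add: density_1 add.commute)
  show "distr (lebesgue_on {a - c..b - c}) (lebesgue_on {a..b}) (\<lambda>t. t + c) = lebesgue_on {a..b::real}"
    (is "?L = ?R")
  proof (rule measure_eqI)
    fix A assume "A \<in> sets ?L"
    then have A: "A \<in> sets (lebesgue_on {a..b})" by simp
    then have A': "A \<in> sets lebesgue" "A \<subseteq> {a..b}"
      by (auto simp: sets_restrict_space_iff)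
    have "emeasure ?L A = emeasure (lebesgue_on {a - c..b - c}) ((\<lambda>t. t + c) -` A \<inter> {a - c..b - c})"
      using A m2 by (simp add: emeasure_distr)
    also have "(\<lambda>t. t + c) -` A \<inter> {a - c..b - c} = (\<lambda>t. t + c) -` A"
      using A' by force
    also have "emeasure (lebesgue_on {a - c..b - c}) \<dots> = emeasure lebesgue ((\<lambda>t. t + c) -` A)"
      using A' by (intro emeasure_restrict_space) force+
    also have "\<dots> = emeasure (distr lebesgue lebesgue (\<lambda>t. t + c)) A"
      using A' m by (simp add: emeasure_distr)
    also have "\<dots> = emeasure ?R A"
      using A' by (simp add: d emeasure_restrict_space)
    finally show "emeasure ?L A = emeasure ?R A" .
  qed simp
qed

lemma integrable_shift_Icc:
  fixes c :: real
  assumes "integrable (lebesgue_on {a..b}) f"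
  shows "integrable (lebesgue_on {a - c..b - c}) (\<lambda>t. f (t + c) :: real)"
  using assms integrable_distr[OF measurable_shift_Icc[of c a b], of f]
  by (simp add: distr_shift_Icc)

lemma lint_shift:
  assumes "f \<in> borel_measurable (lebesgue_on {a..b})"
  shows "lint (a - c) (b - c) (\<lambda>t. f (t + c)) = lint a b f"
  using integral_distr[OF measurable_shift_Icc[of c a b] assms]
  by (simp add: distr_shift_Icc)

lemma L2_on_shift: "L2_on a b f \<Longrightarrow> L2_on (a - c) (b - c) (\<lambda>t. f (t + c))"
  unfolding L2_on_def
  using measurable_compose[OF measurable_shift_Icc[of c a b], of f borel]
  by (auto intro: integrable_shift_Icc)

lemma AE_shift_Icc:
  fixes c :: real
  assumes "AE t in lebesgue_on {a..b}. P t"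
  shows "AE t in lebesgue_on {a - c..b - c}. P (t + c)"
  by (rule AE_distrD[OF measurable_shift_Icc[of c a b]]) (use assms in \<open>simp only: distr_shift_Icc\<close>)

lemma AE_Icc_subset:
  assumes "AE t in lebesgue_on {a..b::real}. P t" "a \<le> c" "d \<le> b"
  shows "AE t in lebesgue_on {c..d::real}. P t"
  using assms by (auto simp: AE_restrict_space_iff elim!: eventually_mono)

section \<open>Functions whose primitive vanishes\<close>

lemma emeasure_density_halfline:
  fixes f :: "real \<Rightarrow> real"
  assumes "integrable lborel f"
  shows "emeasure (density lborel (\<lambda>t. ennreal (f t))) {x<..}
    = ennreal (\<integral>t. indicator {x<..} t * max 0 (f t) \<partial>lborel)"
proof -
  have [measurable]: "f \<in> borel_measurable borel" using assms by auto
  have "emeasure (density lborel (\<lambda>t. ennreal (f t))) {x<..}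
    = (\<integral>\<^sup>+t. ennreal (f t) * indicator {x<..} t \<partial>lborel)"
    by (subst emeasure_density) auto
  also have "\<dots> = (\<integral>\<^sup>+t. ennreal (indicator {x<..} t * max 0 (f t)) \<partial>lborel)"
    by (intro nn_integral_cong) (auto simp: indicator_def max_def ennreal_neg)
  also have "\<dots> = ennreal (\<integral>t. indicator {x<..} t * max 0 (f t) \<partial>lborel)"
    using assms integrable_mult_indicator[of "{x<..}" lborel "\<lambda>t. max 0 (f t)"]
    by (intro nn_integral_eq_integral) auto
  finally show ?thesis .
qed

text \<open>\<open>ennreal\<close> cuts off negative values, so the densities \<open>f\<close> and
  \<open>- f\<close> define the measures of the positive and of the negative part. They are finite
  on half-lines and agree there, hence coincide, and uniqueness of densities makes the two parts
  equal almost everywhere, which forces both to be zero.\<close>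

lemma AE_zero_of_halfline_integrals:
  fixes f :: "real \<Rightarrow> real"
  assumes f: "integrable lborel f"
    and z: "\<And>x. (\<integral>t. indicator {x<..} t * f t \<partial>lborel) = 0"
  shows "AE t in lborel. f t = 0"
proof -
  have [measurable]: "f \<in> borel_measurable borel" using f by auto
  have e: "(\<integral>t. indicator {x<..} t * max 0 (f t) \<partial>lborel) = (\<integral>t. indicator {x<..} t * max 0 (- f t) \<partial>lborel)" for x
  proof -
    have "integrable lborel (\<lambda>t. indicator {x<..} t * max 0 (f t))"
      "integrable lborel (\<lambda>t. indicator {x<..} t * max 0 (- f t))"
      using f integrable_mult_indicator[of "{x<..}" lborel "\<lambda>t. max 0 (f t)"]
        integrable_mult_indicator[of "{x<..}" lborel "\<lambda>t. max 0 (- f t)"] by auto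
    then have "(\<integral>t. indicator {x<..} t * max 0 (f t) \<partial>lborel) - (\<integral>t. indicator {x<..} t * max 0 (- f t) \<partial>lborel)
      = (\<integral>t. indicator {x<..} t * max 0 (f t) - indicator {x<..} t * max 0 (- f t) \<partial>lborel)"
      by simp
    also have "\<dots> = (\<integral>t. indicator {x<..} t * f t \<partial>lborel)"
      by (intro Bochner_Integration.integral_cong) (auto simp: indicator_def max_def)
    finally show ?thesis using z by simp
  qed
  have "density lborel (\<lambda>t. ennreal (f t)) = density lborel (\<lambda>t. ennreal (- f t))"
  proof (rule measure_eqI_lessThan)
    fix x
    show "emeasure (density lborel (\<lambda>t. ennreal (f t))) {x<..} < \<infinity>"
      using emeasure_density_halfline[OF f, of x] by simp
    show "emeasure (density lborel (\<lambda>t. ennreal (f t))) {x<..}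
        = emeasure (density lborel (\<lambda>t. ennreal (- f t))) {x<..}"
      using emeasure_density_halfline[OF f, of x] emeasure_density_halfline[of "\<lambda>t. - f t" x] f e by simp
  qed auto
  then have "AE t in lborel. ennreal (f t) = ennreal (- f t)"
    by (intro sigma_finite_measure.density_unique[OF lborel.sigma_finite_measure_axioms]) auto
  then show ?thesis
  proof (eventually_elim)
    fix t assume *: "ennreal (f t) = ennreal (- f t)"
    show "f t = 0"
    proof (cases "f t" "0::real" rule: linorder_cases)
      case less
      then have "ennreal (- f t) = 0" using * by (metis ennreal_neg less_imp_le)
      then show ?thesis using less by simp
    next
      case greater
      then have "ennreal (f t) = 0" using * by (metis ennreal_neg less_imp_le neg_less_0_iff_less)
      then show ?thesis using greater by simp
    qed
  qed
qed

text \<open>After extension by zero, a half-line integral is either trivially zero or an integral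
  over some \<open>[y,b]\<close>, the difference of two vanishing integrals; so the half-line
  criterion applies.\<close>

lemma AE_zero_of_lint_zero:
  assumes f: "integrable (lebesgue_on {a..b}) f"
    and z: "\<And>x. x \<in> {a..b} \<Longrightarrow> lint a x f = 0"
  shows "AE t in lebesgue_on {a..b}. f t = 0"
proof (cases "a \<le> b")
  case False
  then show ?thesis by (intro AE_I2) simp
next
  case True
  define F where "F t = (if t \<in> {a..b} then f t else 0)" for t
  have F: "integrable lebesgue F"
    using f unfolding F_def[abs_def] by (subst Lebesgue_Measure.integrable_restrict_UNIV) auto
  \<comment> \<open>The half-line criterion concerns Borel functions, so \<open>F\<close> is
    replaced by a Borel function that agrees with it up to a null set.\<close>
  obtain g where g: "g \<in> borel_measurable lborel" "AE t in lborel. F t = g t"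
    using completion_ex_borel_measurable_real[OF borel_measurable_integrable[OF F]] by auto
  have ig: "integrable lborel g"
  proof -
    have "integrable lebesgue F \<longleftrightarrow> integrable lebesgue g"
      by (intro integrable_cong_AE borel_measurable_integrable[OF F] measurable_completion[OF g(1)]
          AE_completion[OF g(2)])
    then show ?thesis
      using F integrable_completion[OF g(1)] by simp
  qed
  have "(\<integral>t. indicator {x<..} t * g t \<partial>lborel) = 0" for x
  proof -
    have "(\<integral>t. indicator {x<..} t * g t \<partial>lborel) = (\<integral>t. indicator {x<..} t * g t \<partial>lebesgue)"
      using g by (subst integral_completion) auto
    also have "\<dots> = (\<integral>t. indicator {x<..} t * F t \<partial>lebesgue)"
    proof (rule integral_cong_AE)
      show "AE t in lebesgue. indicator {x<..} t * g t = indicator {x<..} t * F t"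
        using AE_completion[OF g(2)] by eventually_elim simp
      have [measurable]: "{x<..} \<in> sets lebesgue" by simp
      show "(\<lambda>t. indicator {x<..} t * F t) \<in> borel_measurable lebesgue"
        using F by (intro borel_measurable_times borel_measurable_indicator) auto
      show "(\<lambda>t. indicator {x<..} t * g t) \<in> borel_measurable lebesgue"
        using g by (intro borel_measurable_times borel_measurable_indicator measurable_completion) auto
    qed
    also have "\<dots> = 0"
    proof (cases "x < b")
      case False
      then have "(\<lambda>t. indicator {x<..} t * F t) = (\<lambda>_. 0)" by (auto simp: F_def indicator_def fun_eq_iff)
      then show ?thesis by simp
    next
      case xb: True
      define y where "y = max a x"
      have "(\<integral>t. indicator {x<..} t * F t \<partial>lebesgue) = (\<integral>t. (if t \<in> {x<..} \<inter> {a..b} then f t else 0) \<partial>lebesgue)"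
        by (intro Bochner_Integration.integral_cong) (auto simp: F_def indicator_def)
      also have "\<dots> = integral\<^sup>L (lebesgue_on ({x<..} \<inter> {a..b})) f"
        by (intro Lebesgue_Measure.integral_restrict_UNIV) auto
      also have "\<dots> = integral ({x<..} \<inter> {a..b}) f"
      proof (rule lebesgue_integral_eq_integral)
        have "integrable lebesgue (\<lambda>t. indicator {x<..} t *\<^sub>R F t)"
          by (rule integrable_mult_indicator[OF _ F]) simp
        also have "(\<lambda>t. indicator {x<..} t *\<^sub>R F t) = (\<lambda>t. (if t \<in> {x<..} \<inter> {a..b} then f t else 0))"
          by (auto simp: F_def indicator_def fun_eq_iff)
        finally show "integrable (lebesgue_on ({x<..} \<inter> {a..b})) f"
          by (subst (asm) Lebesgue_Measure.integrable_restrict_UNIV) auto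
      qed auto
      also have "\<dots> = integral {y..b} f"
        by (intro integral_spike_set negligible_subset[OF negligible_sing[of x]]) (auto simp: y_def)
      also have "\<dots> = lint y b f"
        by (intro lebesgue_integral_eq_integral[symmetric] integrable_subinterval[OF f]) (auto simp: y_def)
      also have "\<dots> = 0"
        using lint_combine[OF f, of y] z[of y] z[of b] xb True by (auto simp: y_def)
      finally show ?thesis .
    qed
    finally show ?thesis .
  qed
  then have "AE t in lborel. g t = 0"
    using AE_zero_of_halfline_integrals ig by blast
  with g(2) have "AE t in lborel. F t = 0" by eventually_elim simp
  then have "AE t in lebesgue. F t = 0" by (rule AE_completion)
  then show ?thesis
    by (auto simp: AE_restrict_space_iff F_def elim!: eventually_mono)
qed

section \<open>Cauchy-Schwarz and completeness\<close>

lemma lint_singleton [simp]: "integral\<^sup>L (lebesgue_on {a::real}) f = (0::real)"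
  by (rule integral_eq_zero_null_sets) (simp add: null_sets_completionI)

lemma lint_cong_AE:
  assumes "AE t in lebesgue_on {a..b}. f t = g t"
    "f \<in> borel_measurable (lebesgue_on {a..b})" "g \<in> borel_measurable (lebesgue_on {a..b})"
  shows "lint a b f = lint a b g"
  using assms by (intro integral_cong_AE) auto

lemma lint_nonneg: "(\<And>t. t \<in> {a..b} \<Longrightarrow> 0 \<le> f t) \<Longrightarrow> 0 \<le> lint a b f"
  by (rule Bochner_Integration.integral_nonneg) auto

lemma lint_square_nonneg [simp]: "0 \<le> lint a b (\<lambda>t. (f t)\<^sup>2)"
  by (rule lint_nonneg) simp

lemma lint_mono:
  "integrable (lebesgue_on {a..b}) f \<Longrightarrow> integrable (lebesgue_on {a..b}) g
    \<Longrightarrow> (\<And>t. t \<in> {a..b} \<Longrightarrow> f t \<le> g t) \<Longrightarrow> lint a b f \<le> lint a b g"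
  by (rule Bochner_Integration.integral_mono) auto

text \<open>Cauchy-Schwarz against the constant 1: expand the nonnegative variance of the absolute
  value of \<open>f\<close> about its mean \<open>m\<close>.\<close>

lemma lint_abs_square_le:
  assumes "L2_on a b f" "a \<le> b"
  shows "(lint a b (\<lambda>t. \<bar>f t\<bar>))\<^sup>2 \<le> (b - a) * lint a b (\<lambda>t. (f t)\<^sup>2)"
proof (cases "a = b")
  case False
  then have ab: "a < b" using assms by simp
  define A m where "A = lint a b (\<lambda>t. \<bar>f t\<bar>)" and "m = A / (b - a)"
  have i: "integrable (lebesgue_on {a..b}) (\<lambda>t. \<bar>f t\<bar>)" "integrable (lebesgue_on {a..b}) (\<lambda>t. (f t)\<^sup>2)"
    using L2_on_integrable[OF assms(1)] L2_on_square[OF assms(1)] by auto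
  have "0 \<le> lint a b (\<lambda>t. (\<bar>f t\<bar> - m)\<^sup>2)" by simp
  also have "lint a b (\<lambda>t. (\<bar>f t\<bar> - m)\<^sup>2) = lint a b (\<lambda>t. (f t)\<^sup>2 + m\<^sup>2 - 2 * m * \<bar>f t\<bar>)"
    by (intro lint_cong) (simp add: power2_diff)
  also have "\<dots> = lint a b (\<lambda>t. (f t)\<^sup>2) + (b - a) * m\<^sup>2 - 2 * m * A"
    using i ab by (simp add: measure_Icc A_def)
  finally have *: "0 \<le> lint a b (\<lambda>t. (f t)\<^sup>2) + (b - a) * m\<^sup>2 - 2 * m * A" .
  have A: "A = (b - a) * m" using ab by (simp add: m_def)
  have "(b - a) * m\<^sup>2 \<le> lint a b (\<lambda>t. (f t)\<^sup>2)"
    using * unfolding A by (simp add: power2_eq_square algebra_simps)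
  then have "(b - a) * ((b - a) * m\<^sup>2) \<le> (b - a) * lint a b (\<lambda>t. (f t)\<^sup>2)"
    using ab by (intro mult_left_mono) auto
  then have "A\<^sup>2 \<le> (b - a) * lint a b (\<lambda>t. (f t)\<^sup>2)"
    unfolding A by (simp add: power_mult_distrib) (simp add: power2_eq_square mult.assoc)
  then show ?thesis by (simp add: A_def)
qed simp

text \<open>On a bounded interval, Cauchy in mean square implies Cauchy in L1, so a subsequence
  converges almost everywhere. Fatou's lemma along this subsequence, with the other index fixed,
  upgrades the pointwise limit to a mean-square limit of the whole sequence.\<close>

lemma L2_on_complete:
  fixes f :: "nat \<Rightarrow> real \<Rightarrow> real"
  assumes f: "\<And>n. L2_on a b (f n)" and ab: "a \<le> b"
    and c: "\<And>e. e > 0 \<Longrightarrow> \<exists>N. \<forall>i\<ge>N. \<forall>j\<ge>N. lint a b (\<lambda>t. (f i t - f j t)\<^sup>2) < e"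
  obtains g where "L2_on a b g" "(\<lambda>n. lint a b (\<lambda>t. (f n t - g t)\<^sup>2)) \<longlonglongrightarrow> 0"
proof -
  let ?M = "lebesgue_on {a..b}"
  have [measurable]: "f n \<in> borel_measurable ?M" for n using f by (rule L2_on_measurable)
  have L1: "\<exists>N. \<forall>i\<ge>N. \<forall>j\<ge>N. lint a b (\<lambda>t. norm (f i t - f j t)) < e" if e: "e > 0" for e
  proof -
    \<comment> \<open>The summand 1 keeps the denominator positive when
      \<open>a = b\<close>.\<close>
    obtain N where N: "\<And>i j. i \<ge> N \<Longrightarrow> j \<ge> N \<Longrightarrow> lint a b (\<lambda>t. (f i t - f j t)\<^sup>2) < e\<^sup>2 / (b - a + 1)"
      using c[of "e\<^sup>2 / (b - a + 1)"] e ab by auto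
    have "lint a b (\<lambda>t. \<bar>f i t - f j t\<bar>) < e" if "i \<ge> N" "j \<ge> N" for i j
    proof -
      have "(lint a b (\<lambda>t. \<bar>f i t - f j t\<bar>))\<^sup>2 \<le> (b - a) * lint a b (\<lambda>t. (f i t - f j t)\<^sup>2)"
        using f ab by (intro lint_abs_square_le L2_on_diff)
      also have "\<dots> \<le> (b - a + 1) * lint a b (\<lambda>t. (f i t - f j t)\<^sup>2)"
        by (intro mult_right_mono) auto
      also have "\<dots> < e\<^sup>2"
        using N[OF that] ab by (simp add: field_simps)
      finally show ?thesis using e by (simp add: power2_less_imp_less)
    qed
    then show ?thesis by auto
  qed
  obtain r where r: "strict_mono r" "AE t in ?M. Cauchy (\<lambda>k. f (r k) t)"
    using cauchy_L1_AE_cauchy_subseq[of ?M f] L1 L2_on_integrable[OF f] by blast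
  define g where "g t = lim (\<lambda>k. f (r k) t)" for t
  have [measurable]: "g \<in> borel_measurable ?M"
    unfolding g_def by measurable
  have lim: "AE t in ?M. (\<lambda>k. f (r k) t) \<longlonglongrightarrow> g t"
    using r(2) by eventually_elim (simp add: g_def Cauchy_convergent_iff convergent_LIMSEQ_iff)
  have key: "\<exists>N. \<forall>n\<ge>N. integrable ?M (\<lambda>t. (f n t - g t)\<^sup>2) \<and> lint a b (\<lambda>t. (f n t - g t)\<^sup>2) \<le> e"
    if e: "e > 0" for e
  proof -
    obtain N where N: "\<And>i j. i \<ge> N \<Longrightarrow> j \<ge> N \<Longrightarrow> lint a b (\<lambda>t. (f i t - f j t)\<^sup>2) < e"
      using c[OF e] by auto
    show ?thesis
    proof (intro exI[of _ N] allI impI)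
      fix n assume n: "n \<ge> N"
      have "(\<integral>\<^sup>+t. ennreal ((f n t - g t)\<^sup>2) \<partial>?M)
          = (\<integral>\<^sup>+t. liminf (\<lambda>k. ennreal ((f n t - f (r k) t)\<^sup>2)) \<partial>?M)"
      proof (rule nn_integral_cong_AE)
        show "AE t in ?M. ennreal ((f n t - g t)\<^sup>2) = liminf (\<lambda>k. ennreal ((f n t - f (r k) t)\<^sup>2))"
          using lim
        proof eventually_elim
          fix t assume "(\<lambda>k. f (r k) t) \<longlonglongrightarrow> g t"
          then have "(\<lambda>k. ennreal ((f n t - f (r k) t)\<^sup>2)) \<longlonglongrightarrow> ennreal ((f n t - g t)\<^sup>2)"
            by (intro tendsto_ennrealI tendsto_intros)
          then show "ennreal ((f n t - g t)\<^sup>2) = liminf (\<lambda>k. ennreal ((f n t - f (r k) t)\<^sup>2))"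
            by (intro lim_imp_Liminf[symmetric] sequentially_bot)
        qed
      qed
      also have "\<dots> \<le> liminf (\<lambda>k. \<integral>\<^sup>+t. ennreal ((f n t - f (r k) t)\<^sup>2) \<partial>?M)"
        by (intro nn_integral_liminf) measurable
      also have "\<dots> \<le> liminf (\<lambda>k. ennreal e)"
      proof (rule Liminf_mono, rule eventually_mono[OF eventually_ge_at_top[of N]])
        fix k assume "N \<le> k"
        then have rk: "N \<le> r k" using strict_mono_imp_increasing[OF r(1), of k] by simp
        have "(\<integral>\<^sup>+t. ennreal ((f n t - f (r k) t)\<^sup>2) \<partial>?M) = ennreal (lint a b (\<lambda>t. (f n t - f (r k) t)\<^sup>2))"
          by (intro nn_integral_eq_integral L2_on_square L2_on_diff f) auto
        then show "(\<integral>\<^sup>+t. ennreal ((f n t - f (r k) t)\<^sup>2) \<partial>?M) \<le> ennreal e"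
          using N[OF n rk] by (simp add: ennreal_leI)
      qed
      also have "\<dots> = ennreal e" by (rule lim_imp_Liminf) auto
      finally have le: "(\<integral>\<^sup>+t. ennreal ((f n t - g t)\<^sup>2) \<partial>?M) \<le> ennreal e" .
      have i: "integrable ?M (\<lambda>t. (f n t - g t)\<^sup>2)"
        using le by (intro integrableI_bounded) (auto simp: order_le_less_trans)
      have "ennreal (lint a b (\<lambda>t. (f n t - g t)\<^sup>2)) \<le> ennreal e"
        using le i by (subst nn_integral_eq_integral[symmetric]) auto
      then show "integrable ?M (\<lambda>t. (f n t - g t)\<^sup>2) \<and> lint a b (\<lambda>t. (f n t - g t)\<^sup>2) \<le> e"
        using i e by simp
    qed
  qed
  obtain n where "integrable ?M (\<lambda>t. (f n t - g t)\<^sup>2)" using key[of 1] by auto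
  then have "L2_on a b (\<lambda>t. f n t - g t)" by (simp add: L2_on_def)
  from L2_on_diff[OF f[of n] this] have "L2_on a b g" by simp
  moreover have "(\<lambda>n. lint a b (\<lambda>t. (f n t - g t)\<^sup>2)) \<longlonglongrightarrow> 0"
  proof (rule LIMSEQ_I)
    fix e :: real assume e: "0 < e"
    obtain N where "\<forall>n\<ge>N. lint a b (\<lambda>t. (f n t - g t)\<^sup>2) \<le> e / 2"
      using key[of "e / 2"] e by auto
    then show "\<exists>N. \<forall>n\<ge>N. norm (lint a b (\<lambda>t. (f n t - g t)\<^sup>2) - 0) < e"
      using e by (intro exI[of _ N]) force
  qed
  ultimately show ?thesis by (rule that)
qed

section \<open>Weak derivatives\<close>

text \<open>Measurability of \<open>g\<close> is a conclusion here, by completeness of Lebesgue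
  measure.\<close>

lemma L2_on_cong_AE:
  assumes "L2_on a b f" "AE t in lebesgue_on {a..b}. f t = g t"
  shows "L2_on a b g"
proof -
  have "(\<lambda>t. if t \<in> {a..b} then f t else 0) \<in> borel_measurable lebesgue"
    by (rule borel_measurable_if_I[OF L2_on_measurable[OF assms(1)]]) simp
  moreover have "AE t in lebesgue. (if t \<in> {a..b} then f t else 0) = (if t \<in> {a..b} then g t else 0)"
    using assms(2) by (auto simp: AE_restrict_space_iff elim!: eventually_mono)
  ultimately have "(\<lambda>t. if t \<in> {a..b} then g t else 0) \<in> borel_measurable lebesgue"
    by (rule borel_measurable_AE)
  then have m: "g \<in> borel_measurable (lebesgue_on {a..b})"
    by (rule borel_measurable_if_D)
  then have "integrable (lebesgue_on {a..b}) (\<lambda>t. (g t)\<^sup>2)"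
    using assms by (subst integrable_cong_AE[where g = "\<lambda>t. (f t)\<^sup>2"]) (auto simp: L2_on_def elim!: eventually_mono)
  with m show ?thesis by (simp add: L2_on_def)
qed

lemma is_wderiv_L2: "is_wderiv a b f g \<Longrightarrow> L2_on a b g"
  unfolding is_wderiv_def by (rule conjunct1)

lemma is_wderivD: "is_wderiv a b f g \<Longrightarrow> x \<in> {a..b} \<Longrightarrow> f x = f a + lint a x g"
  unfolding is_wderiv_def by blast

lemma is_wderivI:
  "L2_on a b g \<Longrightarrow> (\<And>x. x \<in> {a..b} \<Longrightarrow> f x = f a + lint a x g) \<Longrightarrow> is_wderiv a b f g"
  unfolding is_wderiv_def by blast

lemma is_wderiv_diff_eq:
  assumes "is_wderiv a b f g" "a \<le> x" "x \<le> y" "y \<le> b"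
  shows "f y = f x + lint x y g"
proof -
  have i: "integrable (lebesgue_on {a..y}) g"
    using assms by (intro L2_on_integrable L2_on_subset[OF is_wderiv_L2[OF assms(1)]]) auto
  show ?thesis
    using lint_combine[OF i, of x] assms is_wderivD[OF assms(1), of x] is_wderivD[OF assms(1), of y] by simp
qed

lemma is_wderiv_continuous:
  assumes "is_wderiv a b f g"
  shows "continuous_on {a..b} f"
proof -
  have "continuous_on {a..b} (\<lambda>x. f a + lint a x g)"
    using indefinite_integral_continuous_real[OF L2_on_integrable[OF is_wderiv_L2[OF assms]]]
    by (intro continuous_intros)
  then show ?thesis
    by (rule continuous_on_eq) (rule is_wderivD[OF assms, symmetric])
qed

lemma is_wderiv_L2_fun: "is_wderiv a b f g \<Longrightarrow> L2_on a b f"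
  by (intro L2_on_continuous is_wderiv_continuous)

text \<open>A primitive of a square-integrable function is continuous on the compact interval, so
  its own square-integrability comes for free.\<close>

lemma W21_iff: "W21 a b f \<longleftrightarrow> (\<exists>g. is_wderiv a b f g)"
  using is_wderiv_L2_fun by (auto simp: W21_def)

lemma is_wderiv_subset:
  assumes "is_wderiv a b f g" "a \<le> c" "d \<le> b"
  shows "is_wderiv c d f g"
proof (rule is_wderivI)
  show "L2_on c d g" by (rule L2_on_subset[OF is_wderiv_L2[OF assms(1)] assms(2,3)])
  show "f x = f c + lint c x g" if "x \<in> {c..d}" for x
    by (rule is_wderiv_diff_eq[OF assms(1)]) (use that assms in auto)
qed

lemma is_wderiv_integral:
  assumes "L2_on a b g" "\<And>x. x \<in> {a..b} \<Longrightarrow> f x = C + lint a x g"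
  shows "is_wderiv a b f g"
proof (rule is_wderivI[OF assms(1)])
  fix x assume x: "x \<in> {a..b}"
  then have "f a = C" using assms(2)[of a] by simp
  then show "f x = f a + lint a x g" using assms(2)[OF x] by simp
qed

lemma is_wderiv_cong:
  assumes "is_wderiv a b f g" "\<And>t. t \<in> {a..b} \<Longrightarrow> f t = f' t"
    "AE t in lebesgue_on {a..b}. g t = g' t"
  shows "is_wderiv a b f' g'"
proof -
  have L: "L2_on a b g'" by (rule L2_on_cong_AE[OF is_wderiv_L2[OF assms(1)] assms(3)])
  have "lint a x g = lint a x g'" if "x \<in> {a..b}" for x
    using that L2_on_subset[OF L, of a x] L2_on_subset[OF is_wderiv_L2[OF assms(1)], of a x]
    by (intro lint_cong_AE AE_Icc_subset[OF assms(3)] L2_on_measurable) auto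
  then have "f' x = f' a + lint a x g'" if "x \<in> {a..b}" for x
    using is_wderivD[OF assms(1) that] assms(2)[of x] assms(2)[of a] that by simp
  then show ?thesis
    by (rule is_wderivI[OF L])
qed

lemma is_wderiv_cong_eq:
  assumes "\<And>t. t \<in> {a..b} \<Longrightarrow> f t = f' t" "\<And>t. t \<in> {a..b} \<Longrightarrow> g t = g' t"
  shows "is_wderiv a b f g \<longleftrightarrow> is_wderiv a b f' g'"
proof -
  have *: "AE t in lebesgue_on {a..b}. g t = g' t" "AE t in lebesgue_on {a..b}. g' t = g t"
    by (auto intro!: AE_I2 simp: assms)
  show ?thesis
    using is_wderiv_cong[OF _ _ *(1), of f f'] is_wderiv_cong[OF _ _ *(2), of f' f] assms(1) by metis
qed

lemma is_wderiv_add: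
  assumes "is_wderiv a b f f'" "is_wderiv a b g g'"
  shows "is_wderiv a b (\<lambda>t. f t + g t) (\<lambda>t. f' t + g' t)"
proof (rule is_wderiv_integral[where C = "f a + g a"])
  show "L2_on a b (\<lambda>t. f' t + g' t)" using assms by (intro L2_on_add is_wderiv_L2)
  fix x assume x: "x \<in> {a..b}"
  have "integrable (lebesgue_on {a..x}) f'" "integrable (lebesgue_on {a..x}) g'"
    using assms x by (auto intro!: L2_on_integrable L2_on_subset[OF is_wderiv_L2])
  then show "f x + g x = f a + g a + lint a x (\<lambda>t. f' t + g' t)"
    using is_wderivD[OF assms(1) x] is_wderivD[OF assms(2) x] by simp
qed

lemma is_wderiv_cmult:
  assumes "is_wderiv a b f f'"
  shows "is_wderiv a b (\<lambda>t. c * f t) (\<lambda>t. c * f' t)"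
proof (rule is_wderiv_integral[where C = "c * f a"])
  show "L2_on a b (\<lambda>t. c * f' t)" using assms by (intro L2_on_cmult is_wderiv_L2)
  fix x assume x: "x \<in> {a..b}"
  then have "f x = f a + lint a x f'" by (rule is_wderivD[OF assms])
  then show "c * f x = c * f a + lint a x (\<lambda>t. c * f' t)" by (simp add: algebra_simps)
qed

lemma is_wderiv_diff:
  "is_wderiv a b f f' \<Longrightarrow> is_wderiv a b g g' \<Longrightarrow> is_wderiv a b (\<lambda>t. f t - g t) (\<lambda>t. f' t - g' t)"
  using is_wderiv_add[of a b f f' "\<lambda>t. -1 * g t" "\<lambda>t. -1 * g' t"] is_wderiv_cmult[of a b g g' "-1"] by simp

lemma is_wderiv_linear: "is_wderiv a b (\<lambda>t. \<alpha> + \<beta> * t) (\<lambda>_. \<beta>)"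
  by (rule is_wderiv_integral[where C = "\<alpha> + \<beta> * a"]) (auto simp: measure_Icc algebra_simps)

text \<open>Gluing asks only for matching values; the derivative at the joint is a matter of a null
  set. Histories, delayed functions and test functions are all assembled in this way.\<close>

lemma is_wderiv_piecewise:
  assumes f: "is_wderiv a c f f'" and g: "is_wderiv c b g g'" and "f c = g c" "a \<le> c" "c \<le> b"
  shows "is_wderiv a b (\<lambda>t. if t < c then f t else g t) (\<lambda>t. if t < c then f' t else g' t)"
proof (rule is_wderiv_integral[where C = "f a"])
  let ?h = "\<lambda>t. if t < c then f' t else g' t"
  show L: "L2_on a b ?h"
    using assms by (intro L2_on_piecewise is_wderiv_L2)
  have left: "lint a x ?h = lint a x f'" if "a \<le> x" "x \<le> c" for x
  proof (rule lint_cong_AE)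
    have "AE t in lebesgue_on {a..x}. t \<noteq> c \<and> t \<in> space (lebesgue_on {a..x})"
      using AE_Icc_neq AE_space by eventually_elim simp
    then show "AE t in lebesgue_on {a..x}. ?h t = f' t"
      by eventually_elim (use that in auto)
    show "?h \<in> borel_measurable (lebesgue_on {a..x})"
      by (rule L2_on_measurable[OF L2_on_subset[OF L]]) (use that assms in auto)
    show "f' \<in> borel_measurable (lebesgue_on {a..x})"
      by (rule L2_on_measurable[OF L2_on_subset[OF is_wderiv_L2[OF f]]]) (use that assms in auto)
  qed
  fix x assume x: "x \<in> {a..b}"
  show "(if x < c then f x else g x) = f a + lint a x ?h"
  proof (cases "x < c")
    case True
    then show ?thesis using is_wderivD[OF f, of x] x left[of x] by simp
  next
    case False
    have i: "integrable (lebesgue_on {a..x}) ?h"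
      by (rule L2_on_integrable[OF L2_on_subset[OF L]]) (use x in auto)
    have "lint a x ?h = lint a c ?h + lint c x ?h"
      by (rule lint_combine[OF i]) (use assms False in auto)
    also have "lint c x ?h = lint c x g'"
      by (rule lint_cong) auto
    also have "lint a c ?h = g c - f a"
      using left[of c] is_wderivD[OF f, of c] assms by simp
    also have "lint c x g' = g x - g c"
      using is_wderivD[OF g, of x] x False by simp
    finally show ?thesis using False by simp
  qed
qed

lemma is_wderiv_shift:
  assumes "is_wderiv a b f g"
  shows "is_wderiv (a - c) (b - c) (\<lambda>t. f (t + c)) (\<lambda>t. g (t + c))"
proof (rule is_wderiv_integral[where C = "f a"])
  show "L2_on (a - c) (b - c) (\<lambda>t. g (t + c))"
    using assms by (intro L2_on_shift is_wderiv_L2)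
  fix x assume x: "x \<in> {a - c..b - c}"
  then have "lint (a - c) (x + c - c) (\<lambda>t. g (t + c)) = lint a (x + c) g"
    by (intro lint_shift L2_on_measurable L2_on_subset[OF is_wderiv_L2[OF assms]]) auto
  moreover have "f (x + c) = f a + lint a (x + c) g" using x by (intro is_wderivD[OF assms]) auto
  ultimately show "f (x + c) = f a + lint (a - c) x (\<lambda>t. g (t + c))" by simp
qed

text \<open>The difference of two derivatives of one function has vanishing integrals over all
  \<open>[a,x]\<close>.\<close>

lemma is_wderiv_AE_unique:
  assumes "is_wderiv a b f g" "is_wderiv a b f h"
  shows "AE t in lebesgue_on {a..b}. g t = h t"
proof -
  have d: "is_wderiv a b (\<lambda>t. 0) (\<lambda>t. g t - h t)"
    using is_wderiv_diff[OF assms] by simp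
  have "AE t in lebesgue_on {a..b}. g t - h t = 0"
  proof (rule AE_zero_of_lint_zero)
    show "integrable (lebesgue_on {a..b}) (\<lambda>t. g t - h t)"
      using d by (intro L2_on_integrable is_wderiv_L2)
    show "lint a x (\<lambda>t. g t - h t) = 0" if "x \<in> {a..b}" for x
      using is_wderivD[OF d that] by simp
  qed
  then show ?thesis by eventually_elim simp
qed

lemma is_wderiv_wderiv: "W21 a b f \<Longrightarrow> is_wderiv a b f (wderiv a b f)"
  unfolding wderiv_def W21_iff by (rule someI_ex[of "is_wderiv a b f"])

section \<open>Sobolev inequality and integration by parts\<close>

lemma is_wderiv_abs_diff_le:
  assumes "is_wderiv a b f g" "x \<in> {a..b}" "y \<in> {a..b}"
  shows "\<bar>f x - f y\<bar> \<le> lint a b (\<lambda>t. \<bar>g t\<bar>)"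
proof -
  have i: "integrable (lebesgue_on {a..b}) (\<lambda>t. \<bar>g t\<bar>)"
    using L2_on_integrable[OF is_wderiv_L2[OF assms(1)]] by simp
  have *: "\<bar>f v - f u\<bar> \<le> lint a b (\<lambda>t. \<bar>g t\<bar>)" if "a \<le> u" "u \<le> v" "v \<le> b" for u v
  proof -
    have "\<bar>f v - f u\<bar> = \<bar>lint u v g\<bar>"
      using is_wderiv_diff_eq[OF assms(1) that] by simp
    also have "\<dots> \<le> lint u v (\<lambda>t. \<bar>g t\<bar>)"
      by (rule integral_abs_bound)
    also have "\<dots> \<le> lint a b (\<lambda>t. \<bar>g t\<bar>)"
      by (rule lint_subset_mono[OF i]) (use that in auto)
    finally show ?thesis .
  qed
  show ?thesis using *[of x y] *[of y x] assms(2,3) by (cases "x \<le> y") (auto simp: abs_minus_commute)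
qed

text \<open>Compare \<open>f x\<close> with \<open>f y\<close>, which differ by at most the integral
  of the absolute value of \<open>g\<close>, and average over \<open>y\<close>. Averaging
  contributes \<open>2 / (b - a)\<close>; Cauchy-Schwarz for that integral contributes
  \<open>2 * (b - a)\<close>.\<close>

lemma Sobolev_sup_bound:
  assumes d: "is_wderiv a b f g" and ab: "a < b" and x: "x \<in> {a..b}"
  shows "(f x)\<^sup>2 \<le> (2 / (b - a) + 2 * (b - a)) * (lint a b (\<lambda>t. (f t)\<^sup>2) + lint a b (\<lambda>t. (g t)\<^sup>2))"
proof -
  define A where "A = lint a b (\<lambda>t. \<bar>g t\<bar>)"
  have "(f x)\<^sup>2 \<le> 2 * (f y)\<^sup>2 + 2 * A\<^sup>2" if "y \<in> {a..b}" for y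
  proof -
    have "\<bar>f x\<bar> \<le> \<bar>f y\<bar> + A"
      using is_wderiv_abs_diff_le[OF d x that] unfolding A_def by linarith
    then have "(f x)\<^sup>2 \<le> (\<bar>f y\<bar> + A)\<^sup>2"
      by (metis abs_ge_zero power2_abs power_mono)
    also have "\<dots> \<le> 2 * (f y)\<^sup>2 + 2 * A\<^sup>2"
      using sum_squares_bound[of "\<bar>f y\<bar>" A] by (simp add: power2_sum)
    finally show ?thesis .
  qed
  then have "lint a b (\<lambda>_. (f x)\<^sup>2) \<le> lint a b (\<lambda>y. 2 * (f y)\<^sup>2 + 2 * A\<^sup>2)"
    using L2_on_square[OF is_wderiv_L2_fun[OF d]] by (intro lint_mono) auto
  then have "(b - a) * (f x)\<^sup>2 \<le> 2 * lint a b (\<lambda>t. (f t)\<^sup>2) + (b - a) * (2 * A\<^sup>2)"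
    using ab L2_on_square[OF is_wderiv_L2_fun[OF d]] by (simp add: measure_Icc algebra_simps)
  then have "(f x)\<^sup>2 \<le> 2 / (b - a) * lint a b (\<lambda>t. (f t)\<^sup>2) + 2 * A\<^sup>2"
    using ab by (simp add: field_simps)
  moreover have "A\<^sup>2 \<le> (b - a) * lint a b (\<lambda>t. (g t)\<^sup>2)"
    unfolding A_def using ab by (intro lint_abs_square_le is_wderiv_L2[OF d]) auto
  then have "2 * A\<^sup>2 \<le> 2 * (b - a) * lint a b (\<lambda>t. (g t)\<^sup>2)"
    unfolding mult.assoc by (intro mult_left_mono) auto
  ultimately have "(f x)\<^sup>2 \<le> 2 / (b - a) * lint a b (\<lambda>t. (f t)\<^sup>2) + 2 * (b - a) * lint a b (\<lambda>t. (g t)\<^sup>2)"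
    by linarith
  also have "\<dots> \<le> 2 / (b - a) * (lint a b (\<lambda>t. (f t)\<^sup>2) + lint a b (\<lambda>t. (g t)\<^sup>2))
      + 2 * (b - a) * (lint a b (\<lambda>t. (f t)\<^sup>2) + lint a b (\<lambda>t. (g t)\<^sup>2))"
    using ab by (intro add_mono mult_left_mono) auto
  finally show ?thesis by (simp only: distrib_right)
qed

lemma lint_prefix:
  assumes "integrable (lebesgue_on {a..b}) f" "t \<in> {a..b}"
  shows "lint a b (\<lambda>s. if s \<le> t then f s else 0) = lint a t f"
    and "lint a b (\<lambda>s. if t \<le> s then f s else 0) = lint t b f"
proof -
  have "lint a b (\<lambda>s. if s \<le> t then f s else 0) = lint a b (\<lambda>s. if s \<in> {a..t} then f s else 0)"
    by (intro lint_cong) auto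
  also have "\<dots> = lint a t f"
    using assms by (intro Lebesgue_Measure.integral_restrict) auto
  finally show "lint a b (\<lambda>s. if s \<le> t then f s else 0) = lint a t f" .
  have "lint a b (\<lambda>s. if t \<le> s then f s else 0) = lint a b (\<lambda>s. if s \<in> {t..b} then f s else 0)"
    by (intro lint_cong) auto
  also have "\<dots> = lint t b f"
    using assms by (intro Lebesgue_Measure.integral_restrict) auto
  finally show "lint a b (\<lambda>s. if t \<le> s then f s else 0) = lint t b f" .
qed

text \<open>Fubini for \<open>f s * g t\<close> on the triangle \<open>s \<le> t\<close>:
  integrating over \<open>s\<close> first gives \<open>(F t - F a) * g t\<close>, integrating over
  \<open>t\<close> first gives \<open>f s * (G b - G s)\<close>.\<close>

lemma is_wderiv_parts:
  assumes F: "is_wderiv a b F f" and G: "is_wderiv a b G g" and ab: "a \<le> b"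
  shows "lint a b (\<lambda>t. f t * G t + F t * g t) = F b * G b - F a * G a"
proof -
  let ?M = "lebesgue_on {a..b}"
  interpret M: finite_measure ?M by (rule finite_measure_Icc)
  interpret P: pair_sigma_finite ?M ?M ..
  have [measurable]: "f \<in> borel_measurable ?M" "g \<in> borel_measurable ?M"
    using is_wderiv_L2[OF F] is_wderiv_L2[OF G] by (auto simp: L2_on_def)
  have i: "integrable ?M f" "integrable ?M g"
    using is_wderiv_L2[OF F] is_wderiv_L2[OF G] by (auto intro: L2_on_integrable)
  have [measurable]: "(\<lambda>x::real. x) \<in> borel_measurable ?M"
    using id_borel_measurable_lebesgue_on[of "{a..b}"] by (simp add: id_def)
  have mG: "integrable ?M (\<lambda>t. f t * G t)" "integrable ?M (\<lambda>t. F t * g t)"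
    by (intro L2_on_mult_integrable is_wderiv_L2[OF F] is_wderiv_L2[OF G] is_wderiv_L2_fun[OF F] is_wderiv_L2_fun[OF G])+
  define k where "k s t = (if s \<le> t then f s * g t else 0)" for s t
  have m: "(\<lambda>(s,t). k s t) \<in> borel_measurable (?M \<Otimes>\<^sub>M ?M)"
    unfolding k_def by measurable
  have "integrable (?M \<Otimes>\<^sub>M ?M) (\<lambda>(s,t). f s * g t)"
  proof (rule P.Fubini_integrable)
    show "(\<lambda>(s,t). f s * g t) \<in> borel_measurable (?M \<Otimes>\<^sub>M ?M)" by measurable
    show "integrable ?M (\<lambda>x. LINT y|?M. norm (case (x, y) of (s, t) \<Rightarrow> f s * g t))"
      using i by (simp add: abs_mult)
    show "AE x in ?M. integrable ?M (\<lambda>y. case (x, y) of (s, t) \<Rightarrow> f s * g t)"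
      using i by simp
  qed
  then have ik: "integrable (?M \<Otimes>\<^sub>M ?M) (\<lambda>(s,t). k s t)"
    by (rule Bochner_Integration.integrable_bound[OF _ m]) (auto simp: k_def)
  have "lint a b (\<lambda>t. (lint a b (\<lambda>s. k s t))) = lint a b (\<lambda>t. F t * g t - F a * g t)"
  proof (rule lint_cong)
    fix t assume t: "t \<in> {a..b}"
    have "lint a b (\<lambda>s. k s t) = lint a b (\<lambda>s. g t * (if s \<le> t then f s else 0))"
      by (rule lint_cong) (simp add: k_def)
    also have "\<dots> = g t * lint a t f"
      using lint_prefix(1)[OF i(1) t] by simp
    also have "\<dots> = F t * g t - F a * g t"
      using is_wderivD[OF F t] by (simp add: algebra_simps)
    finally show "lint a b (\<lambda>s. k s t) = F t * g t - F a * g t" .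
  qed
  also have "\<dots> = lint a b (\<lambda>t. F t * g t) - F a * (G b - G a)"
    using mG i is_wderiv_diff_eq[OF G order_refl ab order_refl] by simp
  finally have 1: "lint a b (\<lambda>t. (lint a b (\<lambda>s. k s t))) = lint a b (\<lambda>t. F t * g t) - F a * (G b - G a)" .
  have "lint a b (\<lambda>s. (lint a b (\<lambda>t. k s t))) = lint a b (\<lambda>s. G b * f s - f s * G s)"
  proof (rule lint_cong)
    fix s assume s: "s \<in> {a..b}"
    have "lint a b (\<lambda>t. k s t) = lint a b (\<lambda>t. f s * (if s \<le> t then g t else 0))"
      by (rule lint_cong) (simp add: k_def)
    also have "\<dots> = f s * lint s b g"
      using lint_prefix(2)[OF i(2) s] by simp
    also have "\<dots> = G b * f s - f s * G s"
      using is_wderiv_diff_eq[OF G, of s b] s by (simp add: algebra_simps)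
    finally show "lint a b (\<lambda>t. k s t) = G b * f s - f s * G s" .
  qed
  also have "\<dots> = G b * (F b - F a) - lint a b (\<lambda>t. f t * G t)"
    using mG i is_wderiv_diff_eq[OF F order_refl ab order_refl] by simp
  finally have 2: "lint a b (\<lambda>s. (lint a b (\<lambda>t. k s t))) = G b * (F b - F a) - lint a b (\<lambda>t. f t * G t)" .
  have "lint a b (\<lambda>t. f t * G t + F t * g t) = lint a b (\<lambda>t. f t * G t) + lint a b (\<lambda>t. F t * g t)"
    using mG by simp
  then show ?thesis
    using P.Fubini_integral[OF ik] 1 2 by (simp add: algebra_simps)
qed

section \<open>Exponential weights and the bound on a single edge\<close>

lemma lint_exp:
  assumes "l > 0" "0 \<le> t"
  shows "lint 0 t (\<lambda>s. exp (l * s)) = (exp (l * t) - 1) / l"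
proof -
  have "((\<lambda>s. exp (l * s)) has_integral (exp (l * t) / l - exp (l * 0) / l)) {0..t}"
    using assms by (intro fundamental_theorem_of_calculus)
      (auto intro!: derivative_eq_intros simp flip: has_real_derivative_iff_has_vector_derivative)
  moreover have "integrable (lebesgue_on {0..t}) (\<lambda>s. exp (l * s))"
    by (intro L2_on_integrable L2_on_continuous continuous_intros)
  ultimately show ?thesis
    using assms by (simp add: lebesgue_integral_eq_integral integral_unique diff_divide_distrib)
qed

text \<open>A weighted maximum of \<open>exp (- l t) \<bar>y t\<bar>\<close> replaces the Gronwall inequality: for large \<open>l\<close>
  the integral operator is a contraction in the weighted norm.\<close>

lemma edge_sup_bound:
  assumes y: "is_wderiv 0 L y g" and L: "0 < L" and D: "L2_on 0 L D"
    and D_cases: "\<And>t. t \<in> {0..L} \<Longrightarrow> \<bar>D t\<bar> \<le> P \<or> (\<exists>s\<in>{0..t}. D t = y s)"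
    and y0: "\<bar>y 0\<bar> \<le> P" and S: "lint 0 L (\<lambda>t. \<bar>g t + b * y t + c * D t\<bar>) \<le> S" and t: "t \<in> {0..L}"
  shows "\<bar>y t\<bar> \<le> 2 * exp ((2 * (\<bar>b\<bar> + \<bar>c\<bar>) + 1) * L) * (1 + \<bar>c\<bar> * L) * (P + S)"
proof -
  \<comment> \<open>Chosen so that the ratio of \<open>\<bar>b\<bar> + \<bar>c\<bar>\<close> to
    \<open>l\<close> is at most 1/2; the summand 1 keeps \<open>l\<close> positive when both
    coefficients vanish.\<close>
  define l where "l = 2 * (\<bar>b\<bar> + \<bar>c\<bar>) + 1"
  define u where "u t = g t + b * y t + c * D t" for t
  have l: "0 < l" by (simp add: l_def)
  have P: "0 \<le> P" using y0 by linarith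
  have u2: "L2_on 0 L u"
    unfolding u_def using y D by (intro L2_on_add L2_on_cmult) (auto dest: is_wderiv_L2 is_wderiv_L2_fun)
  have S0: "0 \<le> S" by (rule order_trans[OF lint_nonneg S]) simp
  have "continuous_on {0..L} (\<lambda>t. exp (- l * t) * \<bar>y t\<bar>)"
    using is_wderiv_continuous[OF y] by (intro continuous_intros)
  then obtain t0 where t0: "t0 \<in> {0..L}"
    and mx: "\<And>s. s \<in> {0..L} \<Longrightarrow> exp (- l * s) * \<bar>y s\<bar> \<le> exp (- l * t0) * \<bar>y t0\<bar>"
    using continuous_attains_sup[of "{0..L}" "\<lambda>t. exp (- l * t) * \<bar>y t\<bar>"] L by auto
  define N where "N = exp (- l * t0) * \<bar>y t0\<bar>"
  have N0: "0 \<le> N" by (simp add: N_def)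
  have ys: "\<bar>y s\<bar> \<le> N * exp (l * s)" if "s \<in> {0..L}" for s
  proof -
    have "exp (l * s) * (exp (- l * s) * \<bar>y s\<bar>) \<le> exp (l * s) * N"
      using mx[OF that] unfolding N_def by (intro mult_left_mono) auto
    moreover have "exp (l * s) * (exp (- l * s) * \<bar>y s\<bar>) = \<bar>y s\<bar>"
      by (simp add: exp_minus)
    ultimately show ?thesis by (simp only: mult.commute[of N])
  qed
  \<comment> \<open>A delayed value is either inherited, hence at most \<open>P\<close>, or taken
    from the same edge at an earlier time, where the exponential bound is smaller.\<close>
  have Ds: "\<bar>D s\<bar> \<le> P + N * exp (l * s)" if s: "s \<in> {0..L}" for s
    using D_cases[OF s]
  proof
    assume "\<exists>r\<in>{0..s}. D s = y r"
    then obtain r where r: "r \<in> {0..s}" "D s = y r" by auto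
    have "\<bar>D s\<bar> \<le> N * exp (l * r)" using ys[of r] r s by simp
    also have "\<dots> \<le> N * exp (l * s)" using r N0 l by (intro mult_left_mono) auto
    finally show ?thesis using P by simp
  next
    assume "\<bar>D s\<bar> \<le> P"
    then show ?thesis using N0 by (intro add_increasing2) auto
  qed
  have gs: "\<bar>g s\<bar> \<le> \<bar>u s\<bar> + (\<bar>c\<bar> * P + (\<bar>b\<bar> + \<bar>c\<bar>) * N * exp (l * s))" if s: "s \<in> {0..L}" for s
  proof -
    have "\<bar>g s\<bar> \<le> \<bar>u s\<bar> + \<bar>b\<bar> * \<bar>y s\<bar> + \<bar>c\<bar> * \<bar>D s\<bar>"
      unfolding u_def abs_mult[symmetric] by linarith
    also have "\<dots> \<le> \<bar>u s\<bar> + \<bar>b\<bar> * (N * exp (l * s)) + \<bar>c\<bar> * (P + N * exp (l * s))"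
      using ys[OF s] Ds[OF s] by (intro add_mono mult_left_mono) auto
    finally show ?thesis by (simp add: algebra_simps)
  qed
  have sub: "L2_on 0 t0 u" "L2_on 0 t0 g"
    using t0 L2_on_subset[OF u2, of 0 t0] L2_on_subset[OF is_wderiv_L2[OF y], of 0 t0] by auto
  have iexp: "integrable (lebesgue_on {0..t0}) (\<lambda>s. exp (l * s))"
    by (intro L2_on_integrable L2_on_continuous continuous_intros)
  have "\<bar>y t0\<bar> \<le> \<bar>y 0\<bar> + \<bar>lint 0 t0 g\<bar>"
    using is_wderivD[OF y t0] by linarith
  also have "\<bar>lint 0 t0 g\<bar> \<le> lint 0 t0 (\<lambda>s. \<bar>g s\<bar>)" by (rule integral_abs_bound)
  also have "\<dots> \<le> lint 0 t0 (\<lambda>s. \<bar>u s\<bar> + (\<bar>c\<bar> * P + (\<bar>b\<bar> + \<bar>c\<bar>) * N * exp (l * s)))"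
    using t0 by (intro lint_mono gs Bochner_Integration.integrable_add integrable_abs
        L2_on_integrable[OF sub(1)] L2_on_integrable[OF sub(2)] integrable_const_Icc
        integrable_mult_right iexp) auto
  also have "\<dots> = lint 0 t0 (\<lambda>s. \<bar>u s\<bar>) + (t0 * (\<bar>c\<bar> * P) + (\<bar>b\<bar> + \<bar>c\<bar>) * N * ((exp (l * t0) - 1) / l))"
    using L2_on_integrable[OF sub(1)] iexp t0 l by (simp add: measure_Icc lint_exp)
  also have "lint 0 t0 (\<lambda>s. \<bar>u s\<bar>) \<le> lint 0 L (\<lambda>s. \<bar>u s\<bar>)"
    using t0 L2_on_integrable[OF u2] by (intro lint_subset_mono) auto
  also have "\<dots> \<le> S" using S by (simp add: u_def)
  also have "(\<bar>b\<bar> + \<bar>c\<bar>) * N * ((exp (l * t0) - 1) / l) \<le> N * exp (l * t0) / 2"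
  proof -
    have "(\<bar>b\<bar> + \<bar>c\<bar>) * N * ((exp (l * t0) - 1) / l) = (\<bar>b\<bar> + \<bar>c\<bar>) / l * (N * (exp (l * t0) - 1))"
      by simp
    also have "\<dots> \<le> 1 / 2 * (N * exp (l * t0))"
    proof (rule mult_mono)
      show "(\<bar>b\<bar> + \<bar>c\<bar>) / l \<le> 1 / 2" using l by (simp add: field_simps) (simp add: l_def)
      show "N * (exp (l * t0) - 1) \<le> N * exp (l * t0)" using N0 by (intro mult_left_mono) auto
      show "0 \<le> N * (exp (l * t0) - 1)" using N0 l t0 by simp
    qed simp
    finally show ?thesis by simp
  qed
  also have "t0 * (\<bar>c\<bar> * P) \<le> L * (\<bar>c\<bar> * P)"
    using t0 P by (intro mult_right_mono) auto
  finally have y_t0: "\<bar>y t0\<bar> \<le> P + (S + (L * (\<bar>c\<bar> * P) + N * exp (l * t0) / 2))"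
    using y0 by simp
  define R where "R = (1 + \<bar>c\<bar> * L) * (P + S)"
  have R: "P + S + L * (\<bar>c\<bar> * P) \<le> R" and R0: "0 \<le> R"
    using L P S0 by (auto simp: R_def algebra_simps)
  \<comment> \<open>At the maximum point the unknown \<open>N\<close> reappears on the right with
    factor 1/2 and is absorbed into the left side.\<close>
  have "N \<le> exp (- l * t0) * (R + N * exp (l * t0) / 2)"
    unfolding N_def[of] using y_t0 R unfolding N_def by (intro mult_left_mono) auto
  also have "\<dots> = exp (- l * t0) * R + N / 2"
    by (simp add: algebra_simps exp_minus)
  also have "exp (- l * t0) * R \<le> 1 * R"
    using l t0 R0 by (intro mult_right_mono) auto
  finally have N: "N \<le> 2 * R" by simp
  have "\<bar>y t\<bar> \<le> N * exp (l * t)" by (rule ys[OF t])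
  also have "\<dots> \<le> (2 * R) * exp (l * L)"
    using N N0 t l by (intro mult_mono) auto
  also have "\<dots> = 2 * exp (l * L) * (1 + \<bar>c\<bar> * L) * (P + S)"
    unfolding R_def by (simp only: mult_ac)
  finally show ?thesis unfolding l_def .
qed

section \<open>Limits and null tails\<close>

lemma square_sum3_le: "(x + y + z)\<^sup>2 \<le> 3 * x\<^sup>2 + 3 * y\<^sup>2 + 3 * (z::real)\<^sup>2"
  using zero_le_power2[of "x - y"] zero_le_power2[of "x - z"] zero_le_power2[of "y - z"]
  by (simp add: power2_eq_square algebra_simps)

text \<open>Mean-square convergence of the derivatives on a bounded interval carries the integrals
  over \<open>[a,x]\<close> along, so the limit can be taken in the integral representation at every
  single point.\<close>

lemma is_wderiv_limit:
  assumes d: "\<And>n. is_wderiv a b (f n) (g n)" and ab: "a \<le> b"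
    and F: "\<And>x. x \<in> {a..b} \<Longrightarrow> (\<lambda>n. f n x) \<longlonglongrightarrow> F x"
    and G: "L2_on a b G" "(\<lambda>n. lint a b (\<lambda>t. (g n t - G t)\<^sup>2)) \<longlonglongrightarrow> 0"
  shows "is_wderiv a b F G"
proof (rule is_wderivI[OF G(1)])
  fix x assume x: "x \<in> {a..b}"
  have "(\<lambda>n. lint a x (g n) - lint a x G) \<longlonglongrightarrow> 0"
  proof (rule Lim_null_comparison)
    show "(\<lambda>n. sqrt ((b - a) * lint a b (\<lambda>t. (g n t - G t)\<^sup>2))) \<longlonglongrightarrow> 0"
      using tendsto_real_sqrt[OF tendsto_mult_left[OF G(2), of "b - a"]] by simp
    have "\<bar>lint a x (g n) - lint a x G\<bar> \<le> sqrt ((b - a) * lint a b (\<lambda>t. (g n t - G t)\<^sup>2))" for n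
    proof (rule real_le_rsqrt)
      have L: "L2_on a b (\<lambda>t. g n t - G t)" by (intro L2_on_diff is_wderiv_L2[OF d] G)
      have i: "integrable (lebesgue_on {a..x}) (g n)" "integrable (lebesgue_on {a..x}) G"
        using x by (auto intro!: L2_on_integrable L2_on_subset[OF G(1)] L2_on_subset[OF is_wderiv_L2[OF d]])
      have "\<bar>lint a x (g n) - lint a x G\<bar> = \<bar>lint a x (\<lambda>t. g n t - G t)\<bar>" using i by simp
      also have "\<dots> \<le> lint a x (\<lambda>t. \<bar>g n t - G t\<bar>)" by (rule integral_abs_bound)
      also have "\<dots> \<le> lint a b (\<lambda>t. \<bar>g n t - G t\<bar>)"
        using x by (intro lint_subset_mono integrable_abs L2_on_integrable[OF L]) auto
      finally have "\<bar>lint a x (g n) - lint a x G\<bar>\<^sup>2 \<le> (lint a b (\<lambda>t. \<bar>g n t - G t\<bar>))\<^sup>2"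
        by (rule power_mono) simp
      also have "\<dots> \<le> (b - a) * lint a b (\<lambda>t. (g n t - G t)\<^sup>2)"
        by (rule lint_abs_square_le[OF L ab])
      finally show "\<bar>lint a x (g n) - lint a x G\<bar>\<^sup>2 \<le> (b - a) * lint a b (\<lambda>t. (g n t - G t)\<^sup>2)" .
    qed
    then show "\<forall>\<^sub>F n in sequentially. norm (lint a x (g n) - lint a x G)
        \<le> sqrt ((b - a) * lint a b (\<lambda>t. (g n t - G t)\<^sup>2))" by simp
  qed
  then have "(\<lambda>n. lint a x (g n)) \<longlonglongrightarrow> lint a x G" by (rule Lim_null[THEN iffD2])
  then have "(\<lambda>n. f n a + lint a x (g n)) \<longlonglongrightarrow> F a + lint a x G"
    using F[of a] ab by (intro tendsto_add) auto
  moreover have "f n a + lint a x (g n) = f n x" for n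
    using is_wderivD[OF d x] by simp
  ultimately show "F x = F a + lint a x G"
    using F[OF x] LIMSEQ_unique by fastforce
qed

text \<open>The right-hand side has the form in which the parallelogram identity bounds the
  differences of a minimizing sequence.\<close>

lemma Cauchy_of_square_bound:
  fixes x :: "nat \<Rightarrow> real"
  assumes b: "\<And>i j. (x i - x j)\<^sup>2 \<le> e i + e j" and e: "e \<longlonglongrightarrow> 0"
  shows "Cauchy x"
proof (rule CauchyI)
  fix r :: real assume r: "0 < r"
  then have "\<forall>\<^sub>F n in sequentially. e n < r\<^sup>2 / 2"
    using e by (intro order_tendstoD) auto
  then obtain N where N: "\<And>n. n \<ge> N \<Longrightarrow> e n < r\<^sup>2 / 2" by (auto simp: eventually_sequentially)
  have "norm (x i - x j) < r" if "i \<ge> N" "j \<ge> N" for i j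
  proof -
    have "\<bar>x i - x j\<bar>\<^sup>2 < r\<^sup>2" using b[of i j] N[OF that(1)] N[OF that(2)] by simp
    then show ?thesis using r power2_less_imp_less[of "\<bar>x i - x j\<bar>" r] by simp
  qed
  then show "\<exists>M. \<forall>m\<ge>M. \<forall>n\<ge>M. norm (x m - x n) < r" by blast
qed

lemma AE_Icc_combine:
  assumes "AE t in lebesgue_on {a..s}. P t" "AE t in lebesgue_on {s..b::real}. P t"
  shows "AE t in lebesgue_on {a..b}. P t"
  using assms by (auto simp: AE_restrict_space_iff elim!: eventually_elim2)

lemma AE_zero_tail:
  assumes "is_wderiv a b f g" "\<And>t. t \<in> {a..b} \<Longrightarrow> f t = 0"
  shows "AE t in lebesgue_on {a..b}. g t = 0"
proof -
  have "is_wderiv a b (\<lambda>_. 0) (\<lambda>_. 0)" using is_wderiv_linear[of a b 0 0] by simp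
  moreover have "is_wderiv a b f (\<lambda>_. 0) \<longleftrightarrow> is_wderiv a b (\<lambda>_. 0) (\<lambda>_. 0)"
    by (rule is_wderiv_cong_eq) (auto simp: assms)
  ultimately show ?thesis
    using is_wderiv_AE_unique[OF assms(1)] by blast
qed

lemma lint_sum:
  assumes "\<And>i. i \<in> I \<Longrightarrow> integrable (lebesgue_on {a..b}) (f i)"
  shows "lint a b (\<lambda>t. \<Sum>i\<in>I. f i t) = (\<Sum>i\<in>I. lint a b (f i))"
  using assms by (rule Bochner_Integration.integral_sum)

section \<open>Extension by zero and the du Bois-Reymond lemma\<close>

lemma is_wderiv_zero: "is_wderiv a b (\<lambda>_. 0) (\<lambda>_. 0)"
  using is_wderiv_linear[of a b 0 0] by simp

lemma is_wderiv_zero_extend_left: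
  assumes "is_wderiv s b f g" "f s = 0" "a \<le> s" "s \<le> b"
  shows "is_wderiv a b (\<lambda>t. if s \<le> t then f t else 0) (\<lambda>t. if s \<le> t then g t else 0)"
proof -
  have "is_wderiv a b (\<lambda>t. if t < s then 0 else f t) (\<lambda>t. if t < s then 0 else g t)"
    by (rule is_wderiv_piecewise[OF is_wderiv_zero assms(1)]) (use assms in auto)
  then show ?thesis
    by (subst is_wderiv_cong_eq) auto
qed

lemma is_wderiv_zero_extend_right:
  assumes "is_wderiv a s f g" "f s = 0" "a \<le> s" "s \<le> b"
  shows "is_wderiv a b (\<lambda>t. if t \<le> s then f t else 0) (\<lambda>t. if t \<le> s then g t else 0)"
proof -
  have d: "is_wderiv a b (\<lambda>t. if t < s then f t else 0) (\<lambda>t. if t < s then g t else 0)"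
    by (rule is_wderiv_piecewise[OF assms(1) is_wderiv_zero]) (use assms in auto)
  \<comment> \<open>Gluing produces a strict cutoff, the statement has a weak one; the derivatives
    differ at \<open>s\<close> only.\<close>
  have ae: "AE t in lebesgue_on {a..b}. (if t < s then g t else 0) = (if t \<le> s then g t else 0)"
    using AE_Icc_neq[where a = a and b = b and c = s] by eventually_elim auto
  show ?thesis
    by (rule is_wderiv_cong[OF d _ ae]) (use assms in auto)
qed

lemma is_wderiv_zero_extend:
  assumes "is_wderiv 0 s f g" "f 0 = 0" "f s = 0" "a \<le> 0" "0 \<le> s" "s \<le> b"
  shows "is_wderiv a b (\<lambda>t. if 0 \<le> t \<and> t \<le> s then f t else 0) (\<lambda>t. if 0 \<le> t \<and> t \<le> s then g t else 0)"
proof -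
  have "is_wderiv a b (\<lambda>t. if 0 \<le> t then if t \<le> s then f t else 0 else 0)
     (\<lambda>t. if 0 \<le> t then if t \<le> s then g t else 0 else 0)"
    using assms by (intro is_wderiv_zero_extend_left is_wderiv_zero_extend_right) auto
  then show ?thesis
    by (subst is_wderiv_cong_eq) auto
qed

text \<open>Testing with the primitive of \<open>u - Q - \<kappa>\<close>, where \<open>Q\<close> is the primitive of \<open>q\<close> and
  \<open>\<kappa>\<close> the mean of \<open>u - Q\<close>, yields \<open>\<integral>(u - Q - \<kappa>)\<^sup>2 = 0\<close>.\<close>

lemma du_Bois_Reymond:
  assumes l: "0 < l" and u: "L2_on 0 l u" and q: "L2_on 0 l q"
    and test: "\<And>F v. is_wderiv 0 l F v \<Longrightarrow> F 0 = 0 \<Longrightarrow> F l = 0 \<Longrightarrow> lint 0 l (\<lambda>t. u t * v t + q t * F t) = 0"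
  obtains \<kappa> where "AE t in lebesgue_on {0..l}. u t = \<kappa> + lint 0 t q"
proof -
  define Q where "Q t = lint 0 t q" for t
  have Q: "is_wderiv 0 l Q q" by (rule is_wderiv_integral[OF q, where C = 0]) (simp add: Q_def)
  define g where "g t = u t - Q t" for t
  have g: "L2_on 0 l g" unfolding g_def by (intro L2_on_diff u is_wderiv_L2_fun[OF Q])
  define \<kappa> where "\<kappa> = lint 0 l g / l"
  define v where "v t = g t - \<kappa>" for t
  have v: "L2_on 0 l v" unfolding v_def by (intro L2_on_diff g) simp
  have v0: "lint 0 l v = 0"
    unfolding v_def using L2_on_integrable[OF g] l by (simp add: measure_Icc \<kappa>_def)
  define F where "F t = lint 0 t v" for t
  have F: "is_wderiv 0 l F v" by (rule is_wderiv_integral[OF v, where C = 0]) (simp add: F_def)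
  have F0: "F 0 = 0" "F l = 0" using v0 by (auto simp: F_def)
  \<comment> \<open>Integration by parts exchanges \<open>q * F\<close> for \<open>- Q * v\<close>;
    the boundary terms vanish with \<open>F\<close>.\<close>
  have p: "lint 0 l (\<lambda>t. q t * F t + Q t * v t) = 0"
    using is_wderiv_parts[OF Q F] l F0 by simp
  have i: "integrable (lebesgue_on {0..l}) (\<lambda>t. u t * v t + q t * F t)"
    "integrable (lebesgue_on {0..l}) (\<lambda>t. q t * F t + Q t * v t)"
    "integrable (lebesgue_on {0..l}) v"
    by (intro Bochner_Integration.integrable_add L2_on_mult_integrable u q v is_wderiv_L2_fun[OF Q]
        is_wderiv_L2_fun[OF F] L2_on_integrable)+
  have "lint 0 l (\<lambda>t. (v t)\<^sup>2)
      = lint 0 l (\<lambda>t. (u t * v t + q t * F t) - (q t * F t + Q t * v t) - \<kappa> * v t)"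
    by (intro lint_cong) (simp add: v_def g_def power2_eq_square algebra_simps)
  also have "\<dots> = lint 0 l (\<lambda>t. u t * v t + q t * F t) - lint 0 l (\<lambda>t. q t * F t + Q t * v t)
      - \<kappa> * lint 0 l v"
    using i by (simp only: Bochner_Integration.integral_diff Bochner_Integration.integrable_diff
        integrable_mult_right integral_mult_right_zero)
  also have "\<dots> = 0" using test[OF F F0] p v0 by simp
  finally have "AE t in lebesgue_on {0..l}. (v t)\<^sup>2 = 0"
    using integral_nonneg_eq_0_iff_AE[OF L2_on_square[OF v]] by simp
  then have "AE t in lebesgue_on {0..l}. u t = \<kappa> + lint 0 t q"
    by eventually_elim (simp add: v_def g_def Q_def)
  then show ?thesis by (rule that)
qed

text \<open>\<open>W21_norm\<close> uses a derivative picked by choice; uniqueness almost everywhere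
  makes any derivative at hand equally good.\<close>

lemma W21_norm_square:
  assumes "is_wderiv a b f g"
  shows "(W21_norm a b f)\<^sup>2 = lint a b (\<lambda>t. (f t)\<^sup>2) + lint a b (\<lambda>t. (g t)\<^sup>2)"
proof -
  have w: "is_wderiv a b f (wderiv a b f)"
    using assms by (intro is_wderiv_wderiv) (auto simp: W21_iff)
  have "AE t in lebesgue_on {a..b}. (wderiv a b f t)\<^sup>2 = (g t)\<^sup>2"
    using is_wderiv_AE_unique[OF w assms] by eventually_elim simp
  then have "lint a b (\<lambda>t. (wderiv a b f t)\<^sup>2) = lint a b (\<lambda>t. (g t)\<^sup>2)"
    by (rule lint_cong_AE)
      (intro borel_measurable_integrable L2_on_square is_wderiv_L2[OF w] is_wderiv_L2[OF assms])+
  then show ?thesis by (simp add: W21_norm_def)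
qed

section \<open>Functions on the tree and energy estimates\<close>

text \<open>Edge \<open>j\<close> ends at vertex \<open>j\<close>, so for \<open>j \<ge> 2\<close>
  the number \<open>k j\<close> names both the initial vertex of edge \<open>j\<close> and the edge
  leading to it.\<close>

locale delay_tree =
  fixes m d :: nat and k :: "nat \<Rightarrow> nat" and T b c :: "nat \<Rightarrow> real" and \<tau> :: real
  assumes m: "1 \<le> m" and dm: "d < m"
    and k1: "k 1 = 0" and k_range: "\<forall>j\<in>{2..m}. k j \<in> {1..d}"
    and k_iter: "\<forall>j\<in>{1..m}. \<exists>n. (k ^^ n) j = 1"
    and T_tau: "\<forall>j\<in>{1..m}. 0 < T j \<and> \<tau> < T j"
    and tau: "0 < \<tau>"
begin

text \<open>The history is left free, so these pairs form a linear space; \<open>feasible\<close>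
  cuts out the affine subset with history \<phi>, and \<open>null_start\<close> its space of
  directions.\<close>

definition tree_fun :: "(nat \<Rightarrow> real \<Rightarrow> real) \<Rightarrow> (nat \<Rightarrow> real \<Rightarrow> real) \<Rightarrow> bool" where
  "tree_fun y dy \<longleftrightarrow> (\<forall>j\<in>{1..m}. is_wderiv (tleft \<tau> j) (T j) (y j) (dy j))
    \<and> (\<forall>j\<in>{2..m}. y j 0 = y (k j) (T (k j)))
    \<and> (\<forall>j\<in>{d+1..m}. \<forall>t\<in>{T j - \<tau>..T j}. y j t = 0)"

definition null_start :: "(nat \<Rightarrow> real \<Rightarrow> real) \<Rightarrow> bool" where
  "null_start y \<longleftrightarrow> (\<forall>t\<in>{- \<tau>..0}. y 1 t = 0)"

abbreviation "delay \<equiv> ydel \<tau> k T"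
abbreviation "E \<equiv> ell b c \<tau> k T"

definition form where
  "form y dy z dz = (\<Sum>j = 1..m. lint 0 (T j) (\<lambda>t. E y dy j t * E z dz j t))"

definition energy where
  "energy y dy = (\<Sum>j = 1..m. lint 0 (T j) (\<lambda>t. (E y dy j t)\<^sup>2))"

definition start_norm where
  "start_norm y dy = lint (- \<tau>) 0 (\<lambda>t. (y (1::nat) t)\<^sup>2) + lint (- \<tau>) 0 (\<lambda>t. (dy (1::nat) t)\<^sup>2)"

lemma tree_fun_wderiv: "tree_fun y dy \<Longrightarrow> j \<in> {1..m} \<Longrightarrow> is_wderiv (tleft \<tau> j) (T j) (y j) (dy j)"
  by (simp add: tree_fun_def)

lemma tree_fun_vertex: "tree_fun y dy \<Longrightarrow> j \<in> {2..m} \<Longrightarrow> y j 0 = y (k j) (T (k j))"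
  by (simp add: tree_fun_def)

lemma tree_fun_end: "tree_fun y dy \<Longrightarrow> j \<in> {1..m} \<Longrightarrow> d < j \<Longrightarrow> t \<in> {T j - \<tau>..T j} \<Longrightarrow> y j t = 0"
  by (simp add: tree_fun_def)

lemma T_pos: "j \<in> {1..m} \<Longrightarrow> 0 < T j" and tau_less: "j \<in> {1..m} \<Longrightarrow> \<tau> < T j"
  using T_tau by auto

lemma tleft_le: "tleft \<tau> j \<le> 0"
  using tau by (auto simp: tleft_def)

lemma parent: "j \<in> {1..m} \<Longrightarrow> j \<noteq> 1 \<Longrightarrow> k j \<in> {1..m} \<and> k j \<le> d"
  using k_range dm by (cases "j = 1") (auto dest: bspec[of _ _ j])

lemma tree_fun_wderiv0: "tree_fun y dy \<Longrightarrow> j \<in> {1..m} \<Longrightarrow> is_wderiv 0 (T j) (y j) (dy j)"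
  using is_wderiv_subset[OF tree_fun_wderiv tleft_le order_refl] .

lemma tree_fun_wderiv_start: "tree_fun y dy \<Longrightarrow> is_wderiv (- \<tau>) 0 (y 1) (dy 1)"
  using is_wderiv_subset[OF tree_fun_wderiv[of y dy 1], of "- \<tau>" 0] m T_pos[of 1]
  by (auto simp: tleft_def)

text \<open>Below \<tau> the delayed function follows the parent edge, afterwards the edge itself,
  and the vertex condition makes the pieces meet at \<open>t = \<tau>\<close>. The delay thus costs
  no regularity and commutes with differentiation.\<close>

lemma delay_wderiv:
  assumes y: "tree_fun y dy" and j: "j \<in> {1..m}"
  shows "is_wderiv 0 (T j) (delay y j) (delay dy j)"
proof (cases "j = 1")
  case True
  have "is_wderiv (- \<tau>) (T 1) (y 1) (dy 1)"
    using tree_fun_wderiv[OF y j] True by (simp add: tleft_def)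
  from is_wderiv_subset[OF is_wderiv_shift[OF this, of "- \<tau>"], of 0 "T 1"]
  show ?thesis using tau True by (simp add: ydel_def[abs_def])
next
  case False
  then have kj: "k j \<in> {1..m}" using parent j by auto
  have "is_wderiv (T (k j) - \<tau>) (T (k j)) (y (k j)) (dy (k j))"
    by (rule is_wderiv_subset[OF tree_fun_wderiv0[OF y kj]]) (use tau_less[OF kj] tau in auto)
  from is_wderiv_shift[OF this, of "T (k j) - \<tau>"]
  have 1: "is_wderiv 0 \<tau> (\<lambda>t. y (k j) (t - \<tau> + T (k j))) (\<lambda>t. dy (k j) (t - \<tau> + T (k j)))"
    by (simp add: algebra_simps)
  have "is_wderiv 0 (T j - \<tau>) (y j) (dy j)"
    by (rule is_wderiv_subset[OF tree_fun_wderiv0[OF y j]]) (use tau in auto)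
  from is_wderiv_shift[OF this, of "- \<tau>"]
  have 2: "is_wderiv \<tau> (T j) (\<lambda>t. y j (t - \<tau>)) (\<lambda>t. dy j (t - \<tau>))" by simp
  have "is_wderiv 0 (T j) (\<lambda>t. if t < \<tau> then y (k j) (t - \<tau> + T (k j)) else y j (t - \<tau>))
     (\<lambda>t. if t < \<tau> then dy (k j) (t - \<tau> + T (k j)) else dy j (t - \<tau>))"
    by (rule is_wderiv_piecewise[OF 1 2]) (use tree_fun_vertex[OF y, of j] False j tau tau_less[OF j] in auto)
  then show ?thesis using False by (simp add: ydel_def[abs_def])
qed

lemma E_L2: "tree_fun y dy \<Longrightarrow> j \<in> {1..m} \<Longrightarrow> L2_on 0 (T j) (E y dy j)"
  unfolding ell_def[abs_def]
  by (intro L2_on_add L2_on_cmult is_wderiv_L2[OF tree_fun_wderiv0]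
      is_wderiv_L2_fun[OF tree_fun_wderiv0] is_wderiv_L2_fun[OF delay_wderiv])

lemma tree_fun_add:
  "tree_fun y dy \<Longrightarrow> tree_fun z dz \<Longrightarrow> tree_fun (\<lambda>j t. y j t + z j t) (\<lambda>j t. dy j t + dz j t)"
  unfolding tree_fun_def by (auto intro: is_wderiv_add)

lemma tree_fun_cmult:
  "tree_fun y dy \<Longrightarrow> tree_fun (\<lambda>j t. r * y j t) (\<lambda>j t. r * dy j t)"
  unfolding tree_fun_def by (auto intro: is_wderiv_cmult)

lemma tree_fun_diff:
  "tree_fun y dy \<Longrightarrow> tree_fun z dz \<Longrightarrow> tree_fun (\<lambda>j t. y j t - z j t) (\<lambda>j t. dy j t - dz j t)"
  unfolding tree_fun_def by (auto intro: is_wderiv_diff)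

lemma E_add: "E (\<lambda>j t. y j t + z j t) (\<lambda>j t. dy j t + dz j t) j t = E y dy j t + E z dz j t"
  and E_cmult: "E (\<lambda>j t. r * y j t) (\<lambda>j t. r * dy j t) j t = r * E y dy j t"
  by (auto simp: ell_def ydel_def algebra_simps)

text \<open>The pair \<open>i\<close>, \<open>s\<close> depends on \<open>j\<close> and
  \<open>t\<close> but not on \<open>y\<close>, so a bound for all values of \<open>y\<close> on the
  tree is at once a bound for the delayed function.\<close>

lemma delay_value:
  assumes "j \<in> {1..m}" "t \<in> {0..T j}"
  obtains i s where "i \<in> {1..m}" "s \<in> {tleft \<tau> i..T i}" "\<And>y :: nat \<Rightarrow> real \<Rightarrow> real. delay y j t = y i s"
proof (cases "j = 1")
  case True
  show ?thesis
    by (rule that[of 1 "t - \<tau>"]) (use True assms m tau in \<open>auto simp: ydel_def tleft_def\<close>)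
next
  case False
  note kj = parent[OF assms(1) False]
  show ?thesis
  proof (cases "t < \<tau>")
    case True
    show ?thesis
      by (rule that[of "k j" "t - \<tau> + T (k j)"])
        (use True False kj assms m tau tleft_le[of "k j"] tau_less[of "k j"] in \<open>auto simp: ydel_def\<close>)
  next
    case f: False
    show ?thesis
      by (rule that[of j "t - \<tau>"])
        (use f False assms tau tleft_le[of j] in \<open>auto simp: ydel_def\<close>)
  qed
qed

section \<open>Supremum bounds along the tree\<close>

lemma edge_const_ge_1:
  assumes "0 < L"
  shows "1 \<le> 2 * exp ((2 * (\<bar>p\<bar> + \<bar>q\<bar>) + 1) * L) * (1 + \<bar>q\<bar> * L :: real)"
proof -
  have "1 * 1 \<le> (2 * exp ((2 * (\<bar>p\<bar> + \<bar>q\<bar>) + 1) * L)) * (1 + \<bar>q\<bar> * L)"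
  proof (intro mult_mono)
    have "1 \<le> exp ((2 * (\<bar>p\<bar> + \<bar>q\<bar>) + 1) * L)" using assms by simp
    then show "1 \<le> 2 * exp ((2 * (\<bar>p\<bar> + \<bar>q\<bar>) + 1) * L)" by linarith
  qed (use assms in auto)
  then show ?thesis by simp
qed

lemma sup_bound_root_edge:
  "\<exists>K\<ge>1. \<forall>y dy P S. tree_fun y dy \<longrightarrow> (\<forall>t\<in>{- \<tau>..0}. \<bar>y 1 t\<bar> \<le> P)
    \<longrightarrow> (\<forall>j\<in>{1..m}. lint 0 (T j) (\<lambda>t. \<bar>E y dy j t\<bar>) \<le> S)
    \<longrightarrow> (\<forall>t\<in>{0..T 1}. \<bar>y 1 t\<bar> \<le> K * (P + S))"
proof -
  define K where "K = 2 * exp ((2 * (\<bar>b 1\<bar> + \<bar>c 1\<bar>) + 1) * T 1) * (1 + \<bar>c 1\<bar> * T 1)"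
  have T1: "0 < T 1" "1 \<in> {1..m}" using T_pos[of 1] m by auto
  have K: "1 \<le> K" unfolding K_def by (rule edge_const_ge_1[OF T1(1)])
  show ?thesis
  proof (intro exI[of _ K] conjI K allI impI ballI)
    fix y dy P S t
    assume y: "tree_fun y dy" and P: "\<forall>t\<in>{- \<tau>..0}. \<bar>y 1 t\<bar> \<le> P"
      and S: "\<forall>j\<in>{1..m}. lint 0 (T j) (\<lambda>t. \<bar>E y dy j t\<bar>) \<le> S" and t: "t \<in> {0..T 1}"
    show "\<bar>y 1 t\<bar> \<le> K * (P + S)"
      unfolding K_def
    proof (rule edge_sup_bound[OF tree_fun_wderiv0[OF y T1(2)] T1(1) is_wderiv_L2_fun[OF delay_wderiv[OF y T1(2)]]])
      show "\<bar>delay y 1 t\<bar> \<le> P \<or> (\<exists>s\<in>{0..t}. delay y 1 t = y 1 s)" if "t \<in> {0..T 1}" for t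
        using P that tau by (cases "t < \<tau>") (auto simp: ydel_def)
      show "lint 0 (T 1) (\<lambda>t. \<bar>dy 1 t + b 1 * y 1 t + c 1 * delay y 1 t\<bar>) \<le> S"
        using S T1 by (auto simp: ell_def)
    qed (use P tau t in auto)
  qed
qed

text \<open>Induction on the number of steps to the root edge. The bound \<open>K0 * (P + S)\<close>
  on the parent edge takes the place of \<open>P\<close>, since it controls both the initial value
  and the delayed values that reach back over the vertex.\<close>

lemma sup_bound_edge_ex:
  assumes "j \<in> {1..m}" "(k ^^ n) j = 1"
  shows "\<exists>K\<ge>1. \<forall>y dy P S. tree_fun y dy \<longrightarrow> (\<forall>t\<in>{- \<tau>..0}. \<bar>y 1 t\<bar> \<le> P)
    \<longrightarrow> (\<forall>j\<in>{1..m}. lint 0 (T j) (\<lambda>t. \<bar>E y dy j t\<bar>) \<le> S)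
    \<longrightarrow> (\<forall>t\<in>{0..T j}. \<bar>y j t\<bar> \<le> K * (P + S))"
  using assms
proof (induction n arbitrary: j)
  case 0
  then show ?case using sup_bound_root_edge by simp
next
  case (Suc n)
  \<comment> \<open>\<open>k 0\<close> is unconstrained, so iterates starting at 1 may come back to
    1; the root edge therefore needs its own case here too.\<close>
  show ?case
  proof (cases "j = 1")
    case True
    then show ?thesis using sup_bound_root_edge by simp
  next
    case False
    note kj = parent[OF Suc.prems(1) False]
    have "(k ^^ n) (k j) = 1" using Suc.prems(2) by (simp add: funpow_swap1)
    with Suc.IH[of "k j"] kj obtain K0 where K0: "K0 \<ge> 1"
      and IH: "\<And>y dy P S. tree_fun y dy \<Longrightarrow> (\<forall>t\<in>{- \<tau>..0}. \<bar>y 1 t\<bar> \<le> P)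
      \<Longrightarrow> (\<forall>j\<in>{1..m}. lint 0 (T j) (\<lambda>t. \<bar>E y dy j t\<bar>) \<le> S)
      \<Longrightarrow> (\<forall>t\<in>{0..T (k j)}. \<bar>y (k j) t\<bar> \<le> K0 * (P + S))"
      by blast
    note j = Suc.prems(1)
    note Tj = T_pos[OF j]
    define K where "K = 2 * exp ((2 * (\<bar>b j\<bar> + \<bar>c j\<bar>) + 1) * T j) * (1 + \<bar>c j\<bar> * T j)"
    have K: "1 \<le> K" unfolding K_def by (rule edge_const_ge_1[OF Tj])
    show ?thesis
    proof (intro exI[of _ "K * (K0 + 1)"] conjI allI impI ballI)
      show "1 \<le> K * (K0 + 1)" using K K0 mult_mono[of 1 K 1 "K0 + 1"] by simp
      fix y dy P S t
      assume y: "tree_fun y dy" and P: "\<forall>t\<in>{- \<tau>..0}. \<bar>y 1 t\<bar> \<le> P"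
        and S: "\<forall>j\<in>{1..m}. lint 0 (T j) (\<lambda>t. \<bar>E y dy j t\<bar>) \<le> S" and t: "t \<in> {0..T j}"
      have P0: "0 \<le> P" using P tau by (force dest: bspec[of _ _ 0])
      have S0: "0 \<le> S" by (rule order_trans[OF lint_nonneg bspec[OF S j]]) simp
      note B = IH[OF y P S]
      have "\<bar>y j t\<bar> \<le> K * (K0 * (P + S) + S)"
        unfolding K_def
      proof (rule edge_sup_bound[OF tree_fun_wderiv0[OF y j] Tj is_wderiv_L2_fun[OF delay_wderiv[OF y j]]])
        show "\<bar>delay y j t\<bar> \<le> K0 * (P + S) \<or> (\<exists>s\<in>{0..t}. delay y j t = y j s)" if "t \<in> {0..T j}" for t
          using that tau B False tau_less[of "k j"] kj by (cases "t < \<tau>") (auto simp: ydel_def)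
        show "\<bar>y j 0\<bar> \<le> K0 * (P + S)"
          using B tree_fun_vertex[OF y, of j] j False T_pos[of "k j"] kj by auto
        show "lint 0 (T j) (\<lambda>t. \<bar>dy j t + b j * y j t + c j * delay y j t\<bar>) \<le> S"
          using S j by (auto simp: ell_def)
      qed (use t in auto)
      also have "\<dots> \<le> K * ((K0 + 1) * (P + S))"
        using K P0 S0 by (intro mult_left_mono) (auto simp: algebra_simps)
      finally show "\<bar>y j t\<bar> \<le> K * (K0 + 1) * (P + S)" by (simp add: mult.assoc)
    qed
  qed
qed

lemma sup_bound:
  "\<exists>K\<ge>1. \<forall>y dy P S. tree_fun y dy \<longrightarrow> (\<forall>t\<in>{- \<tau>..0}. \<bar>y 1 t\<bar> \<le> P)
    \<longrightarrow> (\<forall>j\<in>{1..m}. lint 0 (T j) (\<lambda>t. \<bar>E y dy j t\<bar>) \<le> S)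
    \<longrightarrow> (\<forall>j\<in>{1..m}. \<forall>t\<in>{0..T j}. \<bar>y j t\<bar> \<le> K * (P + S))"
proof -
  have "\<forall>j\<in>{1..m}. \<exists>K\<ge>1. \<forall>y dy P S. tree_fun y dy \<longrightarrow> (\<forall>t\<in>{- \<tau>..0}. \<bar>y 1 t\<bar> \<le> P)
    \<longrightarrow> (\<forall>j\<in>{1..m}. lint 0 (T j) (\<lambda>t. \<bar>E y dy j t\<bar>) \<le> S)
    \<longrightarrow> (\<forall>t\<in>{0..T j}. \<bar>y j t\<bar> \<le> K * (P + S))"
    using k_iter sup_bound_edge_ex by blast
  from bchoice[OF this] obtain K where K: "\<And>j. j \<in> {1..m} \<Longrightarrow> K j \<ge> 1"
    "\<And>j y dy P S t. j \<in> {1..m} \<Longrightarrow> tree_fun y dy \<Longrightarrow> (\<forall>t\<in>{- \<tau>..0}. \<bar>y 1 t\<bar> \<le> P)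
    \<Longrightarrow> (\<forall>j\<in>{1..m}. lint 0 (T j) (\<lambda>t. \<bar>E y dy j t\<bar>) \<le> S)
    \<Longrightarrow> t\<in>{0..T j} \<Longrightarrow> \<bar>y j t\<bar> \<le> K j * (P + S)"
    by blast
  \<comment> \<open>The sum is a common upper bound for the finitely many positive edge
    constants.\<close>
  define K' where "K' = (\<Sum>j = 1..m. K j)"
  have le: "K j \<le> K'" if "j \<in> {1..m}" for j
    unfolding K'_def using that K(1) by (intro member_le_sum) (auto intro: order_trans[of 0 1])
  have m1: "1 \<in> {1..m}" using m by simp
  show ?thesis
  proof (intro exI[of _ K'] conjI allI impI ballI)
    show "1 \<le> K'" using le[OF m1] K(1)[OF m1] by simp
    fix y dy P S j t
    assume y: "tree_fun y dy" and P: "\<forall>t\<in>{- \<tau>..0}. \<bar>y 1 t\<bar> \<le> P"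
      and S: "\<forall>j\<in>{1..m}. lint 0 (T j) (\<lambda>t. \<bar>E y dy j t\<bar>) \<le> S" and j: "j \<in> {1..m}" and t: "t \<in> {0..T j}"
    have "\<bar>y 1 0\<bar> \<le> P" using P tau by auto
    then have P0: "0 \<le> P" by linarith
    have S0: "0 \<le> S" by (rule order_trans[OF lint_nonneg bspec[OF S j]]) simp
    have "\<bar>y j t\<bar> \<le> K j * (P + S)" by (rule K(2)[OF j y P S t])
    also have "\<dots> \<le> K' * (P + S)" using le[OF j] P0 S0 by (intro mult_right_mono) auto
    finally show "\<bar>y j t\<bar> \<le> K' * (P + S)" .
  qed
qed

section \<open>Coercivity of the energy\<close>

lemma delay_square_le:
  assumes "\<And>i s. i \<in> {1..m} \<Longrightarrow> s \<in> {tleft \<tau> i..T i} \<Longrightarrow> (y i s)\<^sup>2 \<le> M"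
    and "j \<in> {1..m}" "t \<in> {0..T j}"
  shows "(delay y j t)\<^sup>2 \<le> M"
  using delay_value[OF assms(2,3)] assms(1) by metis

text \<open>\<open>E y dy\<close> and \<open>dy\<close> differ by terms of order zero, which
  \<open>M\<close> controls. The first estimate leads to coercivity of the energy, the second to its
  continuity; the factor 3 comes from squaring a sum of three terms.\<close>

lemma
  assumes y: "tree_fun y dy" and j: "j \<in> {1..m}"
    and M: "\<And>i s. i \<in> {1..m} \<Longrightarrow> s \<in> {tleft \<tau> i..T i} \<Longrightarrow> (y i s)\<^sup>2 \<le> M"
  shows lint_deriv_le: "lint 0 (T j) (\<lambda>t. (dy j t)\<^sup>2)
      \<le> 3 * lint 0 (T j) (\<lambda>t. (E y dy j t)\<^sup>2) + 3 * T j * ((b j)\<^sup>2 + (c j)\<^sup>2) * M" (is ?D)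
    and lint_E_le: "lint 0 (T j) (\<lambda>t. (E y dy j t)\<^sup>2)
      \<le> 3 * lint 0 (T j) (\<lambda>t. (dy j t)\<^sup>2) + 3 * T j * ((b j)\<^sup>2 + (c j)\<^sup>2) * M" (is ?E)
proof -
  have rest: "3 * (b j * y j t)\<^sup>2 + 3 * (c j * delay y j t)\<^sup>2 \<le> 3 * (((b j)\<^sup>2 + (c j)\<^sup>2) * M)" if "t \<in> {0..T j}" for t
  proof -
    have "(b j)\<^sup>2 * (y j t)\<^sup>2 \<le> (b j)\<^sup>2 * M"
      using that tleft_le[of j] by (intro mult_left_mono M[OF j]) auto
    moreover have "(c j)\<^sup>2 * (delay y j t)\<^sup>2 \<le> (c j)\<^sup>2 * M"
      by (intro mult_left_mono delay_square_le[OF M j that]) auto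
    ultimately show ?thesis by (simp add: power_mult_distrib algebra_simps)
  qed
  have i: "integrable (lebesgue_on {0..T j}) (\<lambda>t. (dy j t)\<^sup>2)"
    "integrable (lebesgue_on {0..T j}) (\<lambda>t. (E y dy j t)\<^sup>2)"
    using is_wderiv_L2[OF tree_fun_wderiv0[OF y j]] E_L2[OF y j] by (auto intro: L2_on_square)
  have "lint 0 (T j) (\<lambda>t. (dy j t)\<^sup>2) \<le> lint 0 (T j) (\<lambda>t. 3 * (E y dy j t)\<^sup>2 + 3 * (((b j)\<^sup>2 + (c j)\<^sup>2) * M))"
  proof (intro lint_mono)
    fix t assume t: "t \<in> {0..T j}"
    show "(dy j t)\<^sup>2 \<le> 3 * (E y dy j t)\<^sup>2 + 3 * (((b j)\<^sup>2 + (c j)\<^sup>2) * M)"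
      using square_sum3_le[of "E y dy j t" "- (b j * y j t)" "- (c j * delay y j t)"] rest[OF t]
      by (simp add: ell_def)
  qed (use i in auto)
  then show ?D using i T_pos[OF j] by (simp add: measure_Icc mult_ac)
  have "lint 0 (T j) (\<lambda>t. (E y dy j t)\<^sup>2) \<le> lint 0 (T j) (\<lambda>t. 3 * (dy j t)\<^sup>2 + 3 * (((b j)\<^sup>2 + (c j)\<^sup>2) * M))"
  proof (intro lint_mono)
    fix t assume t: "t \<in> {0..T j}"
    show "(E y dy j t)\<^sup>2 \<le> 3 * (dy j t)\<^sup>2 + 3 * (((b j)\<^sup>2 + (c j)\<^sup>2) * M)"
      using square_sum3_le[of "dy j t" "b j * y j t" "c j * delay y j t"] rest[OF t]
      by (simp add: ell_def)
  qed (use i in auto)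
  then show ?E using i T_pos[OF j] by (simp add: measure_Icc mult_ac)
qed

lemma energy_nonneg [simp]: "0 \<le> energy y dy"
  unfolding energy_def by (intro sum_nonneg) simp

lemma start_norm_nonneg [simp]: "0 \<le> start_norm y dy"
  unfolding start_norm_def by simp

lemma edge_energy_le: "j \<in> {1..m} \<Longrightarrow> lint 0 (T j) (\<lambda>t. (E y dy j t)\<^sup>2) \<le> energy y dy"
  unfolding energy_def by (rule member_le_sum) auto

text \<open>Turns the bounds in supremum and L1 norm into quadratic ones: the Sobolev inequality on
  \<open>[- \<tau>,0]\<close> handles the history, Cauchy-Schwarz the integrals of
  \<open>\<bar>E y dy\<bar>\<close>.\<close>

lemma energy_sup_bound:
  "\<exists>C>0. \<forall>y dy. tree_fun y dy \<longrightarrow>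
    (\<forall>j\<in>{1..m}. \<forall>t\<in>{tleft \<tau> j..T j}. (y j t)\<^sup>2 \<le> C * (start_norm y dy + energy y dy))"
proof -
  obtain K where K: "K \<ge> 1"
    and bd: "\<And>y dy P S. tree_fun y dy \<Longrightarrow> (\<forall>t\<in>{- \<tau>..0}. \<bar>y 1 t\<bar> \<le> P)
    \<Longrightarrow> (\<forall>j\<in>{1..m}. lint 0 (T j) (\<lambda>t. \<bar>E y dy j t\<bar>) \<le> S)
    \<Longrightarrow> (\<forall>j\<in>{1..m}. \<forall>t\<in>{0..T j}. \<bar>y j t\<bar> \<le> K * (P + S))"
    using sup_bound by blast
  \<comment> \<open>\<open>Cs\<close> is the Sobolev constant of the history interval,
    \<open>Ts\<close> the total length of the edges; the factor 2 in \<open>C\<close> and the square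
    of \<open>K\<close> arise from squaring \<open>K * (Pb + S)\<close>.\<close>
  define Cs where "Cs = 2 / \<tau> + 2 * \<tau>"
  define Ts where "Ts = (\<Sum>j = 1..m. T j)"
  define C where "C = 2 * K\<^sup>2 * (Cs + Ts)"
  have Cs: "0 < Cs" using tau by (simp add: Cs_def add_pos_pos)
  have Ts: "0 \<le> Ts" unfolding Ts_def by (intro sum_nonneg less_imp_le T_pos)
  have K2: "1 \<le> 2 * K\<^sup>2" using one_le_power[OF K, of 2] by linarith
  have "1 * Cs \<le> (2 * K\<^sup>2) * (Cs + Ts)"
    by (intro mult_mono K2) (use Cs Ts in auto)
  then have CsC: "Cs \<le> C" by (simp add: C_def)
  show ?thesis
  proof (intro exI[of _ C] conjI allI impI ballI)
    show "0 < C" using Cs CsC by simp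
    fix y dy j t
    assume y: "tree_fun y dy" and j: "j \<in> {1..m}" and t: "t \<in> {tleft \<tau> j..T j}"
    let ?p = "start_norm y dy" and ?e = "energy y dy"
    have P: "(y 1 s)\<^sup>2 \<le> Cs * ?p" if "s \<in> {- \<tau>..0}" for s
      using Sobolev_sup_bound[OF tree_fun_wderiv_start[OF y], of s] that tau
      by (simp add: Cs_def start_norm_def)
    define Pb S where "Pb = sqrt (Cs * ?p)" and "S = sqrt (Ts * ?e)"
    have p1: "\<forall>t\<in>{- \<tau>..0}. \<bar>y 1 t\<bar> \<le> Pb"
      using P by (auto simp: Pb_def real_le_rsqrt)
    have p2: "\<forall>j\<in>{1..m}. lint 0 (T j) (\<lambda>t. \<bar>E y dy j t\<bar>) \<le> S"
    proof
      fix j assume j: "j \<in> {1..m}"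
      have "(lint 0 (T j) (\<lambda>t. \<bar>E y dy j t\<bar>))\<^sup>2 \<le> (T j - 0) * lint 0 (T j) (\<lambda>t. (E y dy j t)\<^sup>2)"
        using T_pos[OF j] by (intro lint_abs_square_le E_L2[OF y j]) auto
      also have "\<dots> \<le> Ts * ?e"
      proof (intro mult_mono)
        show "T j - 0 \<le> Ts"
          using member_le_sum[of j "{1..m}" T] T_pos j by (auto simp: Ts_def less_imp_le)
      qed (use Ts edge_energy_le[OF j] in auto)
      finally show "lint 0 (T j) (\<lambda>t. \<bar>E y dy j t\<bar>) \<le> S"
        by (simp add: S_def real_le_rsqrt)
    qed
    show "(y j t)\<^sup>2 \<le> C * (?p + ?e)"
    proof (cases "t < 0")
      case True
      then have "j = 1" "t \<in> {- \<tau>..0}" using t by (auto simp: tleft_def split: if_splits)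
      then have "(y j t)\<^sup>2 \<le> Cs * ?p" using P by simp
      also have "\<dots> \<le> C * (?p + ?e)" using CsC Cs by (intro mult_mono) auto
      finally show ?thesis .
    next
      case False
      have "\<bar>y j t\<bar> \<le> K * (Pb + S)"
        using bd[OF y p1 p2] j t False by auto
      then have "(y j t)\<^sup>2 \<le> (K * (Pb + S))\<^sup>2"
        by (metis abs_ge_zero power2_abs power_mono)
      also have "\<dots> = K\<^sup>2 * (Pb + S)\<^sup>2" by (simp add: power_mult_distrib)
      also have "\<dots> \<le> K\<^sup>2 * (2 * ((Cs + Ts) * (?p + ?e)))"
      proof (rule mult_left_mono)
        have "(Pb + S)\<^sup>2 \<le> 2 * Pb\<^sup>2 + 2 * S\<^sup>2"
          using sum_squares_bound[of Pb S] by (simp add: power2_sum)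
        also have "\<dots> = 2 * (Cs * ?p + Ts * ?e)"
          using Cs Ts by (simp add: Pb_def S_def)
        also have "\<dots> \<le> 2 * ((Cs + Ts) * (?p + ?e))"
          using Cs Ts by (simp add: algebra_simps add_nonneg_nonneg)
        finally show "(Pb + S)\<^sup>2 \<le> 2 * ((Cs + Ts) * (?p + ?e))" .
      qed simp
      also have "\<dots> = C * (?p + ?e)" by (simp add: C_def)
      finally show ?thesis .
    qed
  qed
qed

lemma deriv_start:
  assumes y: "tree_fun y dy" and j: "j \<in> {1..m}"
  shows "lint (tleft \<tau> j) (T j) (\<lambda>t. (dy j t)\<^sup>2)
    \<le> start_norm y dy + lint 0 (T j) (\<lambda>t. (dy j t)\<^sup>2)"
proof -
  have "lint (tleft \<tau> j) (T j) (\<lambda>t. (dy j t)\<^sup>2)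
      = lint (tleft \<tau> j) 0 (\<lambda>t. (dy j t)\<^sup>2) + lint 0 (T j) (\<lambda>t. (dy j t)\<^sup>2)"
    using tleft_le[of j] T_pos[OF j] by (intro lint_combine L2_on_square is_wderiv_L2[OF tree_fun_wderiv[OF y j]]) auto
  also have "lint (tleft \<tau> j) 0 (\<lambda>t. (dy j t)\<^sup>2) \<le> start_norm y dy"
    by (cases "j = 1") (auto simp: tleft_def start_norm_def)
  finally show ?thesis by simp
qed

text \<open>Once the values are controlled, \<open>dy\<close> is recovered from
  \<open>E y dy\<close>. This coercivity makes minimizing sequences converge and yields the final
  bound.\<close>

lemma energy_estimate:
  obtains C where "0 < C"
    "\<And>y dy j t. tree_fun y dy \<Longrightarrow> j \<in> {1..m} \<Longrightarrow> t \<in> {tleft \<tau> j..T j}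
      \<Longrightarrow> (y j t)\<^sup>2 \<le> C * (start_norm y dy + energy y dy)"
    "\<And>y dy j. tree_fun y dy \<Longrightarrow> j \<in> {1..m}
      \<Longrightarrow> lint (tleft \<tau> j) (T j) (\<lambda>t. (dy j t)\<^sup>2) \<le> C * (start_norm y dy + energy y dy)"
proof -
  obtain C where C: "0 < C" and bd: "\<And>y dy j t. tree_fun y dy \<Longrightarrow> j \<in> {1..m} \<Longrightarrow> t \<in> {tleft \<tau> j..T j}
      \<Longrightarrow> (y j t)\<^sup>2 \<le> C * (start_norm y dy + energy y dy)"
    using energy_sup_bound by blast
  define B where "B = (\<Sum>j = 1..m. 3 * T j * ((b j)\<^sup>2 + (c j)\<^sup>2))"
  have nn: "0 \<le> 3 * T j * ((b j)\<^sup>2 + (c j)\<^sup>2)" if "j \<in> {1..m}" for j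
    using T_pos[OF that] by simp
  have B: "0 \<le> B" "\<And>j. j \<in> {1..m} \<Longrightarrow> 3 * T j * ((b j)\<^sup>2 + (c j)\<^sup>2) \<le> B"
    unfolding B_def using nn by (auto intro!: sum_nonneg member_le_sum[where f = "\<lambda>j. 3 * T j * ((b j)\<^sup>2 + (c j)\<^sup>2)"])
  show ?thesis
  \<comment> \<open>One constant covers both claims. \<open>C\<close> serves the values; for the
    derivative, 4 adds the weight 1 of the history to the 3 in front of the energy, and
    \<open>B * C\<close> carries the zero-order terms.\<close>
  proof (rule that[of "C + (4 + B * C)"])
    show "0 < C + (4 + B * C)" using C B by (intro add_pos_nonneg) auto
    fix y dy j assume y: "tree_fun y dy" and j: "j \<in> {1..m}"
    let ?p = "start_norm y dy" and ?e = "energy y dy"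
    have C': "C * (?p + ?e) \<le> (C + (4 + B * C)) * (?p + ?e)"
      using B C by (intro mult_right_mono) auto
    show "(y j t)\<^sup>2 \<le> (C + (4 + B * C)) * (?p + ?e)" if "t \<in> {tleft \<tau> j..T j}" for t
      using bd[OF y j that] C' by linarith
    have "lint (tleft \<tau> j) (T j) (\<lambda>t. (dy j t)\<^sup>2) \<le> ?p + lint 0 (T j) (\<lambda>t. (dy j t)\<^sup>2)"
      by (rule deriv_start[OF y j])
    also have "\<dots> \<le> ?p + (3 * lint 0 (T j) (\<lambda>t. (E y dy j t)\<^sup>2)
        + 3 * T j * ((b j)\<^sup>2 + (c j)\<^sup>2) * (C * (?p + ?e)))"
      by (intro add_left_mono lint_deriv_le[OF y j] bd[OF y])
    also have "\<dots> \<le> ?p + (3 * ?e + B * (C * (?p + ?e)))"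
      using C by (intro add_left_mono add_mono mult_left_mono mult_right_mono edge_energy_le[OF j] B(2)[OF j]) auto
    also have "\<dots> \<le> (4 + B * C) * (?p + ?e)"
      by (simp add: algebra_simps)
    also have "\<dots> \<le> (C + (4 + B * C)) * (?p + ?e)"
      using C by (intro mult_right_mono) auto
    finally show "lint (tleft \<tau> j) (T j) (\<lambda>t. (dy j t)\<^sup>2) \<le> (C + (4 + B * C)) * (?p + ?e)" .
  qed
qed

lemma null_start_start_norm:
  assumes "tree_fun y dy" "null_start y"
  shows "start_norm y dy = 0"
proof -
  have "is_wderiv (- \<tau>) 0 (y 1) (\<lambda>_. 0)"
    using is_wderiv_linear[of "- \<tau>" 0 0 0] assms(2)
    by (subst is_wderiv_cong_eq[of _ _ _ "\<lambda>_. 0" _ "\<lambda>_. 0"]) (auto simp: null_start_def)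
  then have "AE t in lebesgue_on {- \<tau>..0}. dy 1 t = 0"
    by (rule is_wderiv_AE_unique[OF tree_fun_wderiv_start[OF assms(1)]])
  then have "lint (- \<tau>) 0 (\<lambda>t. (dy 1 t)\<^sup>2) = 0"
    by (intro integral_eq_zero_AE) (auto elim!: eventually_mono)
  moreover have "lint (- \<tau>) 0 (\<lambda>t. (y 1 t)\<^sup>2) = lint (- \<tau>) 0 (\<lambda>t. 0)"
    using assms(2) by (intro lint_cong) (auto simp: null_start_def)
  ultimately show ?thesis by (simp add: start_norm_def)
qed

text \<open>Definiteness of the energy on functions with zero history, the source of uniqueness in
  both problems.\<close>

lemma null_energy_zero:
  assumes "tree_fun y dy" "null_start y" "energy y dy = 0" "j \<in> {1..m}" "t \<in> {tleft \<tau> j..T j}"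
  shows "y j t = 0"
proof -
  obtain C where "\<And>y dy j t. tree_fun y dy \<Longrightarrow> j \<in> {1..m} \<Longrightarrow> t \<in> {tleft \<tau> j..T j}
      \<Longrightarrow> (y j t)\<^sup>2 \<le> C * (start_norm y dy + energy y dy)"
    using energy_estimate by metis
  from this[OF assms(1,4,5)] show ?thesis
    using null_start_start_norm[OF assms(1,2)] assms(3) by simp
qed

section \<open>The variational problem\<close>

definition feasible :: "(real \<Rightarrow> real) \<Rightarrow> (nat \<Rightarrow> real \<Rightarrow> real) \<Rightarrow> (nat \<Rightarrow> real \<Rightarrow> real) \<Rightarrow> bool" where
  "feasible \<phi> y dy \<longleftrightarrow> tree_fun y dy \<and> (\<forall>t\<in>{- \<tau>..0}. y 1 t = \<phi> t)"

lemma feasibleD: "feasible \<phi> y dy \<Longrightarrow> tree_fun y dy" "feasible \<phi> y dy \<Longrightarrow> t \<in> {- \<tau>..0} \<Longrightarrow> y 1 t = \<phi> t"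
  by (auto simp: feasible_def)

lemma feasible_start: "feasible \<phi> y dy \<Longrightarrow> t \<in> {- \<tau>..0} \<Longrightarrow> y (Suc 0) t = \<phi> t"
  using feasibleD(2) by simp

lemma form_integrable:
  "tree_fun y dy \<Longrightarrow> tree_fun z dz \<Longrightarrow> j \<in> {1..m}
    \<Longrightarrow> integrable (lebesgue_on {0..T j}) (\<lambda>t. E y dy j t * E z dz j t)"
  by (intro L2_on_mult_integrable E_L2)

lemma energy_add_cmult:
  assumes y: "tree_fun y dy" and z: "tree_fun z dz"
  shows "energy (\<lambda>j t. y j t + r * z j t) (\<lambda>j t. dy j t + r * dz j t)
    = energy y dy + 2 * r * form y dy z dz + r\<^sup>2 * energy z dz"
proof -
  have "lint 0 (T j) (\<lambda>t. (E (\<lambda>j t. y j t + r * z j t) (\<lambda>j t. dy j t + r * dz j t) j t)\<^sup>2)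
    = lint 0 (T j) (\<lambda>t. (E y dy j t)\<^sup>2) + 2 * r * lint 0 (T j) (\<lambda>t. E y dy j t * E z dz j t)
      + r\<^sup>2 * lint 0 (T j) (\<lambda>t. (E z dz j t)\<^sup>2)" (is "?L = _") if j: "j \<in> {1..m}" for j
  proof -
    have "?L = lint 0 (T j) (\<lambda>t. (E y dy j t)\<^sup>2 + 2 * r * (E y dy j t * E z dz j t) + r\<^sup>2 * (E z dz j t)\<^sup>2)"
      by (intro lint_cong) (simp add: E_add E_cmult power2_sum power_mult_distrib mult_ac)
    then show ?thesis
      using L2_on_square[OF E_L2[OF y j]] L2_on_square[OF E_L2[OF z j]] form_integrable[OF y z j] by simp
  qed
  then show ?thesis
    by (simp add: energy_def form_def sum.distrib sum_distrib_left)
qed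

lemma energy_cmult: "energy (\<lambda>j t. r * y j t) (\<lambda>j t. r * dy j t) = r\<^sup>2 * energy y dy"
  by (simp add: energy_def E_cmult power_mult_distrib sum_distrib_left)

lemma energy_parallelogram:
  assumes y: "tree_fun y dy" and z: "tree_fun z dz"
  shows "energy (\<lambda>j t. y j t - z j t) (\<lambda>j t. dy j t - dz j t)
      + energy (\<lambda>j t. y j t + z j t) (\<lambda>j t. dy j t + dz j t) = 2 * energy y dy + 2 * energy z dz"
  using energy_add_cmult[OF assms, of 1] energy_add_cmult[OF assms, of "-1"] by simp

text \<open>Feasible functions form an affine set, so the midpoint of two of them has energy at
  least \<open>I\<close>, and the parallelogram identity makes the energy of the difference small.
  Differences have zero history, so by coercivity the sequence is uniformly Cauchy in
  \<open>y\<close> and mean-square Cauchy in \<open>dy\<close>.\<close>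

lemma minimizing_limit:
  assumes Z: "\<And>n. feasible \<phi> (Z n) (dZ n)"
    and min: "\<And>z dz. feasible \<phi> z dz \<Longrightarrow> I \<le> energy z dz"
    and le: "\<And>n. energy (Z n) (dZ n) \<le> I + e n" and e: "e \<longlonglongrightarrow> 0"
  obtains y dy where "feasible \<phi> y dy" "energy y dy \<le> I"
proof -
  note tZ = feasibleD(1)[OF Z]
  obtain C where C: "0 < C"
    and Cv: "\<And>y dy j t. tree_fun y dy \<Longrightarrow> j \<in> {1..m} \<Longrightarrow> t \<in> {tleft \<tau> j..T j}
      \<Longrightarrow> (y j t)\<^sup>2 \<le> C * (start_norm y dy + energy y dy)"
    and Cd: "\<And>y dy j. tree_fun y dy \<Longrightarrow> j \<in> {1..m}
      \<Longrightarrow> lint (tleft \<tau> j) (T j) (\<lambda>t. (dy j t)\<^sup>2) \<le> C * (start_norm y dy + energy y dy)"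
    using energy_estimate by metis
  define \<epsilon> where "\<epsilon> n = C * (2 * e n)" for n
  have \<epsilon>: "\<epsilon> \<longlonglongrightarrow> 0"
    using tendsto_mult_left[OF e, of "C * 2"] by (simp add: \<epsilon>_def[abs_def] mult.assoc)
  have en: "energy (\<lambda>j t. Z p j t - Z q j t) (\<lambda>j t. dZ p j t - dZ q j t) \<le> 2 * e p + 2 * e q" for p q
  proof -
    have s: "tree_fun (\<lambda>j t. Z p j t + Z q j t) (\<lambda>j t. dZ p j t + dZ q j t)"
      by (intro tree_fun_add tZ)
    have "feasible \<phi> (\<lambda>j t. 1/2 * (Z p j t + Z q j t)) (\<lambda>j t. 1/2 * (dZ p j t + dZ q j t))"
      unfolding feasible_def
    proof (intro conjI ballI)
      show "tree_fun (\<lambda>j t. 1/2 * (Z p j t + Z q j t)) (\<lambda>j t. 1/2 * (dZ p j t + dZ q j t))"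
        by (rule tree_fun_cmult[OF s])
    qed (simp add: feasible_start[OF Z])
    from min[OF this] have "4 * I \<le> energy (\<lambda>j t. Z p j t + Z q j t) (\<lambda>j t. dZ p j t + dZ q j t)"
      unfolding energy_cmult by (simp add: power2_eq_square)
    then show ?thesis using energy_parallelogram[OF tZ[of p] tZ[of q]] le[of p] le[of q] by simp
  qed
  have st: "start_norm (\<lambda>j t. Z p j t - Z q j t) (\<lambda>j t. dZ p j t - dZ q j t) = 0" for p q
    by (rule null_start_start_norm) (auto simp: null_start_def feasible_start[OF Z] intro: tree_fun_diff tZ)
  have bv: "(Z p j t - Z q j t)\<^sup>2 \<le> \<epsilon> p + \<epsilon> q" if "j \<in> {1..m}" "t \<in> {tleft \<tau> j..T j}" for p q j t
    using Cv[OF tree_fun_diff[OF tZ[of p] tZ[of q]] that] mult_left_mono[OF en[of p q], of C] C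
    by (simp add: st \<epsilon>_def algebra_simps)
  have bd: "lint (tleft \<tau> j) (T j) (\<lambda>t. (dZ p j t - dZ q j t)\<^sup>2) \<le> \<epsilon> p + \<epsilon> q" if "j \<in> {1..m}" for p q j
    using Cd[OF tree_fun_diff[OF tZ[of p] tZ[of q]] that] mult_left_mono[OF en[of p q], of C] C
    by (simp add: st \<epsilon>_def algebra_simps)
  \<comment> \<open>Coercivity controls the values at every point, so the limit is taken pointwise
    and the vertex, history and end conditions pass to it directly.\<close>
  define y where "y j t = lim (\<lambda>n. Z n j t)" for j t
  have lim: "(\<lambda>n. Z n j t) \<longlonglongrightarrow> y j t" if "j \<in> {1..m}" "t \<in> {tleft \<tau> j..T j}" for j t
    using Cauchy_of_square_bound[OF bv[OF that] \<epsilon>]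
    by (simp add: y_def Cauchy_convergent_iff convergent_LIMSEQ_iff)
  have "\<exists>g. L2_on (tleft \<tau> j) (T j) g \<and> (\<lambda>n. lint (tleft \<tau> j) (T j) (\<lambda>t. (dZ n j t - g t)\<^sup>2)) \<longlonglongrightarrow> 0"
    if j: "j \<in> {1..m}" for j
  proof -
    have tT: "tleft \<tau> j \<le> T j" using tleft_le[of j] T_pos[OF j] by simp
    have "\<exists>N. \<forall>p\<ge>N. \<forall>q\<ge>N. lint (tleft \<tau> j) (T j) (\<lambda>t. (dZ p j t - dZ q j t)\<^sup>2) < r" if r: "0 < r" for r
    proof -
      have "\<forall>\<^sub>F n in sequentially. \<epsilon> n < r / 2"
        using \<epsilon> r by (intro order_tendstoD) auto
      then obtain N where N: "\<And>n. n \<ge> N \<Longrightarrow> \<epsilon> n < r / 2" by (auto simp: eventually_sequentially)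
      show ?thesis
      proof (intro exI[of _ N] allI impI)
        fix p q assume "N \<le> p" "N \<le> q"
        then show "lint (tleft \<tau> j) (T j) (\<lambda>t. (dZ p j t - dZ q j t)\<^sup>2) < r"
          using bd[OF j, of p q] N[of p] N[of q] by linarith
      qed
    qed
    from L2_on_complete[OF is_wderiv_L2[OF tree_fun_wderiv[OF tZ j]] tT this] show ?thesis by blast
  qed
  then have "\<forall>j\<in>{1..m}. \<exists>g. L2_on (tleft \<tau> j) (T j) g
      \<and> (\<lambda>n. lint (tleft \<tau> j) (T j) (\<lambda>t. (dZ n j t - g t)\<^sup>2)) \<longlonglongrightarrow> 0" by blast
  from bchoice[OF this] obtain dy where dy: "\<And>j. j \<in> {1..m} \<Longrightarrow> L2_on (tleft \<tau> j) (T j) (dy j)"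
    "\<And>j. j \<in> {1..m} \<Longrightarrow> (\<lambda>n. lint (tleft \<tau> j) (T j) (\<lambda>t. (dZ n j t - dy j t)\<^sup>2)) \<longlonglongrightarrow> 0"
    by blast
  have fy: "feasible \<phi> y dy"
    unfolding feasible_def tree_fun_def
  proof (intro conjI ballI)
    show "is_wderiv (tleft \<tau> j) (T j) (y j) (dy j)" if j: "j \<in> {1..m}" for j
    proof (rule is_wderiv_limit[OF tree_fun_wderiv[OF tZ j] _ lim[OF j] dy(1)[OF j] dy(2)[OF j]])
      show "tleft \<tau> j \<le> T j" using tleft_le[of j] T_pos[OF j] by simp
    qed
    show "y j 0 = y (k j) (T (k j))" if "j \<in> {2..m}" for j
      using tree_fun_vertex[OF tZ that] by (simp add: y_def)
    show "y j t = 0" if "j \<in> {d+1..m}" "t \<in> {T j - \<tau>..T j}" for j t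
      using tree_fun_end[OF tZ _ _ that(2)] that(1) by (simp add: y_def)
    show "y 1 t = \<phi> t" if "t \<in> {- \<tau>..0}" for t
      using feasibleD(2)[OF Z that] by (simp add: y_def)
  qed
  note ty = feasibleD(1)[OF fy]
  define w dw where "w n j t = Z n j t - y j t" and "dw n j t = dZ n j t - dy j t" for n j t
  have tw: "tree_fun (w n) (dw n)" for n
    unfolding w_def dw_def by (rule tree_fun_diff[OF tZ ty])
  \<comment> \<open>Let \<open>q\<close> tend to infinity in \<open>bv\<close>.\<close>
  have wM: "(w n j t)\<^sup>2 \<le> \<epsilon> n" if j: "j \<in> {1..m}" "t \<in> {tleft \<tau> j..T j}" for n j t
  proof (rule LIMSEQ_le)
    show "(\<lambda>q. (Z n j t - Z q j t)\<^sup>2) \<longlonglongrightarrow> (w n j t)\<^sup>2"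
      unfolding w_def by (intro tendsto_intros lim[OF j])
    show "(\<lambda>q. \<epsilon> n + \<epsilon> q) \<longlonglongrightarrow> \<epsilon> n"
      using tendsto_add[OF tendsto_const \<epsilon>, of "\<epsilon> n"] by simp
    show "\<exists>N. \<forall>q\<ge>N. (Z n j t - Z q j t)\<^sup>2 \<le> \<epsilon> n + \<epsilon> q" using bv[OF j] by blast
  qed
  have "(\<lambda>n. energy (w n) (dw n)) \<longlonglongrightarrow> 0"
  proof (rule Lim_null_comparison)
    have "energy (w n) (dw n) \<le> (\<Sum>j = 1..m. 3 * lint (tleft \<tau> j) (T j) (\<lambda>t. (dw n j t)\<^sup>2)
        + 3 * T j * ((b j)\<^sup>2 + (c j)\<^sup>2) * \<epsilon> n)" for n
      unfolding energy_def
    proof (rule sum_mono)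
      fix j assume j: "j \<in> {1..m}"
      have "lint 0 (T j) (\<lambda>t. (dw n j t)\<^sup>2) \<le> lint (tleft \<tau> j) (T j) (\<lambda>t. (dw n j t)\<^sup>2)"
        using tleft_le[of j] by (intro lint_subset_mono L2_on_square is_wderiv_L2[OF tree_fun_wderiv[OF tw j]]) auto
      then show "lint 0 (T j) (\<lambda>t. (E (w n) (dw n) j t)\<^sup>2)
        \<le> 3 * lint (tleft \<tau> j) (T j) (\<lambda>t. (dw n j t)\<^sup>2) + 3 * T j * ((b j)\<^sup>2 + (c j)\<^sup>2) * \<epsilon> n"
        using lint_E_le[OF tw j wM, of n] by linarith
    qed
    then show "\<forall>\<^sub>F n in sequentially. norm (energy (w n) (dw n)) \<le>
       (\<Sum>j = 1..m. 3 * lint (tleft \<tau> j) (T j) (\<lambda>t. (dw n j t)\<^sup>2) + 3 * T j * ((b j)\<^sup>2 + (c j)\<^sup>2) * \<epsilon> n)"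
      by simp
    have "(\<lambda>n. \<Sum>j = 1..m. 3 * lint (tleft \<tau> j) (T j) (\<lambda>t. (dw n j t)\<^sup>2) + 3 * T j * ((b j)\<^sup>2 + (c j)\<^sup>2) * \<epsilon> n)
       \<longlonglongrightarrow> (\<Sum>j = 1..m. 3 * 0 + 3 * T j * ((b j)\<^sup>2 + (c j)\<^sup>2) * 0)"
      unfolding dw_def by (intro tendsto_intros dy \<epsilon>)
    then show "(\<lambda>n. \<Sum>j = 1..m. 3 * lint (tleft \<tau> j) (T j) (\<lambda>t. (dw n j t)\<^sup>2)
        + 3 * T j * ((b j)\<^sup>2 + (c j)\<^sup>2) * \<epsilon> n) \<longlonglongrightarrow> 0" by simp
  qed
  then have "(\<lambda>n. 2 * (I + e n) + 2 * energy (w n) (dw n) - I) \<longlonglongrightarrow> 2 * (I + 0) + 2 * 0 - I"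
    by (intro tendsto_intros e)
  \<comment> \<open>Lower semicontinuity by reflection: \<open>Z n + w n\<close> is
    \<open>2 * Z n - y\<close>, again feasible and so of energy at least \<open>I\<close>, while
    \<open>Z n - w n\<close> is \<open>y\<close>. The parallelogram identity for \<open>Z n\<close>
    and \<open>w n\<close> then bounds the energy of \<open>y\<close>.\<close>
  moreover have "energy y dy \<le> 2 * (I + e n) + 2 * energy (w n) (dw n) - I" for n
  proof -
    have "feasible \<phi> (\<lambda>j t. Z n j t + w n j t) (\<lambda>j t. dZ n j t + dw n j t)"
      unfolding feasible_def using tree_fun_add[OF tZ[of n] tw[of n]]
      by (auto simp: w_def feasible_start[OF Z] feasible_start[OF fy])
    from min[OF this] show ?thesis
      using energy_parallelogram[OF tZ[of n] tw[of n]] le[of n] by (simp add: w_def dw_def)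
  qed
  ultimately have "energy y dy \<le> 2 * (I + 0) + 2 * 0 - I"
    by (intro LIMSEQ_le_const) auto
  then show ?thesis using fy by (intro that) auto
qed

lemma minimizer_exists:
  assumes "feasible \<phi> y0 dy0"
  obtains y dy where "feasible \<phi> y dy" "\<And>z dz. feasible \<phi> z dz \<Longrightarrow> energy y dy \<le> energy z dz"
proof -
  define A where "A = {energy z dz | z dz. feasible \<phi> z dz}"
  have A: "A \<noteq> {}" "bdd_below A"
    using assms by (auto simp: A_def intro!: bdd_belowI[of _ 0])
  have min: "Inf A \<le> energy z dz" if "feasible \<phi> z dz" for z dz
    using that A by (intro cInf_lower) (auto simp: A_def)
  have "\<exists>z dz. feasible \<phi> z dz \<and> energy z dz \<le> Inf A + 1 / real (Suc n)" for n
  proof -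
    have "Inf A < Inf A + 1 / real (Suc n)" by simp
    then obtain a where "a \<in> A" "a < Inf A + 1 / real (Suc n)"
      using cInf_lessD[OF A(1)] by blast
    then show ?thesis by (force simp: A_def)
  qed
  then obtain Z dZ where Z: "\<And>n. feasible \<phi> (Z n) (dZ n)"
    "\<And>n. energy (Z n) (dZ n) \<le> Inf A + 1 / real (Suc n)" by metis
  have "(\<lambda>n. 1 / real (Suc n)) \<longlonglongrightarrow> 0"
    using LIMSEQ_inverse_real_of_nat by (simp add: inverse_eq_divide)
  from minimizing_limit[OF Z(1) min Z(2) this] obtain y dy
    where "feasible \<phi> y dy" "energy y dy \<le> Inf A" by blast
  with min show ?thesis by (intro that[of y dy]) (auto intro: order_trans)
qed

text \<open>First variation: the quadratic polynomial in \<open>r\<close> describing the energy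
  change along \<open>w\<close> is nonnegative, so its linear coefficient vanishes.\<close>

lemma minimizer_orthogonal:
  assumes y: "feasible \<phi> y dy" and min: "\<And>z dz. feasible \<phi> z dz \<Longrightarrow> energy y dy \<le> energy z dz"
    and w: "tree_fun w dw" "null_start w"
  shows "form y dy w dw = 0"
proof -
  define \<beta> \<gamma> where "\<beta> = form y dy w dw" and "\<gamma> = energy w dw"
  have \<gamma>: "0 \<le> \<gamma>" by (simp add: \<gamma>_def)
  have "0 \<le> 2 * r * \<beta> + r\<^sup>2 * \<gamma>" for r
  proof -
    have "feasible \<phi> (\<lambda>j t. y j t + r * w j t) (\<lambda>j t. dy j t + r * dw j t)"
      using tree_fun_add[OF feasibleD(1)[OF y] tree_fun_cmult[OF w(1), of r]] w(2) y
      by (auto simp: feasible_def null_start_def)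
    from min[OF this] show ?thesis
      using energy_add_cmult[OF feasibleD(1)[OF y] w(1), of r] by (simp add: \<beta>_def \<gamma>_def)
  qed
  note nn = this
  \<comment> \<open>Close to the minimum point of the polynomial; the summand 1 avoids a division by
    zero when \<open>w\<close> has no energy.\<close>
  define r where "r = - \<beta> / (\<gamma> + 1)"
  have r: "r * (\<gamma> + 1) = - \<beta>" using \<gamma> by (simp add: r_def)
  have "(2 * r * \<beta> + r\<^sup>2 * \<gamma>) * (\<gamma> + 1)\<^sup>2
      = 2 * (r * (\<gamma> + 1)) * \<beta> * (\<gamma> + 1) + (r * (\<gamma> + 1))\<^sup>2 * \<gamma>"
    by (simp add: power2_eq_square algebra_simps)
  also have "\<dots> = - (\<beta>\<^sup>2 * (\<gamma> + 2))"
    unfolding r by (simp add: power2_eq_square algebra_simps)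
  finally have "\<beta>\<^sup>2 * (\<gamma> + 2) \<le> 0"
    using mult_nonneg_nonneg[OF nn[of r], of "(\<gamma> + 1)\<^sup>2"] by simp
  then show ?thesis using \<gamma> by (simp add: \<beta>_def mult_le_0_iff)
qed

text \<open>Pythagoras: two feasible functions differ by a function with zero history, so the mixed
  term of the expansion vanishes.\<close>

lemma orthogonal_energy:
  assumes y: "feasible \<phi> y dy" and o: "\<And>w dw. tree_fun w dw \<Longrightarrow> null_start w \<Longrightarrow> form y dy w dw = 0"
    and z: "feasible \<phi> z dz"
  shows "energy z dz = energy y dy + energy (\<lambda>j t. z j t - y j t) (\<lambda>j t. dz j t - dy j t)"
proof -
  have w: "tree_fun (\<lambda>j t. z j t - y j t) (\<lambda>j t. dz j t - dy j t)"
    by (rule tree_fun_diff[OF feasibleD(1)[OF z] feasibleD(1)[OF y]])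
  have "null_start (\<lambda>j t. z j t - y j t)"
    by (simp add: null_start_def feasible_start[OF z] feasible_start[OF y])
  from o[OF w this] energy_add_cmult[OF feasibleD(1)[OF y] w, of 1] show ?thesis by simp
qed

lemma orthogonal_unique:
  assumes y: "feasible \<phi> y dy" "\<And>w dw. tree_fun w dw \<Longrightarrow> null_start w \<Longrightarrow> form y dy w dw = 0"
    and z: "feasible \<phi> z dz" "energy z dz \<le> energy y dy"
  shows "eq_on_tree m \<tau> T z y"
proof -
  let ?w = "\<lambda>j t. z j t - y j t" and ?dw = "\<lambda>j t. dz j t - dy j t"
  have 0: "energy ?w ?dw = 0"
    using orthogonal_energy[OF y z(1)] z(2) energy_nonneg[of ?w ?dw] by linarith
  have "z j t - y j t = 0" if "j \<in> {1..m}" "t \<in> {tleft \<tau> j..T j}" for j t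
    by (rule null_energy_zero[OF _ _ 0 that])
      (auto simp: null_start_def feasible_start[OF z(1)] feasible_start[OF y(1)] intro: tree_fun_diff feasibleD(1)[OF z(1)] feasibleD(1)[OF y(1)])
  then show ?thesis by (simp add: eq_on_tree_def)
qed

section \<open>The boundary value problem\<close>

text \<open>\<open>adj\<close> is \<open>ell_tilde\<close> with \<open>u\<close> in place of \<open>ell y\<close>, and \<open>src\<close> is the prescribed derivative
  of \<open>u\<close>: the equation \<open>L y = 0\<close> reads \<open>u' = src u\<close>.\<close>

definition adj :: "(nat \<Rightarrow> real \<Rightarrow> real) \<Rightarrow> nat \<Rightarrow> real \<Rightarrow> real" where
  "adj u j t = (if t < T j - \<tau> then c j * u j (t + \<tau>)
      else (\<Sum>\<nu>\<in>Vset m k j. c \<nu> * u \<nu> (t + \<tau> - T j)))"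

lemma ell_tilde_eq_adj: "ell_tilde m b c \<tau> k T y dy j t = adj (E y dy) j t"
  by (simp add: ell_tilde_def adj_def)

definition src :: "(nat \<Rightarrow> real \<Rightarrow> real) \<Rightarrow> nat \<Rightarrow> real \<Rightarrow> real" where
  "src u j t = b j * u j t + adj u j t"

abbreviation "L2_tree u \<equiv> \<forall>j\<in>{1..m}. L2_on 0 (T j) (u j)"

lemma Vset_iff: "j \<ge> 1 \<Longrightarrow> \<nu> \<in> Vset m k j \<longleftrightarrow> \<nu> \<in> {2..m} \<and> k \<nu> = j"
  using k1 by (cases "\<nu> = 1") (auto simp: Vset_def)

lemma finite_Vset [simp]: "finite (Vset m k j)"
  by (simp add: Vset_def)

text \<open>Every edge but the root edge starts at exactly one internal vertex. The upper limit
  \<open>n\<close> is kept free since the identity is applied with all edges for the delay and with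
  the internal vertices alone for the vertex terms.\<close>

lemma sum_children:
  assumes "d \<le> n"
  shows "(\<Sum>j = 1..n. \<Sum>\<nu>\<in>Vset m k j. f \<nu>) = (\<Sum>\<nu> = 2..m. f \<nu> :: real)"
proof -
  have "(\<Sum>j = 1..n. \<Sum>\<nu>\<in>Vset m k j. f \<nu>) = (\<Sum>j = 1..n. sum f {\<nu>. \<nu> \<in> {2..m} \<and> k \<nu> = j})"
    by (intro sum.cong refl) (auto simp: Vset_iff)
  also have "\<dots> = (\<Sum>\<nu> = 2..m. f \<nu>)"
    using assms k_range by (intro sum.group) force+
  finally show ?thesis .
qed

lemma sum_edges_split: "(\<Sum>j = 1..m. f j) = f 1 + (\<Sum>j = 2..m. f j :: real)"
  using m by (simp add: sum.atLeast_Suc_atMost numeral_2_eq_2)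

section \<open>The adjoint of the delay\<close>

lemma adj_left_L2:
  assumes "L2_tree u" "j \<in> {1..m}"
  shows "L2_on 0 (T j - \<tau>) (\<lambda>t. c j * u j (t + \<tau>))"
proof -
  have "L2_on \<tau> (T j) (u j)"
    by (rule L2_on_subset[OF bspec[OF assms]]) (use tau in auto)
  from L2_on_cmult[OF L2_on_shift[OF this, of \<tau>]] show ?thesis by simp
qed

lemma adj_right_L2:
  assumes "L2_tree u" "j \<in> {1..m}" "\<nu> \<in> {1..m}"
  shows "L2_on (T j - \<tau>) (T j) (\<lambda>t. c \<nu> * u \<nu> (t + \<tau> - T j))"
proof -
  have "L2_on 0 \<tau> (u \<nu>)"
    by (rule L2_on_subset[OF bspec[OF assms(1,3)]]) (use tau_less[OF assms(3)] in auto)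
  from L2_on_cmult[OF L2_on_shift[OF this, of "\<tau> - T j"]] show ?thesis
    by (simp add: add_diff_eq)
qed

lemma adj_L2:
  assumes "L2_tree u" "j \<in> {1..m}"
  shows "L2_on 0 (T j) (adj u j)"
  unfolding adj_def[abs_def]
proof (rule L2_on_piecewise[OF adj_left_L2[OF assms] L2_on_sum])
  show "L2_on (T j - \<tau>) (T j) (\<lambda>t. c \<nu> * u \<nu> (t + \<tau> - T j))" if "\<nu> \<in> Vset m k j" for \<nu>
    by (rule adj_right_L2[OF assms]) (use that in \<open>simp add: Vset_def\<close>)
qed (use tau_less[OF assms(2)] tau in auto)

lemma src_L2: "L2_tree u \<Longrightarrow> j \<in> {1..m} \<Longrightarrow> L2_on 0 (T j) (src u j)"
  unfolding src_def[abs_def] by (intro L2_on_add L2_on_cmult adj_L2) auto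

text \<open>\<open>adj\<close> reads \<open>u\<close> at translated arguments and on child edges;
  translations preserve null sets, and only finitely many exceptional sets occur. This is used when
  the representative of \<open>dy\<close>, and with it \<open>u\<close>, is changed.\<close>

lemma adj_cong_AE:
  assumes uv: "\<And>j. j \<in> {1..m} \<Longrightarrow> AE t in lebesgue_on {0..T j}. u j t = v j t" and j: "j \<in> {1..m}"
  shows "AE t in lebesgue_on {0..T j}. adj u j t = adj v j t"
proof (rule AE_Icc_combine[where s = "T j - \<tau>"])
  have "AE t in lebesgue_on {\<tau>..T j}. u j t = v j t"
    by (rule AE_Icc_subset[OF uv[OF j]]) (use tau in auto)
  from AE_shift_Icc[OF this, of \<tau>] have "AE t in lebesgue_on {0..T j - \<tau>}. u j (t + \<tau>) = v j (t + \<tau>)"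
    unfolding diff_self .
  with AE_Icc_neq[where a = 0 and b = "T j - \<tau>" and c = "T j - \<tau>"] AE_space[of "lebesgue_on {0..T j - \<tau>}"]
  show "AE t in lebesgue_on {0..T j - \<tau>}. adj u j t = adj v j t"
    by eventually_elim (simp add: adj_def)
  have "AE t in lebesgue_on {T j - \<tau>..T j}. u \<nu> (t + \<tau> - T j) = v \<nu> (t + \<tau> - T j)" if "\<nu> \<in> Vset m k j" for \<nu>
  proof -
    have \<nu>: "\<nu> \<in> {1..m}" using that by (simp add: Vset_def)
    have "AE t in lebesgue_on {0..\<tau>}. u \<nu> t = v \<nu> t"
      by (rule AE_Icc_subset[OF uv[OF \<nu>]]) (use tau_less[OF \<nu>] in auto)
    from AE_shift_Icc[OF this, of "\<tau> - T j"] show ?thesis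
      by (simp only: add_diff_eq add_0 diff_0 minus_diff_eq diff_diff_eq2 add_diff_cancel_left')
  qed
  then have "AE t in lebesgue_on {T j - \<tau>..T j}. \<forall>\<nu>\<in>Vset m k j. u \<nu> (t + \<tau> - T j) = v \<nu> (t + \<tau> - T j)"
    by (intro AE_finite_allI) auto
  with AE_space[of "lebesgue_on {T j - \<tau>..T j}"]
  show "AE t in lebesgue_on {T j - \<tau>..T j}. adj u j t = adj v j t"
    by eventually_elim (auto simp: adj_def intro!: sum.cong)
qed

text \<open>Within an edge, a shift by \<tau> moves the delay from \<open>w\<close> to
  \<open>u\<close>. The first stretch of length \<tau> of a child edge reads the last stretch of its
  parent, and summing over the children produces the second branch of \<open>adj\<close>. On the
  root edge that stretch reads the history, where \<open>w\<close> vanishes.\<close>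

lemma delay_transfer:
  assumes u: "L2_tree u" and w: "tree_fun w dw" "null_start w"
  shows "(\<Sum>j = 1..m. lint 0 (T j) (\<lambda>t. u j t * (c j * delay w j t)))
    = (\<Sum>j = 1..m. lint 0 (T j) (\<lambda>t. adj u j t * w j t))"
proof -
  \<comment> \<open>\<open>A j\<close> collects what edge \<open>j\<close> reads from its
    predecessor, \<open>B j\<close> what it reads from itself.\<close>
  define A where "A j = lint 0 \<tau> (\<lambda>t. u j t * (c j * delay w j t))" for j
  define B where "B j = lint 0 (T j - \<tau>) (\<lambda>t. c j * u j (t + \<tau>) * w j t)" for j
  note wL2 = is_wderiv_L2_fun[OF tree_fun_wderiv0[OF w(1)]]
  have ic: "integrable (lebesgue_on {0..T j}) (\<lambda>t. u j t * (c j * delay w j t))" if j: "j \<in> {1..m}" for j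
    by (intro L2_on_mult_integrable L2_on_cmult is_wderiv_L2_fun[OF delay_wderiv[OF w(1) j]] bspec[OF u j])
  have L: "lint 0 (T j) (\<lambda>t. u j t * (c j * delay w j t)) = A j + B j" if j: "j \<in> {1..m}" for j
  proof -
    have "lint 0 (T j) (\<lambda>t. u j t * (c j * delay w j t))
        = A j + lint \<tau> (T j) (\<lambda>t. u j t * (c j * delay w j t))"
      unfolding A_def using tau tau_less[OF j] by (intro lint_combine ic[OF j]) auto
    also have "lint \<tau> (T j) (\<lambda>t. u j t * (c j * delay w j t))
      = lint (\<tau> - \<tau>) (T j - \<tau>) (\<lambda>t. u j (t + \<tau>) * (c j * delay w j (t + \<tau>)))"
      using tau by (intro lint_shift[symmetric] borel_measurable_integrable integrable_subinterval[OF ic[OF j]]) auto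
    also have "\<dots> = B j"
      unfolding B_def by (simp, intro lint_cong) (auto simp: ydel_def)
    finally show ?thesis .
  qed
  have A1: "A 1 = 0"
  proof -
    have "A 1 = lint 0 \<tau> (\<lambda>t. 0)"
      unfolding A_def using w(2) by (intro lint_cong) (auto simp: ydel_def null_start_def)
    then show ?thesis by simp
  qed
  have A: "A \<nu> = lint (T j - \<tau>) (T j) (\<lambda>t. c \<nu> * u \<nu> (t + \<tau> - T j) * w j t)"
    if j: "j \<in> {1..m}" and \<nu>: "\<nu> \<in> Vset m k j" for j \<nu>
  proof -
    have \<nu>': "\<nu> \<in> {2..m}" "k \<nu> = j" "\<nu> \<in> {1..m}" using \<nu> j Vset_iff[of j \<nu>] by auto
    have "A \<nu> = lint (0 - (\<tau> - T j)) (\<tau> - (\<tau> - T j))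
        (\<lambda>t. u \<nu> (t + (\<tau> - T j)) * (c \<nu> * delay w \<nu> (t + (\<tau> - T j))))"
      unfolding A_def using tau_less[OF \<nu>'(3)]
      by (intro lint_shift[symmetric] borel_measurable_integrable integrable_subinterval[OF ic[OF \<nu>'(3)]]) auto
    also have "\<dots> = lint (T j - \<tau>) (T j) (\<lambda>t. c \<nu> * u \<nu> (t + \<tau> - T j) * w j t)"
    proof (simp, intro lint_cong)
      fix t assume t: "t \<in> {T j - \<tau>..T j}"
      \<comment> \<open>At \<open>t = T j\<close> the delay already switches to the child edge and
        reads \<open>w \<nu> 0\<close>; the vertex condition identifies this with
        \<open>w j (T j)\<close>.\<close>
      have "delay w \<nu> (t + (\<tau> - T j)) = w j t"
        using t \<nu>' tree_fun_vertex[OF w(1) \<nu>'(1)] by (cases "t = T j") (auto simp: ydel_def)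
      then show "u \<nu> (t + (\<tau> - T j)) * (c \<nu> * delay w \<nu> (t + (\<tau> - T j))) = c \<nu> * u \<nu> (t + \<tau> - T j) * w j t"
        by (simp add: add_diff_eq)
    qed
    finally show ?thesis .
  qed
  have R: "lint 0 (T j) (\<lambda>t. adj u j t * w j t) = B j + (\<Sum>\<nu>\<in>Vset m k j. A \<nu>)" if j: "j \<in> {1..m}" for j
  proof -
    have i: "integrable (lebesgue_on {0..T j}) (\<lambda>t. adj u j t * w j t)"
      by (intro L2_on_mult_integrable adj_L2[OF u j] wL2[OF j])
    have s: "0 \<le> T j - \<tau>" "T j - \<tau> \<le> T j" using tau tau_less[OF j] by auto
    have "lint 0 (T j) (\<lambda>t. adj u j t * w j t) = lint 0 (T j - \<tau>) (\<lambda>t. adj u j t * w j t)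
       + lint (T j - \<tau>) (T j) (\<lambda>t. adj u j t * w j t)"
      by (rule lint_combine[OF i s])
    also have "lint 0 (T j - \<tau>) (\<lambda>t. adj u j t * w j t) = B j"
      unfolding B_def
    proof (rule lint_cong_AE)
      show "AE t in lebesgue_on {0..T j - \<tau>}. adj u j t * w j t = c j * u j (t + \<tau>) * w j t"
        using AE_Icc_neq[where a = 0 and b = "T j - \<tau>" and c = "T j - \<tau>"] AE_space[of "lebesgue_on {0..T j - \<tau>}"]
        by eventually_elim (simp add: adj_def)
      show "(\<lambda>t. adj u j t * w j t) \<in> borel_measurable (lebesgue_on {0..T j - \<tau>})"
        using s by (intro borel_measurable_integrable integrable_subinterval[OF i]) auto
      show "(\<lambda>t. c j * u j (t + \<tau>) * w j t) \<in> borel_measurable (lebesgue_on {0..T j - \<tau>})"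
        using s by (intro borel_measurable_times[OF L2_on_measurable[OF adj_left_L2[OF u j]]]
          L2_on_measurable L2_on_subset[OF wL2[OF j]]) auto
    qed
    also have "lint (T j - \<tau>) (T j) (\<lambda>t. adj u j t * w j t)
        = lint (T j - \<tau>) (T j) (\<lambda>t. \<Sum>\<nu>\<in>Vset m k j. c \<nu> * u \<nu> (t + \<tau> - T j) * w j t)"
      by (intro lint_cong) (simp add: adj_def sum_distrib_right)
    also have "\<dots> = (\<Sum>\<nu>\<in>Vset m k j. lint (T j - \<tau>) (T j) (\<lambda>t. c \<nu> * u \<nu> (t + \<tau> - T j) * w j t))"
    proof (rule lint_sum)
      fix \<nu> assume "\<nu> \<in> Vset m k j"
      then have "\<nu> \<in> {1..m}" by (simp add: Vset_def)
      then show "integrable (lebesgue_on {T j - \<tau>..T j}) (\<lambda>t. c \<nu> * u \<nu> (t + \<tau> - T j) * w j t)"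
        using s by (intro L2_on_mult_integrable adj_right_L2[OF u j] L2_on_subset[OF wL2[OF j]]) auto
    qed
    also have "\<dots> = (\<Sum>\<nu>\<in>Vset m k j. A \<nu>)"
      by (intro sum.cong refl A[OF j, symmetric])
    finally show ?thesis .
  qed
  have "(\<Sum>j = 1..m. lint 0 (T j) (\<lambda>t. u j t * (c j * delay w j t))) = (\<Sum>j = 1..m. A j) + (\<Sum>j = 1..m. B j)"
    using L by (simp add: sum.distrib)
  also have "(\<Sum>j = 1..m. A j) = (\<Sum>j = 2..m. A j)"
    using A1 sum_edges_split[of A] by simp
  also have "\<dots> = (\<Sum>j = 1..m. \<Sum>\<nu>\<in>Vset m k j. A \<nu>)"
    using dm by (intro sum_children[symmetric]) auto
  finally show ?thesis using R by (simp add: sum.distrib)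
qed

text \<open>Frees the test function from the delay, the form in which the du Bois-Reymond lemma and
  integration by parts apply.\<close>

lemma weak_form:
  assumes u: "L2_tree u" and w: "tree_fun w dw" "null_start w"
  shows "(\<Sum>j = 1..m. lint 0 (T j) (\<lambda>t. u j t * E w dw j t))
    = (\<Sum>j = 1..m. lint 0 (T j) (\<lambda>t. u j t * dw j t + src u j t * w j t))"
proof -
  have 1: "integrable (lebesgue_on {0..T j}) (\<lambda>t. u j t * dw j t)"
    and 2: "integrable (lebesgue_on {0..T j}) (\<lambda>t. u j t * (b j * w j t))"
    and 3: "integrable (lebesgue_on {0..T j}) (\<lambda>t. u j t * (c j * delay w j t))"
    and 4: "integrable (lebesgue_on {0..T j}) (\<lambda>t. adj u j t * w j t)" if j: "j \<in> {1..m}" for j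
    by (intro L2_on_mult_integrable L2_on_cmult is_wderiv_L2_fun[OF delay_wderiv[OF w(1) j]] bspec[OF u j]
      is_wderiv_L2_fun[OF tree_fun_wderiv0[OF w(1) j]] is_wderiv_L2[OF tree_fun_wderiv0[OF w(1) j]]
      adj_L2[OF u j])+
  have "(\<Sum>j = 1..m. lint 0 (T j) (\<lambda>t. u j t * E w dw j t))
    = (\<Sum>j = 1..m. lint 0 (T j) (\<lambda>t. u j t * dw j t) + lint 0 (T j) (\<lambda>t. u j t * (b j * w j t)))
      + (\<Sum>j = 1..m. lint 0 (T j) (\<lambda>t. u j t * (c j * delay w j t)))"
    unfolding sum.distrib[symmetric]
  proof (intro sum.cong refl)
    fix j assume j: "j \<in> {1..m}"
    have "lint 0 (T j) (\<lambda>t. u j t * E w dw j t)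
       = lint 0 (T j) (\<lambda>t. u j t * dw j t + u j t * (b j * w j t) + u j t * (c j * delay w j t))"
      by (intro lint_cong) (simp add: ell_def algebra_simps)
    also have "\<dots> = lint 0 (T j) (\<lambda>t. u j t * dw j t) + lint 0 (T j) (\<lambda>t. u j t * (b j * w j t))
       + lint 0 (T j) (\<lambda>t. u j t * (c j * delay w j t))"
      using 1[OF j] 2[OF j] 3[OF j]
      by (simp only: Bochner_Integration.integral_add Bochner_Integration.integrable_add)
    finally show "lint 0 (T j) (\<lambda>t. u j t * E w dw j t) = lint 0 (T j) (\<lambda>t. u j t * dw j t)
       + lint 0 (T j) (\<lambda>t. u j t * (b j * w j t)) + lint 0 (T j) (\<lambda>t. u j t * (c j * delay w j t))" .
  qed
  also have "\<dots> = (\<Sum>j = 1..m. lint 0 (T j) (\<lambda>t. u j t * dw j t) + lint 0 (T j) (\<lambda>t. u j t * (b j * w j t))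
      + lint 0 (T j) (\<lambda>t. adj u j t * w j t))"
    unfolding delay_transfer[OF u w] sum.distrib ..
  also have "\<dots> = (\<Sum>j = 1..m. lint 0 (T j) (\<lambda>t. u j t * dw j t + src u j t * w j t))"
  proof (intro sum.cong refl)
    fix j assume j: "j \<in> {1..m}"
    have "lint 0 (T j) (\<lambda>t. u j t * dw j t + src u j t * w j t)
       = lint 0 (T j) (\<lambda>t. u j t * dw j t + u j t * (b j * w j t) + adj u j t * w j t)"
      by (intro lint_cong) (simp add: src_def algebra_simps)
    also have "\<dots> = lint 0 (T j) (\<lambda>t. u j t * dw j t) + lint 0 (T j) (\<lambda>t. u j t * (b j * w j t))
      + lint 0 (T j) (\<lambda>t. adj u j t * w j t)"
      using 1[OF j] 2[OF j] 4[OF j]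
      by (simp only: Bochner_Integration.integral_add Bochner_Integration.integrable_add)
    finally show "lint 0 (T j) (\<lambda>t. u j t * dw j t) + lint 0 (T j) (\<lambda>t. u j t * (b j * w j t))
      + lint 0 (T j) (\<lambda>t. adj u j t * w j t) = lint 0 (T j) (\<lambda>t. u j t * dw j t + src u j t * w j t)" ..
  qed
  finally show ?thesis .
qed

section \<open>Green's formula on the tree\<close>

abbreviation "len \<equiv> lvec d \<tau> T"

lemma len_pos: "j \<in> {1..m} \<Longrightarrow> 0 < len j" and len_le: "len j \<le> T j"
  using T_pos tau_less tau by (auto simp: lvec_def)

text \<open>On a leaf edge the equation is known only up to \<open>len j\<close>, but
  \<open>w\<close> vanishes beyond and its derivative does so almost everywhere; integrating by
  parts over \<open>[0, len j]\<close> loses nothing and leaves no end term. The initial terms of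
  the child edges are regrouped at the end of the parent edge by the vertex condition for
  \<open>w\<close>.\<close>

lemma Green_formula:
  assumes u: "L2_tree u" and w: "tree_fun w dw" "null_start w"
    and du: "\<And>j. j \<in> {1..m} \<Longrightarrow> is_wderiv 0 (len j) (u j) (src u j)"
  shows "(\<Sum>j = 1..m. lint 0 (T j) (\<lambda>t. u j t * dw j t + src u j t * w j t))
    = (\<Sum>j = 1..d. w j (T j) * (u j (T j) - (\<Sum>\<nu>\<in>Vset m k j. u \<nu> 0)))"
proof -
  have e: "lint 0 (T j) (\<lambda>t. u j t * dw j t + src u j t * w j t)
      = (if j \<le> d then u j (T j) * w j (T j) else 0) - u j 0 * w j 0" if j: "j \<in> {1..m}" for j
  proof -
    have i: "integrable (lebesgue_on {0..T j}) (\<lambda>t. u j t * dw j t + src u j t * w j t)"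
      by (intro Bochner_Integration.integrable_add L2_on_mult_integrable bspec[OF u j] src_L2[OF u j]
        is_wderiv_L2_fun[OF tree_fun_wderiv0[OF w(1) j]] is_wderiv_L2[OF tree_fun_wderiv0[OF w(1) j]])
    have "lint 0 (T j) (\<lambda>t. u j t * dw j t + src u j t * w j t)
       = lint 0 (len j) (\<lambda>t. u j t * dw j t + src u j t * w j t)
         + lint (len j) (T j) (\<lambda>t. u j t * dw j t + src u j t * w j t)"
      using len_pos[OF j] len_le[of j] by (intro lint_combine[OF i]) auto
    also have "lint (len j) (T j) (\<lambda>t. u j t * dw j t + src u j t * w j t) = 0"
    proof (cases "j \<le> d")
      case True
      then show ?thesis by (simp add: lvec_def)
    next
      case False
      have z: "w j t = 0" if "t \<in> {len j..T j}" for t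
        using tree_fun_end[OF w(1) j, of t] that False by (simp add: lvec_def)
      have "AE t in lebesgue_on {len j..T j}. dw j t = 0"
        using len_pos[OF j]
        by (intro AE_zero_tail[OF is_wderiv_subset[OF tree_fun_wderiv0[OF w(1) j]] z]) auto
      with AE_space[of "lebesgue_on {len j..T j}"]
      have "AE t in lebesgue_on {len j..T j}. u j t * dw j t + src u j t * w j t = 0"
        by eventually_elim (use z in auto)
      then show ?thesis by (rule integral_eq_zero_AE)
    qed
    also have "lint 0 (len j) (\<lambda>t. u j t * dw j t + src u j t * w j t)
        = lint 0 (len j) (\<lambda>t. src u j t * w j t + u j t * dw j t)"
      by (intro lint_cong) simp
    also have "\<dots> = u j (len j) * w j (len j) - u j 0 * w j 0"
      using len_pos[OF j] len_le[of j]
      by (intro is_wderiv_parts[OF du[OF j] is_wderiv_subset[OF tree_fun_wderiv0[OF w(1) j]]]) auto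
    also have "u j (len j) * w j (len j) = (if j \<le> d then u j (T j) * w j (T j) else 0)"
      using tree_fun_end[OF w(1) j, of "len j"] tau by (auto simp: lvec_def)
    finally show ?thesis by simp
  qed
  have "(\<Sum>j = 1..m. lint 0 (T j) (\<lambda>t. u j t * dw j t + src u j t * w j t))
    = (\<Sum>j = 1..m. if j \<le> d then u j (T j) * w j (T j) else 0) - (\<Sum>j = 1..m. u j 0 * w j 0)"
    using e by (simp add: sum_subtractf)
  also have "(\<Sum>j = 1..m. if j \<le> d then u j (T j) * w j (T j) else 0) = (\<Sum>j = 1..d. u j (T j) * w j (T j))"
    using dm by (intro sum.mono_neutral_cong_right) auto
  also have "(\<Sum>j = 1..m. u j 0 * w j 0) = (\<Sum>\<nu> = 2..m. u \<nu> 0 * w (k \<nu>) (T (k \<nu>)))"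
    using w(2) tau tree_fun_vertex[OF w(1)] sum_edges_split[of "\<lambda>j. u j 0 * w j 0"]
    by (simp add: null_start_def)
  also have "\<dots> = (\<Sum>j = 1..d. \<Sum>\<nu>\<in>Vset m k j. u \<nu> 0 * w (k \<nu>) (T (k \<nu>)))"
    by (rule sum_children[symmetric]) simp
  also have "\<dots> = (\<Sum>j = 1..d. w j (T j) * (\<Sum>\<nu>\<in>Vset m k j. u \<nu> 0))"
    by (intro sum.cong refl) (auto simp: Vset_def sum_distrib_left mult.commute intro!: sum.cong)
  finally show ?thesis
    by (simp add: sum_subtractf right_diff_distrib mult.commute)
qed

section \<open>From orthogonality to the equations on the edges\<close>

definition orthogonal where
  "orthogonal y dy \<longleftrightarrow> (\<forall>w dw. tree_fun w dw \<longrightarrow> null_start w \<longrightarrow> form y dy w dw = 0)"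

lemma orthogonalD: "orthogonal y dy \<Longrightarrow> tree_fun w dw \<Longrightarrow> null_start w \<Longrightarrow> form y dy w dw = 0"
  by (simp add: orthogonal_def)

lemma form_eq:
  assumes "tree_fun y dy" "tree_fun w dw" "null_start w"
  shows "form y dy w dw
    = (\<Sum>j = 1..m. lint 0 (T j) (\<lambda>t. E y dy j t * dw j t + src (E y dy) j t * w j t))"
  unfolding form_def by (intro weak_form ballI E_L2 assms)

text \<open>A function on \<open>[0, len j]\<close> that is zero at both ends extends by zero to the
  whole tree without violating the vertex and end conditions, so orthogonality reduces to the
  hypothesis of the du Bois-Reymond lemma on this one edge.\<close>

lemma orthogonal_edge_ode:
  assumes y: "tree_fun y dy" and o: "orthogonal y dy" and j: "j \<in> {1..m}"
  obtains \<kappa> where "AE t in lebesgue_on {0..len j}. E y dy j t = \<kappa> + lint 0 t (src (E y dy) j)"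
proof -
  have u: "L2_tree (E y dy)" using E_L2[OF y] by blast
  show ?thesis
  proof (rule du_Bois_Reymond[OF len_pos[OF j] _ _ _ that])
    show "L2_on 0 (len j) (E y dy j)" "L2_on 0 (len j) (src (E y dy) j)"
      by (rule L2_on_subset[OF bspec[OF u j] order_refl len_le] L2_on_subset[OF src_L2[OF u j] order_refl len_le])+
    fix F v assume F: "is_wderiv 0 (len j) F v" "F 0 = 0" "F (len j) = 0"
    define w where "w i t = (if i = j \<and> 0 \<le> t \<and> t \<le> len j then F t else 0)" for i t
    define dw where "dw i t = (if i = j \<and> 0 \<le> t \<and> t \<le> len j then v t else 0)" for i t
    have w: "tree_fun w dw"
      unfolding tree_fun_def
    proof (intro conjI ballI)
      fix i assume "i \<in> {1..m}"
      show "is_wderiv (tleft \<tau> i) (T i) (w i) (dw i)"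
      proof (cases "i = j")
        case True
        have "is_wderiv (tleft \<tau> i) (T i) (\<lambda>t. if 0 \<le> t \<and> t \<le> len j then F t else 0)
           (\<lambda>t. if 0 \<le> t \<and> t \<le> len j then v t else 0)"
          using len_pos[OF j] len_le[of j] tleft_le[of i] True by (intro is_wderiv_zero_extend F) auto
        then show ?thesis using True by (simp add: w_def[abs_def] dw_def[abs_def])
      next
        case False
        then show ?thesis by (simp add: w_def[abs_def] dw_def[abs_def] is_wderiv_zero)
      qed
    next
      fix i assume i: "i \<in> {2..m}"
      have "w i 0 = 0" using F by (simp add: w_def)
      moreover have "w (k i) (T (k i)) = 0"
        using F k_range i by (auto simp: w_def lvec_def)
      ultimately show "w i 0 = w (k i) (T (k i))" by simp
    next
      fix i t assume i: "i \<in> {d+1..m}" "t \<in> {T i - \<tau>..T i}"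
      show "w i t = 0"
      proof (cases "i = j \<and> t \<le> len j")
        case True
        then have "t = len j" using i by (auto simp: lvec_def)
        then show ?thesis using F by (simp add: w_def)
      qed (auto simp: w_def)
    qed
    have ns: "null_start w"
      using F by (auto simp: null_start_def w_def)
    have "0 = (\<Sum>i = 1..m. lint 0 (T i) (\<lambda>t. E y dy i t * dw i t + src (E y dy) i t * w i t))"
      using form_eq[OF y w ns] orthogonalD[OF o w ns] by simp
    also have "\<dots> = (\<Sum>i = 1..m. if i = j then lint 0 (T j) (\<lambda>t. E y dy j t * dw j t + src (E y dy) j t * w j t) else 0)"
      by (intro sum.cong refl) (auto simp: w_def dw_def)
    also have "\<dots> = lint 0 (T j) (\<lambda>t. E y dy j t * dw j t + src (E y dy) j t * w j t)"
      using j by simp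
    also have "\<dots> = lint 0 (T j) (\<lambda>t. if t \<in> {0..len j} then E y dy j t * v t + src (E y dy) j t * F t else 0)"
      by (intro lint_cong) (simp add: w_def dw_def)
    also have "\<dots> = lint 0 (len j) (\<lambda>t. E y dy j t * v t + src (E y dy) j t * F t)"
      using len_le[of j] by (intro Lebesgue_Measure.integral_restrict) auto
    finally show "lint 0 (len j) (\<lambda>t. E y dy j t * v t + src (E y dy) j t * F t) = 0" ..
  qed
qed

text \<open>The vertex conditions evaluate \<open>dy\<close> at the ends of the edges, so
  \<open>E y dy\<close> has to equal its continuous representative at every point of
  \<open>[0, len j]\<close>, not just almost everywhere.\<close>

lemma orthogonal_regular:
  assumes y: "tree_fun y dy" and o: "orthogonal y dy"
  obtains dy' where "tree_fun y dy'" "orthogonal y dy'"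
    "\<And>j. j \<in> {1..m} \<Longrightarrow> is_wderiv 0 (len j) (E y dy' j) (src (E y dy') j)"
proof -
  have u: "L2_tree (E y dy)" using E_L2[OF y] by blast
  have "\<forall>j\<in>{1..m}. \<exists>\<kappa>. AE t in lebesgue_on {0..len j}. E y dy j t = \<kappa> + lint 0 t (src (E y dy) j)"
    using orthogonal_edge_ode[OF y o] by blast
  from bchoice[OF this] obtain \<kappa> where \<kappa>:
    "\<And>j. j \<in> {1..m} \<Longrightarrow> AE t in lebesgue_on {0..len j}. E y dy j t = \<kappa> j + lint 0 t (src (E y dy) j)"
    by blast
  \<comment> \<open>Solve the definition of \<open>E\<close> for the derivative, with the continuous
    representative on the left; on the history and beyond \<open>len j\<close> the old derivative is
    kept.\<close>
  define dy' where "dy' j t = (if 0 \<le> t \<and> t \<le> len j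
      then \<kappa> j + lint 0 t (src (E y dy) j) - b j * y j t - c j * delay y j t else dy j t)" for j t
  have E': "E y dy' j t = \<kappa> j + lint 0 t (src (E y dy) j)" if "t \<in> {0..len j}" for j t
    using that by (simp add: ell_def dy'_def)
  have ae: "AE t in lebesgue_on {tleft \<tau> j..T j}. dy j t = dy' j t" if j: "j \<in> {1..m}" for j
  proof -
    have "AE t in lebesgue. t \<in> {tleft \<tau> j..T j} \<longrightarrow> dy j t = dy' j t"
      using \<kappa>[OF j] by (auto simp: AE_restrict_space_iff ell_def dy'_def elim!: eventually_mono)
    then show ?thesis by (simp add: AE_restrict_space_iff)
  qed
  have y': "tree_fun y dy'"
    unfolding tree_fun_def
  proof (intro conjI ballI)
    show "is_wderiv (tleft \<tau> j) (T j) (y j) (dy' j)" if "j \<in> {1..m}" for j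
      by (rule is_wderiv_cong[OF tree_fun_wderiv[OF y that] refl ae[OF that]])
  qed (use y in \<open>auto simp: tree_fun_def\<close>)
  have aeE: "AE t in lebesgue_on {0..T j}. E y dy j t = E y dy' j t" if j: "j \<in> {1..m}" for j
    using AE_Icc_subset[OF ae[OF j] tleft_le order_refl] by eventually_elim (simp add: ell_def)
  \<comment> \<open>The source term was formed with the old derivative; it changes on a null set
    only, so the equation also holds with the new one.\<close>
  have aeS: "AE t in lebesgue_on {0..T j}. src (E y dy) j t = src (E y dy') j t" if j: "j \<in> {1..m}" for j
  proof -
    have "AE t in lebesgue_on {0..T j}. adj (E y dy) j t = adj (E y dy') j t"
      by (rule adj_cong_AE[OF aeE j])
    with aeE[OF j] show ?thesis by eventually_elim (simp add: src_def)
  qed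
  show ?thesis
  proof (rule that[OF y'])
    show "orthogonal y dy'"
      unfolding orthogonal_def
    proof (intro allI impI)
      fix w dw assume w: "tree_fun w dw" "null_start w"
      have "form y dy' w dw = form y dy w dw"
        unfolding form_def
      proof (intro sum.cong refl lint_cong_AE)
        fix j assume j: "j \<in> {1..m}"
        show "AE t in lebesgue_on {0..T j}. E y dy' j t * E w dw j t = E y dy j t * E w dw j t"
          using aeE[OF j] by eventually_elim simp
      qed (use form_integrable[OF y' w(1)] form_integrable[OF y w(1)] in blast)+
      then show "form y dy' w dw = 0" using orthogonalD[OF o w] by simp
    qed
    fix j assume j: "j \<in> {1..m}"
    have "is_wderiv 0 (len j) (E y dy' j) (src (E y dy) j)"
      using len_le[of j] E'
      by (intro is_wderiv_integral[where C = "\<kappa> j"] L2_on_subset[OF src_L2[OF u j]]) auto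
    then show "is_wderiv 0 (len j) (E y dy' j) (src (E y dy') j)"
      by (rule is_wderiv_cong[OF _ refl AE_Icc_subset[OF aeS[OF j] order_refl len_le]])
  qed
qed

text \<open>A fixed point of \<open>k\<close> is stationary under iteration, hence equal to 1,
  contrary to \<open>k 1 = 0\<close>. This keeps the two branches of the hat function apart.\<close>

lemma parent_neq: "j \<in> {1..m} \<Longrightarrow> k j \<noteq> j"
proof
  assume j: "j \<in> {1..m}" and kj: "k j = j"
  have "(k ^^ n) j = j" for n by (induction n) (auto simp: kj)
  with k_iter j have "j = 1" by metis
  then show False using kj k1 by simp
qed

section \<open>Hat functions and the vertex conditions\<close>

definition ramp :: "real \<Rightarrow> real \<Rightarrow> real" where
  "ramp a t = (if t \<le> a then 1 - t / a else 0)"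

definition dramp :: "real \<Rightarrow> real \<Rightarrow> real" where
  "dramp a t = (if t \<le> a then - 1 / a else 0)"

lemma ramp_wderiv:
  assumes "0 < a" "a \<le> L"
  shows "is_wderiv 0 L (ramp a) (dramp a)"
proof -
  have "is_wderiv 0 a (\<lambda>t. 1 - t / a) (\<lambda>_. - 1 / a)"
    using is_wderiv_linear[of 0 a 1 "- 1 / a"] by (subst is_wderiv_cong_eq) auto
  then show ?thesis
    unfolding ramp_def[abs_def] dramp_def[abs_def]
    by (rule is_wderiv_zero_extend_right) (use assms in auto)
qed

lemma ramp_simps: "0 < a \<Longrightarrow> ramp a 0 = 1" "0 < a \<Longrightarrow> a \<le> t \<Longrightarrow> ramp a t = 0"
  by (auto simp: ramp_def)

text \<open>The hat rises along edge \<open>i\<close> and falls along every child edge. The fall is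
  complete at \<open>T j - \<tau>\<close>, so the end condition holds on leaves and the other
  internal vertices see zero.\<close>

lemma vertex_hat:
  assumes i: "i \<in> {1..d}"
  obtains w dw where "tree_fun w dw" "null_start w" "w i (T i) = 1"
    "\<And>j. j \<in> {1..d} \<Longrightarrow> j \<noteq> i \<Longrightarrow> w j (T j) = 0"
proof -
  define a where "a j = T j - \<tau>" for j
  have im: "i \<in> {1..m}" using i dm by auto
  have a: "0 < a j" "a j \<le> T j" if "j \<in> {1..m}" for j using tau_less[OF that] tau by (auto simp: a_def)
  define w where "w j t = (if j = i then if 0 \<le> t then t / T i else 0
      else if k j = i then ramp (a j) t else 0)" for j t
  define dw where "dw j t = (if j = i then if 0 \<le> t then 1 / T i else 0
      else if k j = i then dramp (a j) t else 0)" for j t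
  have w: "tree_fun w dw"
    unfolding tree_fun_def
  proof (intro conjI ballI)
    fix j assume j: "j \<in> {1..m}"
    show "is_wderiv (tleft \<tau> j) (T j) (w j) (dw j)"
    proof (cases "j = i")
      case True
      have "is_wderiv 0 (T i) (\<lambda>t. t / T i) (\<lambda>t. 1 / T i)"
        using is_wderiv_linear[of 0 "T i" 0 "1 / T i"] by simp
      then show ?thesis
        using True is_wderiv_zero_extend_left[of 0 "T i" "\<lambda>t. t / T i" "\<lambda>t. 1 / T i"] tleft_le[of i] T_pos[OF im]
        by (simp add: w_def[abs_def] dw_def[abs_def])
    next
      case ni: False
      show ?thesis
      proof (cases "k j = i")
        case True
        then have "j \<noteq> 1" using k1 i by auto
        then have "tleft \<tau> j = 0" by (simp add: tleft_def)
        then show ?thesis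
          using True ni ramp_wderiv[OF a[OF j]] by (simp add: w_def[abs_def] dw_def[abs_def])
      next
        case False
        then show ?thesis using ni by (simp add: w_def[abs_def] dw_def[abs_def] is_wderiv_zero)
      qed
    qed
  next
    fix j assume j2: "j \<in> {2..m}"
    then have j: "j \<in> {1..m}" by auto
    have kj: "k j \<in> {1..m}" using parent[OF j] j2 by auto
    have "w (k j) (T (k j)) = (if k j = i then 1 else 0)"
      using T_pos[OF im] a[OF kj] by (auto simp: w_def ramp_simps)
    moreover have "w j 0 = (if k j = i then 1 else 0)"
      using parent_neq[OF j] a[OF j] by (auto simp: w_def ramp_simps)
    ultimately show "w j 0 = w (k j) (T (k j))" by simp
  next
    fix j t assume j: "j \<in> {d+1..m}" and t: "t \<in> {T j - \<tau>..T j}"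
    then show "w j t = 0" using i a[of j] by (auto simp: w_def a_def ramp_simps)
  qed
  moreover have "null_start w"
    using k1 i by (auto simp: null_start_def w_def)
  moreover have "w i (T i) = 1" using T_pos[OF im] by (simp add: w_def)
  moreover have "w j (T j) = 0" if "j \<in> {1..d}" "j \<noteq> i" for j
    using that a[of j] dm by (auto simp: w_def ramp_simps)
  ultimately show ?thesis by (rule that)
qed

text \<open>Given the edge equations, Green's formula leaves only vertex terms, and a hat singles
  out one of them.\<close>

lemma orthogonal_junction:
  assumes y: "tree_fun y dy" and o: "orthogonal y dy"
    and du: "\<And>j. j \<in> {1..m} \<Longrightarrow> is_wderiv 0 (len j) (E y dy j) (src (E y dy) j)"
    and i: "i \<in> {1..d}"
  shows "E y dy i (T i) - (\<Sum>\<nu>\<in>Vset m k i. E y dy \<nu> 0) = 0"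
proof -
  let ?r = "\<lambda>j. E y dy j (T j) - (\<Sum>\<nu>\<in>Vset m k j. E y dy \<nu> 0)"
  obtain w dw where w: "tree_fun w dw" "null_start w" and wi: "w i (T i) = 1"
    "\<And>j. j \<in> {1..d} \<Longrightarrow> j \<noteq> i \<Longrightarrow> w j (T j) = 0"
    using vertex_hat[OF i] by blast
  have u: "L2_tree (E y dy)" using E_L2[OF y] by blast
  have "0 = (\<Sum>j = 1..d. w j (T j) * ?r j)"
    using form_eq[OF y w] orthogonalD[OF o w] Green_formula[OF u w du] by simp
  also have "\<dots> = (\<Sum>j = 1..d. if j = i then ?r i else 0)"
    using wi by (intro sum.cong refl) auto
  also have "\<dots> = ?r i" using i by simp
  finally show ?thesis ..
qed

lemma orthogonal_of_ode:
  assumes y: "tree_fun y dy"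
    and du: "\<And>j. j \<in> {1..m} \<Longrightarrow> is_wderiv 0 (len j) (E y dy j) (src (E y dy) j)"
    and jn: "\<And>j. j \<in> {1..d} \<Longrightarrow> E y dy j (T j) - (\<Sum>\<nu>\<in>Vset m k j. E y dy \<nu> 0) = 0"
  shows "orthogonal y dy"
  unfolding orthogonal_def
proof (intro allI impI)
  fix w dw assume w: "tree_fun w dw" "null_start w"
  have u: "L2_tree (E y dy)" using E_L2[OF y] by blast
  have "form y dy w dw
      = (\<Sum>j = 1..d. w j (T j) * (E y dy j (T j) - (\<Sum>\<nu>\<in>Vset m k j. E y dy \<nu> 0)))"
    unfolding form_eq[OF y w] by (rule Green_formula[OF u w du])
  also have "\<dots> = 0" using jn by (intro sum.neutral) auto
  finally show "form y dy w dw = 0" .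
qed

text \<open>The vertex condition is a balance of the fluxes \<open>E y dy\<close> in disguise: at
  time 0 a child edge has the same value and the same delayed value as its parent at the vertex, so
  the terms with \<open>b\<close> and with \<open>c\<close> combine into the bracketed
  coefficients.\<close>

lemma junction_eq:
  assumes v: "\<And>j. j \<in> {2..m} \<Longrightarrow> y j 0 = y (k j) (T (k j))" and j: "j \<in> {1..d}"
  shows "dy j (T j) - (\<Sum>\<nu>\<in>Vset m k j. dy \<nu> 0)
      + (b j - (\<Sum>\<nu>\<in>Vset m k j. b \<nu>)) * y j (T j)
      + (c j - (\<Sum>\<nu>\<in>Vset m k j. c \<nu>)) * y j (T j - \<tau>)
    = E y dy j (T j) - (\<Sum>\<nu>\<in>Vset m k j. E y dy \<nu> 0)"
proof -
  have jm: "j \<in> {1..m}" using j dm by auto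
  have "E y dy \<nu> 0 = dy \<nu> 0 + b \<nu> * y j (T j) + c \<nu> * y j (T j - \<tau>)" if "\<nu> \<in> Vset m k j" for \<nu>
  proof -
    have "\<nu> \<in> {2..m}" "k \<nu> = j" using Vset_iff[of j \<nu>] that j by auto
    then show ?thesis using v[of \<nu>] tau by (simp add: ell_def ydel_def)
  qed
  then have "(\<Sum>\<nu>\<in>Vset m k j. E y dy \<nu> 0) = (\<Sum>\<nu>\<in>Vset m k j. dy \<nu> 0)
      + (\<Sum>\<nu>\<in>Vset m k j. b \<nu>) * y j (T j) + (\<Sum>\<nu>\<in>Vset m k j. c \<nu>) * y j (T j - \<tau>)"
    by (simp add: sum.distrib sum_distrib_right)
  moreover have "E y dy j (T j) = dy j (T j) + b j * y j (T j) + c j * y j (T j - \<tau>)"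
    using tau_less[OF jm] by (simp add: ell_def ydel_def)
  ultimately show ?thesis by (simp add: algebra_simps)
qed

section \<open>Solvability\<close>

lemma admissible_iff: "admissible m d k T \<tau> \<phi> y \<longleftrightarrow> (\<exists>dy. feasible \<phi> y dy)"
proof
  assume a: "admissible m d k T \<tau> \<phi> y"
  have "\<forall>j\<in>{1..m}. \<exists>g. is_wderiv (tleft \<tau> j) (T j) (y j) g"
  proof
    fix j assume "j \<in> {1..m}"
    then show "\<exists>g. is_wderiv (tleft \<tau> j) (T j) (y j) g"
      using a by (cases "j = 1") (auto simp: admissible_def tleft_def W21_iff)
  qed
  from bchoice[OF this] obtain dy where "\<forall>j\<in>{1..m}. is_wderiv (tleft \<tau> j) (T j) (y j) (dy j)"
    by blast
  then have "feasible \<phi> y dy"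
    using a by (auto simp: feasible_def tree_fun_def admissible_def)
  then show "\<exists>dy. feasible \<phi> y dy" by blast
next
  assume "\<exists>dy. feasible \<phi> y dy"
  then obtain dy where f: "feasible \<phi> y dy" by blast
  note t = feasibleD(1)[OF f]
  have "W21 (- \<tau>) (T 1) (y 1)"
    using tree_fun_wderiv[OF t, of 1] m by (auto simp: W21_iff tleft_def)
  moreover have "W21 0 (T j) (y j)" if "j \<in> {2..m}" for j
    using tree_fun_wderiv0[OF t, of j] that by (auto simp: W21_iff)
  ultimately show "admissible m d k T \<tau> \<phi> y"
    using f by (simp add: admissible_def feasible_def tree_fun_def)
qed

text \<open>\<open>Jfun\<close> is built from derivatives picked by choice on
  \<open>[0, T i]\<close>; they agree almost everywhere with the carried ones.\<close>

lemma Jfun_eq_energy: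
  assumes y: "tree_fun y dy"
  shows "Jfun m b c \<tau> k T y = energy y dy"
  unfolding Jfun_def energy_def
proof (intro sum.cong refl)
  fix j assume j: "j \<in> {1..m}"
  let ?dy = "\<lambda>i. wderiv 0 (T i) (y i)"
  have w: "is_wderiv 0 (T j) (y j) (?dy j)"
    using tree_fun_wderiv0[OF y j] by (intro is_wderiv_wderiv) (auto simp: W21_iff)
  have ae: "AE t in lebesgue_on {0..T j}. E y dy j t = E y ?dy j t"
    using is_wderiv_AE_unique[OF tree_fun_wderiv0[OF y j] w] by eventually_elim (simp add: ell_def)
  have "AE t in lebesgue_on {0..T j}. (E y ?dy j t)\<^sup>2 = (E y dy j t)\<^sup>2"
    using ae by eventually_elim simp
  then show "lint 0 (T j) (\<lambda>t. (E y ?dy j t)\<^sup>2) = lint 0 (T j) (\<lambda>t. (E y dy j t)\<^sup>2)"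
    by (rule lint_cong_AE)
      (intro borel_measurable_integrable L2_on_square E_L2[OF y j] L2_on_cong_AE[OF E_L2[OF y j] ae])+
qed

lemma feasible_start_norm:
  assumes "feasible \<phi> y dy"
  shows "start_norm y dy = (W21_norm (- \<tau>) 0 \<phi>)\<^sup>2"
proof -
  have "is_wderiv (- \<tau>) 0 \<phi> (dy 1)"
    using tree_fun_wderiv_start[OF feasibleD(1)[OF assms]] feasibleD(2)[OF assms]
    by (subst is_wderiv_cong_eq[where f' = "y 1" and g' = "dy 1"]) auto
  from W21_norm_square[OF this] show ?thesis
    using lint_cong[of "- \<tau>" 0 "\<lambda>t. (y 1 t)\<^sup>2" "\<lambda>t. (\<phi> t)\<^sup>2"] feasibleD(2)[OF assms]
    by (simp add: start_norm_def)
qed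

lemma tree_norm_bound:
  obtains C where "0 < C"
    "\<And>y dy. tree_fun y dy \<Longrightarrow> (tree_norm m \<tau> T y)\<^sup>2 \<le> C * (start_norm y dy + energy y dy)"
proof -
  obtain C where C: "0 < C"
    and Cv: "\<And>y dy j t. tree_fun y dy \<Longrightarrow> j \<in> {1..m} \<Longrightarrow> t \<in> {tleft \<tau> j..T j}
      \<Longrightarrow> (y j t)\<^sup>2 \<le> C * (start_norm y dy + energy y dy)"
    and Cd: "\<And>y dy j. tree_fun y dy \<Longrightarrow> j \<in> {1..m}
      \<Longrightarrow> lint (tleft \<tau> j) (T j) (\<lambda>t. (dy j t)\<^sup>2) \<le> C * (start_norm y dy + energy y dy)"
    using energy_estimate by metis
  \<comment> \<open>Integrating the bound on the values gives the length of the edge as a factor;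
    the summand 1 accounts for the derivative.\<close>
  define B where "B = (\<Sum>j = 1..m. (T j - tleft \<tau> j + 1) * C)"
  have pos: "0 < T j - tleft \<tau> j + 1" if "j \<in> {1..m}" for j
    using T_pos[OF that] tleft_le[of j] by simp
  show ?thesis
  proof (rule that[of B])
    show "0 < B" unfolding B_def using pos C m by (intro sum_pos mult_pos_pos) auto
    fix y dy assume y: "tree_fun y dy"
    let ?s = "start_norm y dy + energy y dy"
    have "(tree_norm m \<tau> T y)\<^sup>2 = (\<Sum>j = 1..m. (W21_norm (tleft \<tau> j) (T j) (y j))\<^sup>2)"
      unfolding tree_norm_def by (simp add: sum_nonneg)
    also have "\<dots> \<le> (\<Sum>j = 1..m. (T j - tleft \<tau> j + 1) * C * ?s)"
    proof (rule sum_mono)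
      fix j assume j: "j \<in> {1..m}"
      note d = tree_fun_wderiv[OF y j]
      have "lint (tleft \<tau> j) (T j) (\<lambda>t. (y j t)\<^sup>2) \<le> lint (tleft \<tau> j) (T j) (\<lambda>t. C * ?s)"
        by (intro lint_mono L2_on_square is_wderiv_L2_fun[OF d] integrable_const_Icc Cv[OF y j])
      also have "\<dots> = (T j - tleft \<tau> j) * (C * ?s)"
        using T_pos[OF j] tleft_le[of j] by (intro lint_const) simp
      finally have "(W21_norm (tleft \<tau> j) (T j) (y j))\<^sup>2 \<le> (T j - tleft \<tau> j) * (C * ?s) + C * ?s"
        unfolding W21_norm_square[OF d] by (intro add_mono Cd[OF y j])
      also have "\<dots> = (T j - tleft \<tau> j + 1) * C * ?s" by (simp only: distrib_right mult_1 mult.assoc)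
      finally show "(W21_norm (tleft \<tau> j) (T j) (y j))\<^sup>2 \<le> (T j - tleft \<tau> j + 1) * C * ?s" .
    qed
    also have "\<dots> = B * ?s" by (simp only: B_def sum_distrib_right)
    finally show "(tree_norm m \<tau> T y)\<^sup>2 \<le> B * ?s" .
  qed
qed

text \<open>Supplies both a starting point for minimization and a competitor whose energy is
  controlled by \<phi>: the value \<open>\<phi> 0\<close> is brought down to zero by a ramp on the
  root edge, and all other edges carry zero.\<close>

lemma feasible_extension:
  obtains C where "0 \<le> C"
    "\<And>\<phi>. W21 (- \<tau>) 0 \<phi> \<Longrightarrow> \<exists>y dy. feasible \<phi> y dy \<and> energy y dy \<le> C * (W21_norm (- \<tau>) 0 \<phi>)\<^sup>2"
proof -
  define Cs where "Cs = 2 / \<tau> + 2 * \<tau>"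
  \<comment> \<open>Reaching zero at \<open>T 1 - \<tau>\<close> also meets the end condition when
    the root edge is itself a leaf, that is for \<open>d = 0\<close>.\<close>
  define a where "a = T 1 - \<tau>"
  \<comment> \<open>The first summand comes from the ramp of slope \<open>- 1 / a\<close> over an
    edge of length \<open>T 1\<close>, the second is the zero-order part of
    \<open>lint_E_le\<close>.\<close>
  define B where "B = (\<Sum>j = 1..m. 3 * (T 1 / a\<^sup>2) + 3 * T j * ((b j)\<^sup>2 + (c j)\<^sup>2))"
  have m1: "1 \<in> {1..m}" using m by simp
  have a: "0 < a" "a \<le> T 1" using tau_less[OF m1] tau by (auto simp: a_def)
  have Cs: "0 < Cs" using tau by (simp add: Cs_def add_pos_pos)
  have B: "0 \<le> B"
    unfolding B_def
    by (intro sum_nonneg add_nonneg_nonneg mult_nonneg_nonneg divide_nonneg_nonneg less_imp_le[OF T_pos] m1) auto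
  show ?thesis
  proof (rule that[of "B * Cs"])
    show "0 \<le> B * Cs" using B Cs by simp
    fix \<phi> assume "W21 (- \<tau>) 0 \<phi>"
    then obtain g where g: "is_wderiv (- \<tau>) 0 \<phi> g" by (auto simp: W21_iff)
    define N where "N = (W21_norm (- \<tau>) 0 \<phi>)\<^sup>2"
    have \<phi>: "(\<phi> s)\<^sup>2 \<le> Cs * N" if "s \<in> {- \<tau>..0}" for s
      using Sobolev_sup_bound[OF g, of s] that tau
      by (simp add: Cs_def N_def W21_norm_square[OF g])
    define y where "y j t = (if j = (1::nat) then if t < 0 then \<phi> t else \<phi> 0 * ramp a t else 0)" for j t
    define dy where "dy j t = (if j = (1::nat) then if t < 0 then g t else \<phi> 0 * dramp a t else 0)" for j t
    have "is_wderiv (- \<tau>) (T 1) (\<lambda>t. if t < 0 then \<phi> t else \<phi> 0 * ramp a t)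
       (\<lambda>t. if t < 0 then g t else \<phi> 0 * dramp a t)"
      by (rule is_wderiv_piecewise[OF g is_wderiv_cmult[OF ramp_wderiv[OF a]]])
        (use tau T_pos[OF m1] a in \<open>auto simp: ramp_simps\<close>)
    then have d: "is_wderiv (tleft \<tau> j) (T j) (y j) (dy j)" if "j \<in> {1..m}" for j
      by (cases "j = 1") (auto simp: y_def[abs_def] dy_def[abs_def] tleft_def is_wderiv_zero)
    have y: "tree_fun y dy"
      unfolding tree_fun_def
    proof (intro conjI ballI)
      show "is_wderiv (tleft \<tau> j) (T j) (y j) (dy j)" if "j \<in> {1..m}" for j by (rule d[OF that])
      show "y j 0 = y (k j) (T (k j))" if "j \<in> {2..m}" for j
        using that a T_pos[OF m1] by (auto simp: y_def ramp_simps)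
      show "y j t = 0" if "j \<in> {d+1..m}" "t \<in> {T j - \<tau>..T j}" for j t
        using that a by (auto simp: y_def ramp_simps a_def)
    qed
    have M: "(y i s)\<^sup>2 \<le> Cs * N" if "i \<in> {1..m}" "s \<in> {tleft \<tau> i..T i}" for i s
    proof (cases "i = 1 \<and> 0 \<le> s")
      case True
      then have "0 \<le> ramp a s" "ramp a s \<le> 1" using a by (auto simp: ramp_def field_simps)
      then have "(ramp a s)\<^sup>2 \<le> 1" by (simp add: power_le_one)
      then have "(\<phi> 0)\<^sup>2 * (ramp a s)\<^sup>2 \<le> (\<phi> 0)\<^sup>2 * 1" by (intro mult_left_mono) auto
      also have "\<dots> \<le> Cs * N" using \<phi>[of 0] tau by simp
      finally show ?thesis using True by (simp add: y_def power_mult_distrib)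
    next
      case False
      then show ?thesis
        using \<phi>[of s] that Cs by (cases "i = 1") (auto simp: y_def tleft_def N_def)
    qed
    have dyb: "lint 0 (T j) (\<lambda>t. (dy j t)\<^sup>2) \<le> T 1 / a\<^sup>2 * (Cs * N)" if j: "j \<in> {1..m}" for j
    proof (cases "j = 1")
      case True
      have "lint 0 (T 1) (\<lambda>t. (dy 1 t)\<^sup>2) \<le> lint 0 (T 1) (\<lambda>_. (1 / a)\<^sup>2 * (Cs * N))"
      proof (intro lint_mono L2_on_square is_wderiv_L2[OF tree_fun_wderiv0[OF y m1]] integrable_const_Icc)
        fix t assume t: "t \<in> {0..T 1}"
        have "(dramp a t)\<^sup>2 \<le> (1 / a)\<^sup>2" by (simp add: dramp_def)
        then have "(\<phi> 0)\<^sup>2 * (dramp a t)\<^sup>2 \<le> (Cs * N) * (1 / a)\<^sup>2"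
          using \<phi>[of 0] tau Cs by (intro mult_mono) (auto simp: N_def)
        then show "(dy 1 t)\<^sup>2 \<le> (1 / a)\<^sup>2 * (Cs * N)"
          using t by (simp add: dy_def power_mult_distrib mult.commute)
      qed
      also have "\<dots> = (T 1 - 0) * ((1 / a)\<^sup>2 * (Cs * N))"
        using T_pos[OF m1] by (intro lint_const) simp
      finally show ?thesis using True by (simp add: power_divide)
    next
      case False
      then show ?thesis
        using T_pos[OF m1] Cs by (simp add: dy_def N_def)
    qed
    have "energy y dy \<le> (\<Sum>j = 1..m. (3 * (T 1 / a\<^sup>2) + 3 * T j * ((b j)\<^sup>2 + (c j)\<^sup>2)) * (Cs * N))"
      unfolding energy_def
    proof (rule sum_mono)
      fix j assume j: "j \<in> {1..m}"
      have "lint 0 (T j) (\<lambda>t. (E y dy j t)\<^sup>2)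
          \<le> 3 * lint 0 (T j) (\<lambda>t. (dy j t)\<^sup>2) + 3 * T j * ((b j)\<^sup>2 + (c j)\<^sup>2) * (Cs * N)"
        by (rule lint_E_le[OF y j M])
      also have "\<dots> \<le> 3 * (T 1 / a\<^sup>2 * (Cs * N)) + 3 * T j * ((b j)\<^sup>2 + (c j)\<^sup>2) * (Cs * N)"
        using dyb[OF j] by simp
      also have "\<dots> = (3 * (T 1 / a\<^sup>2) + 3 * T j * ((b j)\<^sup>2 + (c j)\<^sup>2)) * (Cs * N)"
        by (simp only: distrib_right mult.assoc)
      finally show "lint 0 (T j) (\<lambda>t. (E y dy j t)\<^sup>2)
        \<le> (3 * (T 1 / a\<^sup>2) + 3 * T j * ((b j)\<^sup>2 + (c j)\<^sup>2)) * (Cs * N)" .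
    qed
    also have "\<dots> = B * Cs * N" by (simp only: B_def sum_distrib_right mult.assoc)
    finally have "energy y dy \<le> B * Cs * N" .
    moreover have "feasible \<phi> y dy"
      using y a by (auto simp: feasible_def y_def ramp_simps)
    ultimately show "\<exists>y dy. feasible \<phi> y dy \<and> energy y dy \<le> B * Cs * (W21_norm (- \<tau>) 0 \<phi>)\<^sup>2"
      unfolding N_def by blast
  qed
qed

lemma orthogonal_imp_BVP_sol:
  assumes f: "feasible \<phi> y dy0" and o: "orthogonal y dy0"
  shows "BVP_sol m d k T \<tau> b c \<phi> y"
proof -
  obtain dy where y: "tree_fun y dy" "orthogonal y dy"
    and du: "\<And>j. j \<in> {1..m} \<Longrightarrow> is_wderiv 0 (len j) (E y dy j) (src (E y dy) j)"
    using orthogonal_regular[OF feasibleD(1)[OF f] o] by blast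
  have dyl: "is_wderiv 0 (len j) (y j) (dy j)" if j: "j \<in> {1..m}" for j
    using is_wderiv_subset[OF tree_fun_wderiv0[OF y(1) j] order_refl len_le] .
  have W: "W21 0 (len j) (dy j)" if j: "j \<in> {1..m}" for j
  proof -
    \<comment> \<open>Solving the definition of \<open>E\<close> for \<open>dy\<close> expresses it
      through functions that have weak derivatives; this is the second-order regularity.\<close>
    have "is_wderiv 0 (len j) (\<lambda>t. E y dy j t - b j * y j t - c j * delay y j t)
        (\<lambda>t. src (E y dy) j t - b j * dy j t - c j * delay dy j t)"
      by (intro is_wderiv_diff is_wderiv_cmult du[OF j] dyl[OF j]
          is_wderiv_subset[OF delay_wderiv[OF y(1) j] order_refl len_le])
    moreover have "(\<lambda>t. E y dy j t - b j * y j t - c j * delay y j t) = dy j"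
      by (auto simp: ell_def)
    ultimately show ?thesis by (auto simp: W21_iff)
  qed
  show ?thesis
    unfolding BVP_sol_def
  proof (intro conjI exI[of _ dy] ballI)
    show "admissible m d k T \<tau> \<phi> y" using f admissible_iff by blast
    fix j assume j: "j \<in> {1..m}"
    show "W22 0 (len j) (y j)"
      unfolding W22_def using dyl[OF j] W[OF j] W21_iff by blast
    show "is_wderiv 0 (T j) (y j) (dy j)" by (rule tree_fun_wderiv0[OF y(1) j])
    show "W21 0 (len j) (dy j)" by (rule W[OF j])
    show "\<exists>h. is_wderiv 0 (len j) (E y dy j) h \<and> (AE t in lebesgue_on {0<..<len j}.
           - h t + b j * E y dy j t + ell_tilde m b c \<tau> k T y dy j t = 0)"
      by (intro exI[of _ "src (E y dy) j"] conjI du[OF j]) (simp add: src_def ell_tilde_eq_adj)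
  next
    fix j assume j: "j \<in> {1..d}"
    show "dy j (T j) - (\<Sum>\<nu>\<in>Vset m k j. dy \<nu> 0) + (b j - (\<Sum>\<nu>\<in>Vset m k j. b \<nu>)) * y j (T j)
        + (c j - (\<Sum>\<nu>\<in>Vset m k j. c \<nu>)) * y j (T j - \<tau>) = 0" (is "?x = 0")
    proof -
      have "?x = E y dy j (T j) - (\<Sum>\<nu>\<in>Vset m k j. E y dy \<nu> 0)"
        by (rule junction_eq[OF tree_fun_vertex[OF y(1)] j])
      also have "\<dots> = 0" by (rule orthogonal_junction[OF y du j])
      finally show ?thesis .
    qed
  qed
qed

lemma BVP_sol_imp_orthogonal:
  assumes \<phi>: "W21 (- \<tau>) 0 \<phi>" and z: "BVP_sol m d k T \<tau> b c \<phi> z"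
  obtains dz where "feasible \<phi> z dz" "orthogonal z dz"
proof -
  obtain dz0 where f0: "feasible \<phi> z dz0"
    using z admissible_iff by (auto simp: BVP_sol_def)
  note t0 = feasibleD(1)[OF f0]
  from z obtain dy where dy: "\<And>j. j \<in> {1..m} \<Longrightarrow> is_wderiv 0 (T j) (z j) (dy j)"
    and h: "\<And>j. j \<in> {1..m} \<Longrightarrow> \<exists>h. is_wderiv 0 (len j) (E z dy j) h
       \<and> (AE t in lebesgue_on {0<..<len j}. - h t + b j * E z dy j t + ell_tilde m b c \<tau> k T z dy j t = 0)"
    and jn: "\<And>j. j \<in> {1..d} \<Longrightarrow> dy j (T j) - (\<Sum>\<nu>\<in>Vset m k j. dy \<nu> 0)
        + (b j - (\<Sum>\<nu>\<in>Vset m k j. b \<nu>)) * z j (T j)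
        + (c j - (\<Sum>\<nu>\<in>Vset m k j. c \<nu>)) * z j (T j - \<tau>) = 0"
    unfolding BVP_sol_def by blast
  \<comment> \<open>The problem provides \<open>dy\<close> as a derivative on
    \<open>[0, T j]\<close> only; the part on the history is borrowed from admissibility.\<close>
  define dz where "dz j t = (if t < 0 then dz0 j t else dy j t)" for j t
  have t: "tree_fun z dz"
    unfolding tree_fun_def
  proof (intro conjI ballI)
    fix j assume j: "j \<in> {1..m}"
    have "is_wderiv (tleft \<tau> j) (T j) (\<lambda>t. if t < 0 then z j t else z j t) (\<lambda>t. if t < 0 then dz0 j t else dy j t)"
      using T_pos[OF j] tleft_le[of j]
      by (intro is_wderiv_piecewise is_wderiv_subset[OF tree_fun_wderiv[OF t0 j]] dy[OF j]) auto
    then show "is_wderiv (tleft \<tau> j) (T j) (z j) (dz j)"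
      by (simp add: dz_def[abs_def])
  qed (use t0 in \<open>auto simp: tree_fun_def\<close>)
  have Edz: "E z dz j t = E z dy j t" if "0 \<le> t" for j t
    using that by (simp add: ell_def dz_def)
  have adj: "adj (E z dz) j t = adj (E z dy) j t" if "0 \<le> t" for j t
    using that tau by (auto simp: adj_def Edz)
  show ?thesis
  proof (rule that[of dz])
    show "feasible \<phi> z dz" using t f0 by (simp add: feasible_def)
    show "orthogonal z dz"
    proof (rule orthogonal_of_ode[OF t])
      fix j assume j: "j \<in> {1..m}"
      from h[OF j] obtain h where h: "is_wderiv 0 (len j) (E z dy j) h"
        "AE t in lebesgue_on {0<..<len j}. - h t + b j * E z dy j t + ell_tilde m b c \<tau> k T z dy j t = 0"
        by blast
      have "AE t in lebesgue. t \<in> {0<..<len j} \<longrightarrow> h t = src (E z dy) j t"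
        using h(2) by (auto simp: AE_restrict_space_iff src_def ell_tilde_eq_adj elim!: eventually_mono)
      \<comment> \<open>The equation is given on the open interval; its end points form a null
        set.\<close>
      moreover have "AE t in lebesgue. t \<noteq> 0 \<and> t \<noteq> len j"
        using AE_completion[OF AE_lborel_singleton[of 0]] AE_completion[OF AE_lborel_singleton[of "len j"]]
        by eventually_elim simp
      ultimately have "AE t in lebesgue. t \<in> {0..len j} \<longrightarrow> h t = src (E z dz) j t"
        by eventually_elim (auto simp: src_def adj Edz)
      then have ae: "AE t in lebesgue_on {0..len j}. h t = src (E z dz) j t"
        by (simp add: AE_restrict_space_iff)
      show "is_wderiv 0 (len j) (E z dz j) (src (E z dz) j)"
        by (rule is_wderiv_cong[OF h(1) _ ae]) (simp add: Edz)
    next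
      fix j assume j: "j \<in> {1..d}"
      then have "0 \<le> T j" using T_pos[of j] dm by simp
      then show "E z dz j (T j) - (\<Sum>\<nu>\<in>Vset m k j. E z dz \<nu> 0) = 0"
        using jn[OF j] junction_eq[of z j dy, OF tree_fun_vertex[OF t] j] by (simp add: Edz)
    qed
  qed
qed

section \<open>Existence, uniqueness and the bound\<close>

lemma orthogonal_minimal:
  assumes "feasible \<phi> y dy" "orthogonal y dy" "feasible \<phi> z dz"
  shows "energy y dy \<le> energy z dz"
  using orthogonal_energy[OF assms(1) orthogonalD[OF assms(2)] assms(3)] by simp

lemma orthogonal_eq_on_tree:
  assumes "feasible \<phi> y dy" "orthogonal y dy" "feasible \<phi> z dz" "energy z dz \<le> energy y dy"
  shows "eq_on_tree m \<tau> T z y"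
  by (rule orthogonal_unique[OF assms(1) orthogonalD[OF assms(2)] assms(3,4)])

lemma orthogonal_exists:
  assumes "W21 (- \<tau>) 0 \<phi>"
  obtains y dy where "feasible \<phi> y dy" "orthogonal y dy"
proof -
  obtain y0 dy0 where "feasible \<phi> y0 dy0" using feasible_extension assms by metis
  then obtain y dy where y: "feasible \<phi> y dy" "\<And>z dz. feasible \<phi> z dz \<Longrightarrow> energy y dy \<le> energy z dz"
    using minimizer_exists by blast
  show ?thesis
    by (rule that[OF y(1)]) (use minimizer_orthogonal[OF y] in \<open>auto simp: orthogonal_def\<close>)
qed

text \<open>Any two solutions are orthogonal, hence both minimal; equal energy together with
  orthogonality forces them to coincide.\<close>

lemma BVP_unique_solvable:
  assumes \<phi>: "W21 (- \<tau>) 0 \<phi>"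
  shows "\<exists>y. BVP_sol m d k T \<tau> b c \<phi> y \<and> (\<forall>z. BVP_sol m d k T \<tau> b c \<phi> z \<longrightarrow> eq_on_tree m \<tau> T z y)"
proof -
  obtain y dy where y: "feasible \<phi> y dy" "orthogonal y dy" using orthogonal_exists[OF \<phi>] .
  have "eq_on_tree m \<tau> T z y" if z: "BVP_sol m d k T \<tau> b c \<phi> z" for z
  proof -
    obtain dz where "feasible \<phi> z dz" "orthogonal z dz"
      using BVP_sol_imp_orthogonal[OF \<phi> z] .
    then show ?thesis
      using orthogonal_eq_on_tree[OF y] orthogonal_minimal y(1) by blast
  qed
  then show ?thesis using orthogonal_imp_BVP_sol[OF y] by blast
qed

lemma BVP_norm_bound:
  "\<exists>C>0. \<forall>\<phi> y. W21 (- \<tau>) 0 \<phi> \<longrightarrow> BVP_sol m d k T \<tau> b c \<phi> y \<longrightarrow>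
    tree_norm m \<tau> T y \<le> C * W21_norm (- \<tau>) 0 \<phi>"
proof -
  obtain C1 where C1: "0 < C1"
    "\<And>y dy. tree_fun y dy \<Longrightarrow> (tree_norm m \<tau> T y)\<^sup>2 \<le> C1 * (start_norm y dy + energy y dy)"
    using tree_norm_bound by blast
  obtain C where C: "0 \<le> C"
    "\<And>\<phi>. W21 (- \<tau>) 0 \<phi> \<Longrightarrow> \<exists>y dy. feasible \<phi> y dy \<and> energy y dy \<le> C * (W21_norm (- \<tau>) 0 \<phi>)\<^sup>2"
    using feasible_extension by blast
  show ?thesis
  \<comment> \<open>\<open>C1\<close> is the coercivity constant and \<open>1 + C\<close> bounds
    history plus energy of the extension; the root undoes the squared norms.\<close>
  proof (intro exI[of _ "sqrt (C1 * (1 + C))"] conjI allI impI)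
    show "0 < sqrt (C1 * (1 + C))" using C1 C by simp
    fix \<phi> y assume \<phi>: "W21 (- \<tau>) 0 \<phi>" and b: "BVP_sol m d k T \<tau> b c \<phi> y"
    obtain dy where y: "feasible \<phi> y dy" "orthogonal y dy"
      using BVP_sol_imp_orthogonal[OF \<phi> b] .
    obtain z dz where z: "feasible \<phi> z dz" "energy z dz \<le> C * (W21_norm (- \<tau>) 0 \<phi>)\<^sup>2"
      using C(2)[OF \<phi>] by blast
    have "(tree_norm m \<tau> T y)\<^sup>2 \<le> C1 * ((W21_norm (- \<tau>) 0 \<phi>)\<^sup>2 + energy y dy)"
      using C1(2)[OF feasibleD(1)[OF y(1)]] feasible_start_norm[OF y(1)] by simp
    also have "\<dots> \<le> C1 * ((W21_norm (- \<tau>) 0 \<phi>)\<^sup>2 + C * (W21_norm (- \<tau>) 0 \<phi>)\<^sup>2)"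
      using C1(1) orthogonal_minimal[OF y z(1)] z(2) by (intro mult_left_mono) auto
    also have "\<dots> = (sqrt (C1 * (1 + C)) * W21_norm (- \<tau>) 0 \<phi>)\<^sup>2"
      using C1(1) C(1) by (simp add: power_mult_distrib distrib_left distrib_right mult.assoc)
    finally show "tree_norm m \<tau> T y \<le> sqrt (C1 * (1 + C)) * W21_norm (- \<tau>) 0 \<phi>"
      by (rule power2_le_imp_le) (use C1(1) C(1) in \<open>simp add: W21_norm_def\<close>)
  qed
qed

text \<open>The orthogonal function that solves the boundary value problem is a minimizer, and any
  other minimizer has no more energy than it, hence equals it.\<close>

lemma VP_unique_solvable:
  assumes \<phi>: "W21 (- \<tau>) 0 \<phi>"
  shows "\<exists>y. VP_sol m d k T \<tau> b c \<phi> y \<and> (\<forall>z. VP_sol m d k T \<tau> b c \<phi> z \<longrightarrow> eq_on_tree m \<tau> T z y)"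
proof -
  obtain y dy where y: "feasible \<phi> y dy" "orthogonal y dy" using orthogonal_exists[OF \<phi>] .
  have J: "Jfun m b c \<tau> k T z = energy z dz" if "feasible \<phi> z dz" for z dz
    by (rule Jfun_eq_energy[OF feasibleD(1)[OF that]])
  have "VP_sol m d k T \<tau> b c \<phi> y"
    unfolding VP_sol_def admissible_iff using y orthogonal_minimal[OF y] J by auto
  moreover have "eq_on_tree m \<tau> T z y" if z: "VP_sol m d k T \<tau> b c \<phi> z" for z
  proof -
    obtain dz where f: "feasible \<phi> z dz" using z admissible_iff by (auto simp: VP_sol_def)
    have "Jfun m b c \<tau> k T z \<le> Jfun m b c \<tau> k T y"
      using z y(1) admissible_iff unfolding VP_sol_def by blast
    then show ?thesis
      using orthogonal_eq_on_tree[OF y f] J[OF f] J[OF y(1)] by simp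
  qed
  ultimately show ?thesis by blast
qed

end

theorem theorem2:
  fixes m d :: nat and k :: "nat \<Rightarrow> nat" and T b c :: "nat \<Rightarrow> real" and \<tau> :: real
  assumes "m \<ge> 1" and "d < m"
    and "k 1 = 0" and "\<forall>j\<in>{2..m}. k j \<in> {1..d}"
    and "\<forall>j\<in>{1..m}. \<exists>n. (k ^^ n) j = 1"
    and "\<forall>j\<in>{1..d}. Vset m k j \<noteq> {}"
    and "\<forall>j\<in>{1..m}. 0 < T j \<and> \<tau> < T j"
    and "0 < \<tau>"
  shows "(\<forall>\<phi>. W21 (- \<tau>) 0 \<phi> \<longrightarrow>
            (\<exists>y. BVP_sol m d k T \<tau> b c \<phi> y
                 \<and> (\<forall>z. BVP_sol m d k T \<tau> b c \<phi> z \<longrightarrow> eq_on_tree m \<tau> T z y)))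
       \<and> (\<exists>C2 > 0. \<forall>\<phi> y. W21 (- \<tau>) 0 \<phi> \<longrightarrow> BVP_sol m d k T \<tau> b c \<phi> y \<longrightarrow>
            tree_norm m \<tau> T y \<le> C2 * W21_norm (- \<tau>) 0 \<phi>)
       \<and> (\<forall>\<phi>. W21 (- \<tau>) 0 \<phi> \<longrightarrow>
            (\<exists>y. VP_sol m d k T \<tau> b c \<phi> y
                 \<and> (\<forall>z. VP_sol m d k T \<tau> b c \<phi> z \<longrightarrow> eq_on_tree m \<tau> T z y)))"
proof -
  interpret delay_tree m d k T b c \<tau>
    by unfold_locales (use assms in auto)
  show ?thesis
    using BVP_unique_solvable BVP_norm_bound VP_unique_solvable by blast
qed

end
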